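(* The automorphism group of the colorful $(n+1)$-cyclohedron satisfies $\Gamma(\mathcal{Z}^{c}_n)\cong S_n\times D_{n+2}$ when $n>1$, and $\Gamma(\mathcal{Z}^{c}_n)\cong D_6$ when $n=1$. Here $S_n$ is the symmetric group of degree $n$ and $D_m$ denotes the dihedral group of order $2m$.
   Context: Let $K$ be a centrally symmetric convex $(2n+4)$-gon with center $o$; a diagonal is central if it passes through $o$. Centrally symmetric triangulations of $K$ have exactly one central diagonal and $n$ centrally symmetric pairs of non-central diagonals. A colored such triangulation assigns colors from an $n$-element set $C(K)$ to the non-central diagonals, both diagonals of a symmetric pair receiving the same color and distinct pairs distinct colors; the central diagonal is uncolored. A flip either flips the central diagonal (replacing it by the other diagonal of the quadrilateral formed by its two adjacent triangles), or flips both diagonals of a symmetric pair simultaneously preserving their color; a flip of the central diagonal is labeled with an extra color $c^*$. With $C^*=C(K)\cup\{c^*\}$ and $C\subseteq C^*$, $t\sim_C t'$ means $t'$ is reachable from $t$ by flips with labels in $C$. The colorful cyclohedron $\mathcal{Z}^{c}_n$ is the abstract polytope consisting of a least element and the faces $(C,X)$, $C\subseteq C^*$, $X$ a $\sim_C$-class, of rank $|C|$, ordered by $(C,X)\le(C',X')$ iff $C\subseteq C'$ and $X\subseteq X'$. $\Gamma(\mathcal{Z}^{c}_n)$ is its group of order-preserving bijections. *)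

theory Defs
  imports
    "HOL-Analysis.Analysis"
    "HOL-Algebra.Order"
    "HOL-Algebra.Bij"
    "HOL-Algebra.Sym_Groups"
begin

section \<open>Convex polygons, diagonals and triangulations\<close>

text \<open>
  A convex polygon with \<open>m\<close> sides is given by its vertices \<open>v 0, \<dots>, v (m - 1)\<close> in the complex
  plane, listed counterclockwise. No three vertices are collinear, so all of them are
  genuine corners. Values of \<open>v\<close> at indices from \<open>m\<close> on are irrelevant.
\<close>

definition ccw :: "complex \<Rightarrow> complex \<Rightarrow> complex \<Rightarrow> bool" where
  "ccw a b c \<longleftrightarrow> Im (cnj (b - a) * (c - a)) > 0"

definition convex_polygon :: "nat \<Rightarrow> (nat \<Rightarrow> complex) \<Rightarrow> bool" where
  "convex_polygon m v \<longleftrightarrow>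
     m \<ge> 3 \<and> (\<forall>i j k. i < j \<and> j < k \<and> k < m \<longrightarrow> ccw (v i) (v j) (v k))"

definition vertices :: "nat \<Rightarrow> (nat \<Rightarrow> complex) \<Rightarrow> complex set" where
  "vertices m v = v ` {..<m}"

definition point_reflection :: "complex \<Rightarrow> complex \<Rightarrow> complex" where
  "point_reflection c x = 2 * c - x"

definition cs_convex_polygon :: "nat \<Rightarrow> (nat \<Rightarrow> complex) \<Rightarrow> complex \<Rightarrow> bool" where
  "cs_convex_polygon m v c \<longleftrightarrow>
     convex_polygon m v \<and> point_reflection c ` vertices m v = vertices m v"

text \<open>Sides and diagonals are segments, i.e. sets of points of the plane.\<close>

definition sides :: "nat \<Rightarrow> (nat \<Rightarrow> complex) \<Rightarrow> complex set set" where
  "sides m v = {closed_segment (v i) (v (Suc i mod m)) | i. i < m}"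

definition diagonals :: "nat \<Rightarrow> (nat \<Rightarrow> complex) \<Rightarrow> complex set set" where
  "diagonals m v =
     {closed_segment a b | a b. a \<in> vertices m v \<and> b \<in> vertices m v \<and> a \<noteq> b} - sides m v"

definition noncrossing :: "complex set \<Rightarrow> complex set \<Rightarrow> bool" where
  "noncrossing d e \<longleftrightarrow> disjnt (rel_interior d) (rel_interior e)"

text \<open>
  A triangulation is identified with its set of diagonals: a maximal set of pairwise
  noncrossing diagonals.
\<close>

definition triangulation :: "nat \<Rightarrow> (nat \<Rightarrow> complex) \<Rightarrow> complex set set \<Rightarrow> bool" where
  "triangulation m v t \<longleftrightarrow>
     t \<subseteq> diagonals m v \<and> pairwise noncrossing t \<and>
     (\<forall>t'. t \<subseteq> t' \<and> t' \<subseteq> diagonals m v \<and> pairwise noncrossing t' \<longrightarrow> t' = t)"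

abbreviation opposite :: "complex \<Rightarrow> complex set \<Rightarrow> complex set" where
  "opposite c d \<equiv> point_reflection c ` d"

definition cs_triangulation ::
    "nat \<Rightarrow> (nat \<Rightarrow> complex) \<Rightarrow> complex \<Rightarrow> complex set set \<Rightarrow> bool" where
  "cs_triangulation m v c t \<longleftrightarrow> triangulation m v t \<and> opposite c ` t = t"

definition central :: "complex \<Rightarrow> complex set \<Rightarrow> bool" where
  "central c d \<longleftrightarrow> c \<in> d"

text \<open>
  The two triangles of \<open>t\<close> adjacent to its diagonal \<open>d\<close>, with end points \<open>p\<close> and \<open>q\<close>, are
  \<open>p q r\<close> and \<open>p q s\<close>; the diagonal \<open>d'\<close> from \<open>r\<close> to \<open>s\<close> is the other diagonal of
  the quadrilateral \<open>p r q s\<close>. The triangles lie on different sides of \<open>d\<close> because \<open>d'\<close> crosses \<open>d\<close>.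
\<close>

definition other_diagonal ::
    "nat \<Rightarrow> (nat \<Rightarrow> complex) \<Rightarrow> complex set set \<Rightarrow> complex set \<Rightarrow> complex set \<Rightarrow> bool" where
  "other_diagonal m v t d d' \<longleftrightarrow>
     (\<exists>p\<in>vertices m v. \<exists>q\<in>vertices m v. \<exists>r\<in>vertices m v. \<exists>s\<in>vertices m v.
        d = closed_segment p q \<and> d \<in> t \<and>
        d' = closed_segment r s \<and> \<not> noncrossing d d' \<and>
        {closed_segment p r, closed_segment r q, closed_segment q s, closed_segment s p}
          \<subseteq> t \<union> sides m v)"

section \<open>Colored triangulations and flips\<close>

text \<open>
  A colored triangulation is a pair of a triangulation and a partial map that assigns colors
  to exactly its noncentral diagonals.
\<close>

type_synonym 'c colored_triangulation = "complex set set \<times> (complex set \<rightharpoonup> 'c)"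

definition colored_triangulations ::
    "nat \<Rightarrow> (nat \<Rightarrow> complex) \<Rightarrow> complex \<Rightarrow> 'c set \<Rightarrow> 'c colored_triangulation set" where
  "colored_triangulations m v c Col =
     {(t, \<kappa>). cs_triangulation m v c t \<and>
        dom \<kappa> = {d \<in> t. \<not> central c d} \<and> ran \<kappa> \<subseteq> Col \<and>
        (\<forall>d\<in>dom \<kappa>. \<forall>e\<in>dom \<kappa>. \<kappa> d = \<kappa> e \<longleftrightarrow> e = d \<or> e = opposite c d)}"

text \<open>Flip labels: \<open>None\<close> is the extra color of central flips, \<open>Some a\<close> is the color \<open>a\<close>.\<close>

definition labels :: "'c set \<Rightarrow> 'c option set" where
  "labels Col = insert None (Some ` Col)"

inductive flip ::
    "nat \<Rightarrow> (nat \<Rightarrow> complex) \<Rightarrow> complex \<Rightarrow> 'c option \<Rightarrow>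
     'c colored_triangulation \<Rightarrow> 'c colored_triangulation \<Rightarrow> bool"
  for m v c where
  central_flip:
    "\<lbrakk>central c d; other_diagonal m v t d d'\<rbrakk>
     \<Longrightarrow> flip m v c None (t, \<kappa>) (insert d' (t - {d}), \<kappa>)"
| pair_flip:
    "\<lbrakk>\<not> central c d; \<kappa> d = Some a; other_diagonal m v t d d'\<rbrakk>
     \<Longrightarrow> flip m v c (Some a) (t, \<kappa>)
           ((t - {d, opposite c d}) \<union> {d', opposite c d'},
            \<kappa>(d := None, opposite c d := None, d' \<mapsto> a, opposite c d' \<mapsto> a))"

definition flip_equiv ::
    "nat \<Rightarrow> (nat \<Rightarrow> complex) \<Rightarrow> complex \<Rightarrow> 'c set \<Rightarrow> 'c option set \<Rightarrow>
     ('c colored_triangulation \<times> 'c colored_triangulation) set" where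
  "flip_equiv m v c Col L =
     Restr ({(x, y). \<exists>l\<in>L. flip m v c l x y}\<^sup>*) (colored_triangulations m v c Col)"

section \<open>The colorful cyclohedron\<close>

text \<open>The least element is \<open>None\<close>; the face \<open>(L, X)\<close> of rank \<open>card L\<close> is \<open>Some (L, X)\<close>.\<close>

type_synonym 'c face = "('c option set \<times> 'c colored_triangulation set) option"

fun face_le :: "'c face \<Rightarrow> 'c face \<Rightarrow> bool" where
  "face_le None _ \<longleftrightarrow> True"
| "face_le (Some _) None \<longleftrightarrow> False"
| "face_le (Some (L, X)) (Some (L', X')) \<longleftrightarrow> L \<subseteq> L' \<and> X \<subseteq> X'"

definition colorful_cyclohedron ::
    "nat \<Rightarrow> (nat \<Rightarrow> complex) \<Rightarrow> complex \<Rightarrow> 'c set \<Rightarrow> 'c face gorder" where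
  "colorful_cyclohedron m v c Col =
     \<lparr>carrier = insert None {Some (L, X) | L X.
        L \<subseteq> labels Col \<and> X \<in> colored_triangulations m v c Col // flip_equiv m v c Col L},
      eq = (=),
      le = face_le\<rparr>"

lemma face_le_refl: "face_le x x"
  by (cases x) auto

lemma face_le_antisym: "face_le x y \<Longrightarrow> face_le y x \<Longrightarrow> x = y"
  by (cases x; cases y) auto

lemma face_le_trans: "face_le x y \<Longrightarrow> face_le y z \<Longrightarrow> face_le x z"
  by (cases x; cases y; cases z) (auto, blast+)

lemma partial_order_colorful_cyclohedron:
  "partial_order (colorful_cyclohedron m v c Col)"
  by unfold_locales
    (auto simp: colorful_cyclohedron_def intro: face_le_refl face_le_antisym face_le_trans)

definition order_automorphism_group :: "('a, 'b) gorder_scheme \<Rightarrow> ('a \<Rightarrow> 'a) monoid" where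
  "order_automorphism_group P =
     (BijGroup (carrier P))
       \<lparr>carrier := {f \<in> Bij (carrier P).
          \<forall>x\<in>carrier P. \<forall>y\<in>carrier P. le P (f x) (f y) \<longleftrightarrow> le P x y}\<rparr>"

lemma group_order_automorphism_group: "group (order_automorphism_group P)"
proof -
  let ?S = "carrier P"
  let ?A = "{f \<in> Bij ?S. \<forall>x\<in>?S. \<forall>y\<in>?S. le P (f x) (f y) \<longleftrightarrow> le P x y}"
  interpret B: group "BijGroup ?S" by (rule group_BijGroup)
  have "subgroup ?A (BijGroup ?S)"
  proof (rule B.subgroupI)
    show "?A \<subseteq> carrier (BijGroup ?S)" by (auto simp: BijGroup_def)
    have "(\<lambda>x\<in>?S. x) \<in> ?A" by (simp add: id_Bij)
    then show "?A \<noteq> {}" by blast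
  next
    fix f assume f: "f \<in> ?A"
    then have bij: "bij_betw f ?S ?S" by (simp add: Bij_def)
    have inv: "inv_into ?S f x \<in> ?S" "f (inv_into ?S f x) = x" if "x \<in> ?S" for x
      using bij that by (auto simp: bij_betw_def inv_into_into f_inv_into_f)
    have "restrict (inv_into ?S f) ?S \<in> ?A"
    proof (intro CollectI conjI ballI)
      show "restrict (inv_into ?S f) ?S \<in> Bij ?S"
        using f by (simp add: restrict_inv_into_Bij)
      fix x y assume xy: "x \<in> ?S" "y \<in> ?S"
      have "le P (f (inv_into ?S f x)) (f (inv_into ?S f y)) \<longleftrightarrow>
            le P (inv_into ?S f x) (inv_into ?S f y)"
        using f inv(1) xy by blast
      then show "le P (restrict (inv_into ?S f) ?S x) (restrict (inv_into ?S f) ?S y) \<longleftrightarrow> le P x y"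
        using xy inv(2) by simp
    qed
    then show "inv\<^bsub>BijGroup ?S\<^esub> f \<in> ?A"
      using f by (simp add: inv_BijGroup)
  next
    fix f g assume f: "f \<in> ?A" and g: "g \<in> ?A"
    then have "g x \<in> ?S" if "x \<in> ?S" for x
      using that Bij_imp_funcset by blast
    then have "compose ?S f g \<in> ?A"
      using f g by (auto simp: compose_Bij compose_eq)
    then show "f \<otimes>\<^bsub>BijGroup ?S\<^esub> g \<in> ?A"
      using f g by (simp add: BijGroup_def)
  qed
  then show ?thesis
    unfolding order_automorphism_group_def by (rule B.subgroup_imp_group)
qed

section \<open>Dihedral groups\<close>

text \<open>
  The dihedral group of order \<open>2 * m\<close> as a semidirect product: \<open>(i, False)\<close> is the \<open>i\<close>-th power
  of the basic rotation, and \<open>(i, True)\<close> is the fixed reflection followed by that rotation.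
\<close>

definition dihedral_group :: "nat \<Rightarrow> (int \<times> bool) monoid" where
  "dihedral_group m =
     \<lparr>carrier = {0..<int m} \<times> UNIV,
      mult = (\<lambda>(i, s) (j, t). ((if s then i - j else i + j) mod int m, s \<noteq> t)),
      one = (0, False)\<rparr>"

lemma order_dihedral_group: "order (dihedral_group m) = 2 * m"
  by (simp add: order_def dihedral_group_def card_cartesian_product)

lemma group_dihedral_group:
  assumes "m > 0"
  shows "group (dihedral_group m)"
proof (rule groupI)
  fix x y z
  show "x \<otimes>\<^bsub>dihedral_group m\<^esub> y \<otimes>\<^bsub>dihedral_group m\<^esub> z
      = x \<otimes>\<^bsub>dihedral_group m\<^esub> (y \<otimes>\<^bsub>dihedral_group m\<^esub> z)"
    by (cases x; cases y; cases z) (auto simp: dihedral_group_def mod_simps algebra_simps)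
next
  fix x assume x: "x \<in> carrier (dihedral_group m)"
  obtain i s where x_eq: "x = (i, s)" by (cases x)
  have "((if s then i else (- i) mod int m), s) \<otimes>\<^bsub>dihedral_group m\<^esub> x = \<one>\<^bsub>dihedral_group m\<^esub>"
    using assms by (simp add: x_eq dihedral_group_def mod_simps)
  moreover have "((if s then i else (- i) mod int m), s) \<in> carrier (dihedral_group m)"
    using assms x by (auto simp: x_eq dihedral_group_def)
  ultimately show "\<exists>y\<in>carrier (dihedral_group m). y \<otimes>\<^bsub>dihedral_group m\<^esub> x = \<one>\<^bsub>dihedral_group m\<^esub>"
    by blast
qed (use assms in \<open>auto simp: dihedral_group_def\<close>)

end

theory Submission
  imports Defs "HOL-Library.Tree"
begin

text \<open>
  An automorphism of the poset permutes the vertices, that is, the colored triangulations. The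
  edges at a vertex correspond to the flip labels, and since neighboring vertices share the
  faces of rank two through their common edge, the induced permutation of the labels is the same
  at every vertex. So automorphisms are pairs of a label permutation \<open>p\<close> and a bijection \<open>g\<close> that
  turns flips with label \<open>l\<close> into flips with label \<open>p l\<close>; as the flip graph is connected, such a
  pair is determined by \<open>p\<close> and the image of one triangulation.

  For \<open>n > 1\<close> the permutation \<open>p\<close> fixes the central label: a central and a colored flip
  commute or satisfy the braid relation at every triangulation, while two colored flips may do
  neither. If \<open>p\<close> is the identity, take a zigzag triangulation \<open>x\<close>. Adjacent diagonals are those
  whose flips do not commute, so \<open>g x\<close> has the same adjacencies as \<open>x\<close>, also after one further
  flip; this forces \<open>g x\<close> to be a zigzag with the same sequence of colors, i.e. an image of \<open>x\<close>
  under a symmetry of the polygon. For \<open>n = 1\<close> the flip graph is a hexagon with alternating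
  labels, all of whose symmetries are automorphisms.
\<close>

section \<open>Automorphisms and flips\<close>

text \<open>The dihedral factor has order 2(n + 2) although the polygon has 2n + 4 vertices, because
  the central reflection fixes every centrally symmetric triangulation. For the same reason half of
  the polygon carries all information: positions count modulo n + 2, and the half is a binary tree
  with the central diagonal at its root. The relations used are those of the faces of rank two.
  Flips of diagonals without a common triangle give a square. A central and an adjacent colored flip
  live in a centrally symmetric hexagon and give a 6-cycle, hence the braid relation. Two adjacent
  colored flips live in a pentagon; five alternate flips restore the diagonals but exchange the
  colors, which gives a 10-cycle, where neither relation holds. For n = 1 only the 6-cycle is
  present, so nothing separates the central label from the color and the group D_3 expected from the
  polygon grows to D_6. The geometric work shows that flips in the plane are exactly the operations
  \<open>mflip\<close> on trees; it enters only through \<open>cyclohedron_model\<close>.\<close>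

definition orb :: "('l \<Rightarrow> 'x \<Rightarrow> 'x) \<Rightarrow> 'l set \<Rightarrow> 'x \<Rightarrow> 'x set" where
  "orb F L x = {y. (x, y) \<in> {(u, w). \<exists>l\<in>L. w = F l u}\<^sup>*}"

lemma orb_refl [simp]: "x \<in> orb F L x"
  by (simp add: orb_def)

lemma orb_step: "y \<in> orb F L x \<Longrightarrow> l \<in> L \<Longrightarrow> F l y \<in> orb F L x"
  unfolding orb_def by (auto intro: rtrancl_into_rtrancl)

lemma orb_trans: "y \<in> orb F L x \<Longrightarrow> z \<in> orb F L y \<Longrightarrow> z \<in> orb F L x"
  unfolding orb_def by auto

lemma orb_induct [consumes 1, case_names base step]:
  assumes "y \<in> orb F L x" "Q x" "\<And>z l. z \<in> orb F L x \<Longrightarrow> Q z \<Longrightarrow> l \<in> L \<Longrightarrow> Q (F l z)"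
  shows "Q y"
proof -
  have "(x, y) \<in> {(u, w). \<exists>l\<in>L. w = F l u}\<^sup>*" using assms(1) by (simp add: orb_def)
  then show ?thesis
    by (induction rule: rtrancl_induct) (use assms(2,3) in \<open>auto simp: orb_def\<close>)
qed

lemma orb_mono: "L \<subseteq> L' \<Longrightarrow> orb F L x \<subseteq> orb F L' x"
proof
  fix y assume "L \<subseteq> L'" "y \<in> orb F L x"
  from this(2) show "y \<in> orb F L' x"
    by (induction rule: orb_induct) (use \<open>L \<subseteq> L'\<close> in \<open>auto intro: orb_step\<close>)
qed

lemma orb_empty [simp]: "orb F {} x = {x}"
  by (auto simp: orb_def)

section \<open>Systems of involutive flips and their label-permuting symmetries\<close>

locale flip_system =
  fixes X :: "'x set" and Lab :: "'l set" and F :: "'l \<Rightarrow> 'x \<Rightarrow> 'x"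
  assumes F_closed: "l \<in> Lab \<Longrightarrow> x \<in> X \<Longrightarrow> F l x \<in> X"
    and F_invol: "l \<in> Lab \<Longrightarrow> x \<in> X \<Longrightarrow> F l (F l x) = x"
    and connected: "x \<in> X \<Longrightarrow> y \<in> X \<Longrightarrow> y \<in> orb F Lab x"
begin

lemma orb_closed: "L \<subseteq> Lab \<Longrightarrow> x \<in> X \<Longrightarrow> y \<in> orb F L x \<Longrightarrow> y \<in> X"
  by (erule orb_induct) (auto intro: F_closed)

lemma orb_sym:
  assumes "L \<subseteq> Lab" "x \<in> X" "y \<in> orb F L x"
  shows "x \<in> orb F L y"
  using assms(3)
proof (induction rule: orb_induct)
  case (step z l)
  then have "z \<in> X" using assms orb_closed by blast
  then have "F l (F l z) = z" using F_invol step assms by blast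
  then have "z \<in> orb F L (F l z)" using orb_step[where F=F, OF orb_refl step.hyps(2), of "F l z"] by simp
  then show ?case using step by (metis orb_trans)
qed simp

lemma orb_eq:
  assumes "L \<subseteq> Lab" "x \<in> X" "y \<in> orb F L x"
  shows "orb F L y = orb F L x"
  using orb_trans[OF orb_sym[OF assms]] orb_trans[OF assms(3)] by blast

lemma orb_single:
  assumes "l \<in> Lab" "x \<in> X"
  shows "orb F {l} x = {x, F l x}"
proof
  show "orb F {l} x \<subseteq> {x, F l x}"
  proof
    fix y assume "y \<in> orb F {l} x"
    then show "y \<in> {x, F l x}"
      by (induction rule: orb_induct) (use assms F_invol in auto)
  qed
qed (auto intro: orb_step)

definition compat :: "('l \<Rightarrow> 'l) \<Rightarrow> ('x \<Rightarrow> 'x) \<Rightarrow> bool" where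
  "compat p g \<longleftrightarrow> bij_betw p Lab Lab \<and> bij_betw g X X \<and>
     (\<forall>l\<in>Lab. \<forall>x\<in>X. g (F l x) = F (p l) (g x))"

lemma compat_orb:
  assumes c: "compat p g" and "L \<subseteq> Lab" "x \<in> X"
  shows "orb F (p ` L) (g x) = g ` orb F L x"
proof
  have F: "g (F l z) = F (p l) (g z)" if "l \<in> L" "z \<in> X" for l z
    using c that assms by (auto simp: compat_def)
  show "orb F (p ` L) (g x) \<subseteq> g ` orb F L x"
  proof
    fix y assume "y \<in> orb F (p ` L) (g x)"
    then show "y \<in> g ` orb F L x"
    proof (induction rule: orb_induct)
      case (step z l)
      then obtain z' l' where "z' \<in> orb F L x" "z = g z'" "l' \<in> L" "l = p l'" by auto
      moreover have "z' \<in> X" using calculation assms orb_closed by blast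
      ultimately show ?case using F orb_step by (metis imageI)
    qed simp
  qed
  show "g ` orb F L x \<subseteq> orb F (p ` L) (g x)"
  proof clarify
    fix y assume "y \<in> orb F L x"
    then show "g y \<in> orb F (p ` L) (g x)"
    proof (induction rule: orb_induct)
      case (step z l)
      moreover have "z \<in> X" using calculation assms orb_closed by blast
      ultimately show ?case using F orb_step by (metis imageI)
    qed simp
  qed
qed

lemma compat_eqI:
  assumes "compat p g" "compat q h" "\<And>l. l \<in> Lab \<Longrightarrow> p l = q l" "x0 \<in> X" "g x0 = h x0" "x \<in> X"
  shows "g x = h x"
proof -
  have "x \<in> orb F Lab x0" using connected assms by blast
  then show ?thesis
  proof (induction rule: orb_induct)
    case (step z l)
    then have "z \<in> X" using orb_closed assms(4) by blast
    then show ?case using assms step by (simp add: compat_def)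
  qed (use assms in simp)
qed

end

text \<open>The states are kept abstract because the poset is modelled twice: by labeled trees, and
  for a single color by the integers modulo 6.\<close>

locale cyclohedron_model = flip_system X "labels Col" F
  for X :: "'x set" and Col :: "'c set" and F :: "'c option \<Rightarrow> 'x \<Rightarrow> 'x" +
  fixes m :: nat and v :: "nat \<Rightarrow> complex" and c :: complex
    and enc :: "'x \<Rightarrow> 'c colored_triangulation"
  assumes bij_enc: "bij_betw enc X (colored_triangulations m v c Col)"
    and flip_enc: "l \<in> labels Col \<Longrightarrow> x \<in> X \<Longrightarrow> flip m v c l (enc x) y \<longleftrightarrow> y = enc (F l x)"
begin

abbreviation "Lab \<equiv> labels Col"
abbreviation "P \<equiv> colorful_cyclohedron m v c Col"

section \<open>Faces as flip orbits\<close>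

definition face :: "'c option set \<Rightarrow> 'x \<Rightarrow> 'c face" where
  "face L x = Some (L, enc ` orb F L x)"

lemma inj_enc: "x \<in> X \<Longrightarrow> y \<in> X \<Longrightarrow> enc x = enc y \<longleftrightarrow> x = y"
  using bij_enc by (auto simp: bij_betw_def inj_on_def)

lemma enc_in_iff: "L \<subseteq> Lab \<Longrightarrow> x \<in> X \<Longrightarrow> y \<in> X \<Longrightarrow> enc y \<in> enc ` orb F L x \<longleftrightarrow> y \<in> orb F L x"
  using inj_enc orb_closed by blast

text \<open>Flips with labels in \<open>L\<close> lead from encoded states to encoded states only,
  so the restriction to colored triangulations in \<open>flip_equiv\<close> cuts no path.\<close>

lemma flip_class:
  assumes "L \<subseteq> Lab" "x \<in> X"
  shows "flip_equiv m v c Col L `` {enc x} = enc ` orb F L x"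
proof -
  let ?R = "{(x, y). \<exists>l\<in>L. flip m v c l x y}"
  have "y \<in> enc ` orb F L x" if "(enc x, y) \<in> ?R\<^sup>*" for y
    using that
  proof (induction rule: rtrancl_induct)
    case (step y z)
    then obtain y' where y': "y' \<in> orb F L x" "y = enc y'" by auto
    obtain l where l: "l \<in> L" "flip m v c l y z" using step by auto
    have "y' \<in> X" using y' assms orb_closed by blast
    then have "z = enc (F l y')" using flip_enc l y' assms by blast
    then show ?case using orb_step l y' by fastforce
  qed simp
  moreover have "(enc x, enc y) \<in> ?R\<^sup>*" if "y \<in> orb F L x" for y
    using that
  proof (induction rule: orb_induct)
    case (step z l)
    then have "z \<in> X" using assms orb_closed by blast
    then have "flip m v c l (enc z) (enc (F l z))" using flip_enc step assms by blast
    then show ?case using step by (auto intro: rtrancl_into_rtrancl)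
  qed simp
  moreover have "enc y \<in> colored_triangulations m v c Col" if "y \<in> orb F L x" for y
    using that bij_enc assms orb_closed[of L x y] by (auto simp: bij_betw_def)
  moreover have "enc x \<in> colored_triangulations m v c Col"
    using bij_enc assms by (auto simp: bij_betw_def)
  ultimately show ?thesis
    unfolding flip_equiv_def by (auto simp: Image_def)
qed

lemma carrier_P: "carrier P = insert None {face L x | L x. L \<subseteq> Lab \<and> x \<in> X}"
proof -
  have Q: "colored_triangulations m v c Col // flip_equiv m v c Col L = (\<lambda>x. enc ` orb F L x) ` X"
    if "L \<subseteq> Lab" for L
  proof -
    have "colored_triangulations m v c Col // flip_equiv m v c Col L
        = (\<lambda>y. flip_equiv m v c Col L `` {y}) ` (enc ` X)"
      using bij_enc by (auto simp: quotient_def bij_betw_def)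
    then show ?thesis using flip_class[OF that] by (auto simp: image_image)
  qed
  define B where "B = {face L x | L x. L \<subseteq> Lab \<and> x \<in> X}"
  have "Some (L, Z) \<in> B \<longleftrightarrow>
      L \<subseteq> Lab \<and> Z \<in> colored_triangulations m v c Col // flip_equiv m v c Col L" for L Z
    using Q by (cases "L \<subseteq> Lab") (auto simp: face_def B_def)
  moreover have "None \<notin> B" by (simp add: face_def B_def)
  ultimately have "z \<in> B \<longleftrightarrow> (\<exists>L Z. z = Some (L, Z) \<and>
      L \<subseteq> Lab \<and> Z \<in> colored_triangulations m v c Col // flip_equiv m v c Col L)" for z
    by (cases z) auto
  then have "B = {Some (L, Z) | L Z. L \<subseteq> Lab \<and>
      Z \<in> colored_triangulations m v c Col // flip_equiv m v c Col L}"
    by blast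
  then show ?thesis
    by (simp add: colorful_cyclohedron_def B_def)
qed

text \<open>For \<open>L\<close> inside \<open>L'\<close> an orbit of \<open>L\<close> lies in one
  orbit of \<open>L'\<close>, so a single common element decides containment.\<close>

lemma face_le_face:
  assumes "L \<subseteq> Lab" "L' \<subseteq> Lab" "x \<in> X" "y \<in> X"
  shows "face_le (face L x) (face L' y) \<longleftrightarrow> L \<subseteq> L' \<and> x \<in> orb F L' y"
proof -
  have "enc ` orb F L x \<subseteq> enc ` orb F L' y \<longleftrightarrow> x \<in> orb F L' y" if "L \<subseteq> L'"
  proof
    assume "enc ` orb F L x \<subseteq> enc ` orb F L' y"
    then have "enc x \<in> enc ` orb F L' y" using imageI[OF orb_refl, of enc x F L] by blast
    then show "x \<in> orb F L' y" using assms enc_in_iff by blast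
  next
    assume x: "x \<in> orb F L' y"
    have "orb F L x \<subseteq> orb F L' y" using orb_mono[OF that, of F x] orb_trans[OF x] by blast
    then show "enc ` orb F L x \<subseteq> enc ` orb F L' y" by (rule image_mono)
  qed
  then show ?thesis by (auto simp: face_def)
qed

lemma face_eq:
  assumes "L \<subseteq> Lab" "L' \<subseteq> Lab" "x \<in> X" "y \<in> X"
  shows "face L x = face L' y \<longleftrightarrow> L = L' \<and> x \<in> orb F L' y"
proof
  assume "face L x = face L' y"
  then show "L = L' \<and> x \<in> orb F L' y"
    using face_le_face[OF assms] face_le_refl[of "face L' y"] by (auto simp: face_def)
next
  assume "L = L' \<and> x \<in> orb F L' y"
  then show "face L x = face L' y"
    using orb_eq[OF assms(2,4), of x] by (simp add: face_def)
qed

lemma le_P [simp]: "le P = face_le"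
  by (simp add: colorful_cyclohedron_def)

lemma face_in: "L \<subseteq> Lab \<Longrightarrow> x \<in> X \<Longrightarrow> face L x \<in> carrier P"
  unfolding carrier_P by blast

lemma carrier_cases [consumes 1, case_names None face]:
  assumes "z \<in> carrier P"
  obtains "z = None" | L x where "z = face L x" "L \<subseteq> Lab" "x \<in> X"
  using assms unfolding carrier_P by blast

section \<open>Compatible pairs and automorphisms of the poset\<close>

definition auto_of :: "('c option \<Rightarrow> 'c option) \<Rightarrow> ('x \<Rightarrow> 'x) \<Rightarrow> 'c face \<Rightarrow> 'c face" where
  "auto_of p g = (\<lambda>z\<in>carrier P. case z of None \<Rightarrow> None
     | Some (L, Z) \<Rightarrow> Some (p ` L, (\<lambda>y. enc (g (inv_into X enc y))) ` Z))"

lemma auto_of_None [simp]: "auto_of p g None = None"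
  by (simp add: auto_of_def carrier_P)

lemma auto_of_face:
  assumes "compat p g" "L \<subseteq> Lab" "x \<in> X"
  shows "auto_of p g (face L x) = face (p ` L) (g x)"
proof -
  have "inv_into X enc (enc y) = y" if "y \<in> orb F L x" for y
    using that assms orb_closed bij_enc by (metis bij_betw_def inv_into_f_f)
  then have "(\<lambda>y. enc (g (inv_into X enc y))) ` enc ` orb F L x = enc ` g ` orb F L x"
    by (auto simp: image_image)
  then show ?thesis
    using assms face_in[of L x] compat_orb[OF assms]
    by (simp add: auto_of_def face_def)
qed

lemma compat_facts:
  assumes "compat p g"
  shows "x \<in> X \<Longrightarrow> g x \<in> X" "L \<subseteq> Lab \<Longrightarrow> p ` L \<subseteq> Lab"
  using assms by (auto simp: compat_def bij_betw_def)

lemma compat_image_subset: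
  assumes "compat p g" "L \<subseteq> Lab" "L' \<subseteq> Lab"
  shows "p ` L \<subseteq> p ` L' \<longleftrightarrow> L \<subseteq> L'"
  using assms by (auto simp: compat_def bij_betw_def inj_on_image_subset_iff)

lemma compat_in_orb:
  assumes "compat p g" "L \<subseteq> Lab" "x \<in> X" "y \<in> X"
  shows "g x \<in> orb F (p ` L) (g y) \<longleftrightarrow> x \<in> orb F L y"
proof -
  have "inj_on g X" using assms by (auto simp: compat_def bij_betw_def)
  then show ?thesis
    using assms(3) orb_closed[OF assms(2,4)] by (auto simp: compat_orb[OF assms(1,2,4)] inj_on_def)
qed

lemma auto_of_le:
  assumes c: "compat p g" and z: "z \<in> carrier P" "w \<in> carrier P"
  shows "face_le (auto_of p g z) (auto_of p g w) \<longleftrightarrow> face_le z w"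
  using z(1)
proof (cases z rule: carrier_cases)
  case (face L x)
  show ?thesis using z(2)
  proof (cases w rule: carrier_cases)
    case None
    then show ?thesis using c face by (simp add: auto_of_face) (simp add: face_def)
  next
    case f2: (face L' y)
    then show ?thesis using c face
      by (simp add: auto_of_face face_le_face compat_facts compat_image_subset compat_in_orb)
  qed
qed simp

lemma auto_of_in:
  assumes c: "compat p g"
  shows "auto_of p g \<in> carrier (order_automorphism_group P)"
proof -
  have "auto_of p g z \<in> carrier P" if "z \<in> carrier P" for z
    using that
  proof (cases z rule: carrier_cases)
    case None
    then show ?thesis by (simp add: carrier_P)
  next
    case (face L x)
    then show ?thesis using face_in compat_facts[OF c] by (simp add: auto_of_face[OF c])
  qed
  moreover have "inj_on (auto_of p g) (carrier P)"
  proof (rule inj_onI)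
    fix z w assume zw: "z \<in> carrier P" "w \<in> carrier P" "auto_of p g z = auto_of p g w"
    show "z = w"
      using auto_of_le[OF c] zw face_le_refl face_le_antisym by metis
  qed
  moreover have "\<exists>w\<in>carrier P. z = auto_of p g w" if "z \<in> carrier P" for z
    using that
  proof (cases z rule: carrier_cases)
    case None
    then show ?thesis by (intro bexI[of _ None]) (auto simp: carrier_P)
  next
    case (face L x)
    have b: "p ` Lab = Lab" "g ` X = X" using c by (auto simp: compat_def bij_betw_def)
    obtain L' where L': "L' \<subseteq> Lab" "L = p ` L'" using face b subset_imageE by metis
    obtain x' where x': "x' \<in> X" "x = g x'" using face b by blast
    then show ?thesis using c face L' face_in by (intro bexI[of _ "face L' x'"]) (auto simp: auto_of_face)
  qed
  ultimately have "bij_betw (auto_of p g) (carrier P) (carrier P)"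
    unfolding bij_betw_def by blast
  then show ?thesis
    using auto_of_le[OF c]
    by (simp add: order_automorphism_group_def Bij_def auto_of_def extensional_def)
qed

text \<open>The faces without labels are the vertices and give back \<open>g\<close>; those with a
  single label give back \<open>p\<close>.\<close>

lemma auto_of_inj:
  assumes "compat p g" "compat q h" "auto_of p g = auto_of q h" "X \<noteq> {}"
  shows "l \<in> Lab \<Longrightarrow> p l = q l" "x \<in> X \<Longrightarrow> g x = h x"
proof -
  have *: "p ` L = q ` L \<and> g x \<in> orb F (q ` L) (h x)" if "L \<subseteq> Lab" "x \<in> X" for L x
    using auto_of_face[OF assms(1) that] auto_of_face[OF assms(2) that] assms(3)
      face_eq[of "p ` L" "q ` L" "g x" "h x"] that compat_facts[OF assms(1)] compat_facts[OF assms(2)]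
    by metis
  show "x \<in> X \<Longrightarrow> g x = h x" using *[of "{}" x] by simp
  show "p l = q l" if "l \<in> Lab"
    using *[of "{l}"] that assms(4) by auto
qed

lemma auto_of_comp:
  assumes c: "compat p g" "compat q h" "compat r k"
    and r: "\<And>l. l \<in> Lab \<Longrightarrow> r l = p (q l)" and k: "\<And>x. x \<in> X \<Longrightarrow> k x = g (h x)"
  shows "auto_of r k = compose (carrier P) (auto_of p g) (auto_of q h)"
proof
  fix z show "auto_of r k z = compose (carrier P) (auto_of p g) (auto_of q h) z"
  proof (cases "z \<in> carrier P")
    case True
    then show ?thesis
    proof (cases z rule: carrier_cases)
      case (face L x)
      have "r ` L = p ` q ` L" using r face by (force simp: image_image)
      then show ?thesis
        using c face k True by (simp add: compose_eq auto_of_face compat_facts)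
    qed (simp add: compose_def carrier_P)
  qed (auto simp: compose_def auto_of_def)
qed

text \<open>The faces above a vertex form a copy of the Boolean lattice of label sets. An
  automorphism maps it to the lattice above another vertex, and an isomorphism of such lattices is a
  bijection of labels.\<close>

lemma automorphism_auto_of:
  assumes f: "f \<in> carrier (order_automorphism_group P)" and ne: "X \<noteq> {}"
  obtains p g where "compat p g" "f = auto_of p g"
proof -
  have bij: "bij_betw f (carrier P) (carrier P)" and ext: "f \<in> extensional (carrier P)"
    using f by (auto simp: order_automorphism_group_def Bij_def)
  have le: "face_le (f z) (f w) \<longleftrightarrow> face_le z w" if "z \<in> carrier P" "w \<in> carrier P" for z w
    using f that by (auto simp: order_automorphism_group_def Bij_def)
  have None_in: "None \<in> carrier P" by (simp add: carrier_P)
  have onto: "\<exists>w\<in>carrier P. f w = z" if "z \<in> carrier P" for z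
  proof -
    have "z \<in> f ` carrier P" using bij_betw_imp_surj_on[OF bij] that by simp
    then show ?thesis by blast
  qed
  have into: "f z \<in> carrier P" if "z \<in> carrier P" for z
    using bij_betwE[OF bij] that by simp
  have f_None: "f None = None"
  proof -
    obtain w where "w \<in> carrier P" "f w = None" using onto None_in by blast
    then show ?thesis using le[of None w] None_in by (cases "f None") auto
  qed
  \<comment> \<open>Vertices are the minimal faces other than \<open>None\<close>: a vertex strictly
    below the image of a vertex would have a preimage strictly below that vertex.\<close>
  have "\<exists>y\<in>X. f (face {} x) = face {} y" if x: "x \<in> X" for x
  proof -
    have "f (face {} x) \<noteq> None"
      using bij f_None None_in face_in[of "{}" x] x
      by (metis bij_betw_inv_into_left empty_subsetI face_def option.distinct(1))
    then obtain L y where Ly: "f (face {} x) = face L y" "L \<subseteq> Lab" "y \<in> X"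
      using carrier_cases[OF into[OF face_in[OF empty_subsetI x]]] by metis
    obtain w where w: "w \<in> carrier P" "f w = face {} y" using onto face_in[of "{}" y] Ly by blast
    have "face_le w (face {} x)"
      using le[of w "face {} x"] w Ly x face_in[of "{}" x] face_le_face[of "{}" L y y] by simp
    moreover have "w \<noteq> None" using w f_None by (metis face_def option.distinct(1))
    ultimately have "w = face {} x" using w(1) x
      by (elim carrier_cases) (auto simp: face_le_face face_eq)
    then show ?thesis using w Ly by metis
  qed
  then obtain g where g: "\<And>x. x \<in> X \<Longrightarrow> g x \<in> X" "\<And>x. x \<in> X \<Longrightarrow> f (face {} x) = face {} (g x)"
    by metis
  have "\<exists>L'\<subseteq>Lab. f (face L x) = face L' (g x)" if L: "L \<subseteq> Lab" and x: "x \<in> X" for L x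
  proof -
    have up: "face_le (face {} (g x)) (f (face L x))"
      using le[of "face {} x" "face L x"] face_in L x g face_le_face by simp
    from into[OF face_in[OF L x]] show ?thesis
    proof (cases rule: carrier_cases)
      case None
      then show ?thesis using up by (simp add: face_def)
    next
      case (face L' y)
      then show ?thesis using up g x by (metis empty_subsetI face_eq face_le_face)
    qed
  qed
  then obtain \<Lambda> where \<Lambda>: "\<And>L x. L \<subseteq> Lab \<Longrightarrow> x \<in> X \<Longrightarrow> \<Lambda> L x \<subseteq> Lab \<and> f (face L x) = face (\<Lambda> L x) (g x)"
    by metis
  have in_iff: "\<Lambda> L x \<subseteq> \<Lambda> M y \<and> g x \<in> orb F (\<Lambda> M y) (g y) \<longleftrightarrow> L \<subseteq> M \<and> x \<in> orb F M y"
    if "L \<subseteq> Lab" "M \<subseteq> Lab" "x \<in> X" "y \<in> X" for L M x y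
    using le[of "face L x" "face M y"] that \<Lambda> g face_in face_le_face by simp
  have mono: "\<Lambda> L x \<subseteq> \<Lambda> M x \<longleftrightarrow> L \<subseteq> M" if "L \<subseteq> Lab" "M \<subseteq> Lab" "x \<in> X" for L M x
    using in_iff[OF that(1,2,3,3)] by simp
  have empty: "\<Lambda> {} x = {}" if "x \<in> X" for x
    using \<Lambda>[of "{}" x] g that face_eq[of "\<Lambda> {} x" "{}" "g x" "g x"] by simp
  have surj: "\<exists>L\<subseteq>Lab. M = \<Lambda> L x" if M: "M \<subseteq> Lab" and x: "x \<in> X" for M x
  proof -
    obtain w where w: "w \<in> carrier P" "f w = face M (g x)" using onto[OF face_in[OF M g(1)[OF x]]] by blast
    from w(1) show ?thesis
    proof (cases rule: carrier_cases)
      case None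
      then show ?thesis using w f_None by (simp add: face_def)
    next
      case (face L y)
      then have "face M (g x) = face (\<Lambda> L y) (g y)" using \<Lambda>[of L y] w by simp
      then have *: "M = \<Lambda> L y" "g x \<in> orb F (\<Lambda> L y) (g y)"
        using \<Lambda>[of L y] face x g M face_eq[of M "\<Lambda> L y" "g x" "g y"] by auto
      then have "x \<in> orb F L y" using in_iff[of "{}" L x y] face x empty[OF x] by simp
      then have "face L x = face L y" using face x face_eq[of L L x y] by simp
      then have "face (\<Lambda> L x) (g x) = face M (g x)" using \<Lambda>[of L x] face x w by simp
      then have "\<Lambda> L x = M" using face_eq[of "\<Lambda> L x" M "g x" "g x"] \<Lambda>[of L x] face x M g by simp
      then show ?thesis using face by blast
    qed
  qed
  \<comment> \<open>At a fixed \<open>x\<close>, \<Lambda> is an order isomorphism of the powerset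
    of the labels, so it maps atoms to atoms.\<close>
  have "\<exists>l'\<in>Lab. \<Lambda> {l} x = {l'}" if l: "l \<in> Lab" and x: "x \<in> X" for l x
  proof -
    have "\<not> \<Lambda> {l} x \<subseteq> {}" using mono[of "{l}" "{}" x] l x empty by auto
    then obtain l' where l': "l' \<in> \<Lambda> {l} x" by blast
    have "l' \<in> Lab" using l' \<Lambda>[of "{l}" x] l x by blast
    then obtain M where M: "M \<subseteq> Lab" "{l'} = \<Lambda> M x" using surj[of "{l'}" x] x by blast
    have "M \<subseteq> {l}" using mono[of M "{l}" x] M l x l' by auto
    moreover have "M \<noteq> {}" using M empty x by auto
    ultimately show ?thesis using M \<open>l' \<in> Lab\<close> by (metis subset_singletonD)
  qed
  then have "\<forall>x l. \<exists>l'. l \<in> Lab \<longrightarrow> x \<in> X \<longrightarrow> l' \<in> Lab \<and> \<Lambda> {l} x = {l'}" by blast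
  then obtain q where q: "\<And>l x. l \<in> Lab \<Longrightarrow> x \<in> X \<Longrightarrow> q x l \<in> Lab \<and> \<Lambda> {l} x = {q x l}"
    unfolding choice_iff by blast
  have q_onto: "\<exists>l\<in>Lab. l' = q x l" if l': "l' \<in> Lab" and x: "x \<in> X" for l' x
  proof -
    obtain M where M: "M \<subseteq> Lab" "{l'} = \<Lambda> M x" using surj[of "{l'}" x] x l' by blast
    have "M \<noteq> {}" using M empty x by auto
    then obtain l where l: "l \<in> M" by blast
    then have "\<Lambda> {l} x \<subseteq> \<Lambda> M x" using mono[of "{l}" M x] M x by auto
    moreover have "l \<in> Lab" using l M by blast
    ultimately have "l' = q x l" using M q[of l x] x by auto
    then show ?thesis using \<open>l \<in> Lab\<close> by blast
  qed
  have \<Lambda>q: "\<Lambda> L x = q x ` L" if L: "L \<subseteq> Lab" and x: "x \<in> X" for L x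
  proof -
    have *: "q x l \<in> \<Lambda> L x \<longleftrightarrow> l \<in> L" if "l \<in> Lab" for l
      using mono[of "{l}" L x] q[OF that x] that L x by auto
    show ?thesis
    proof
      show "\<Lambda> L x \<subseteq> q x ` L" using * q_onto[OF _ x] \<Lambda>[OF L x] by blast
      show "q x ` L \<subseteq> \<Lambda> L x" using * L by blast
    qed
  qed
  have q_inj: "inj_on (q x) Lab" if "x \<in> X" for x
    using mono[of "{_}" "{_}" x] q that unfolding inj_on_def
    by (metis empty_subsetI insert_subset singletonD subset_refl)
  \<comment> \<open>The states \<open>x\<close> and \<open>F k x\<close> lie in the same face for
    every label set that contains \<open>k\<close>; the sets \<open>{k}\<close> and
    \<open>{l, k}\<close> then determine the image of \<open>l\<close>.\<close>
  have q_step: "q (F k x) l = q x l" if k: "k \<in> Lab" and x: "x \<in> X" and l: "l \<in> Lab" for k x l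
  proof -
    have *: "\<Lambda> L (F k x) = \<Lambda> L x" if "k \<in> L" "L \<subseteq> Lab" for L
    proof -
      have "face L (F k x) = face L x"
        using face_eq[of L L "F k x" x] that x k F_closed orb_step[where F=F, OF orb_refl that(1), of x] by simp
      then show ?thesis
        using \<Lambda>[of L x] \<Lambda>[of L "F k x"] face_eq that x k F_closed g by metis
    qed
    have "q (F k x) k = q x k" using *[of "{k}"] q k x F_closed by auto
    moreover have "{q (F k x) l, q (F k x) k} = {q x l, q x k}"
      using *[of "{l, k}"] \<Lambda>q[of "{l, k}"] k x l F_closed by simp
    ultimately show ?thesis by (auto simp: doubleton_eq_iff)
  qed
  obtain x0 where x0: "x0 \<in> X" using ne by blast
  have q_const: "q x l = q x0 l" if "x \<in> X" "l \<in> Lab" for x l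
    using connected[OF x0 that(1)]
  proof (induction rule: orb_induct)
    case (step z k)
    then show ?case using q_step[of k z l] that orb_closed[of Lab x0 z] x0 by simp
  qed simp
  define p where "p = q x0"
  have f_face: "f (face L x) = face (p ` L) (g x)" if L: "L \<subseteq> Lab" and x: "x \<in> X" for L x
  proof -
    have "q x ` L = p ` L" using q_const[OF x] L unfolding p_def by (intro image_cong) auto
    then show ?thesis using \<Lambda>[OF L x] \<Lambda>q[OF L x] by simp
  qed
  have orb_iff: "g x \<in> orb F {p l} (g y) \<longleftrightarrow> x \<in> orb F {l} y" if "x \<in> X" "y \<in> X" "l \<in> Lab" for x y l
    using in_iff[of "{}" "{l}" x y] that empty \<Lambda>q[of "{l}" y] q_const by (auto simp: p_def)
  have p_in: "p l \<in> Lab" if "l \<in> Lab" for l using q x0 that by (simp add: p_def)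
  have p_bij: "bij_betw p Lab Lab"
    using q_inj[OF x0] q_onto[OF _ x0] p_in by (auto simp: bij_betw_def p_def)
  have g_inj: "inj_on g X"
  proof (rule inj_onI)
    fix x y assume "x \<in> X" "y \<in> X" "g x = g y"
    then show "x = y" using in_iff[of "{}" "{}" x y] empty by auto
  qed
  have g_onto: "\<exists>x\<in>X. y = g x" if y: "y \<in> X" for y
  proof -
    obtain w where w: "w \<in> carrier P" "f w = face {} y" using onto face_in[of "{}" y] y by blast
    from w(1) show ?thesis
    proof (cases rule: carrier_cases)
      case None
      then show ?thesis using w f_None by (simp add: face_def)
    next
      case (face L x)
      then have "face {} y = face (\<Lambda> L x) (g x)" using \<Lambda>[of L x] w by simp
      then have "{} = \<Lambda> L x" "y \<in> orb F (\<Lambda> L x) (g x)"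
        using face_eq[of "{}" "\<Lambda> L x" y "g x"] \<Lambda>[of L x] face y g by auto
      then show ?thesis using face by (metis orb_empty singletonD)
    qed
  qed
  \<comment> \<open>A flip system may have fixed points, so both ends of the edge are followed:
    either the preimage \<open>z\<close> of \<open>F (p l) (g x)\<close> is \<open>F l x\<close>, or
    both edges collapse to a point.\<close>
  have g_F: "g (F l x) = F (p l) (g x)" if l: "l \<in> Lab" and x: "x \<in> X" for l x
  proof -
    obtain z where z: "z \<in> X" "F (p l) (g x) = g z"
      using g_onto[OF F_closed[OF p_in[OF l] g(1)[OF x]]] by blast
    have "g z \<in> orb F {p l} (g x)" using z(2) orb_single[OF p_in[OF l] g(1)[OF x]] by simp
    then have "z = x \<or> z = F l x" using orb_iff[OF z(1) x l] orb_single[OF l x] by simp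
    moreover have "g (F l x) \<in> {g x, F (p l) (g x)}"
      using orb_iff[OF F_closed[OF l x] x l] orb_single[OF l x] orb_single[OF p_in[OF l] g(1)[OF x]] by simp
    ultimately show ?thesis using z by auto
  qed
  then have compat: "compat p g"
  proof -
    have "g ` X = X" using g_onto g(1) by blast
    then show ?thesis using p_bij g_inj g_F by (simp add: compat_def bij_betw_def)
  qed
  moreover have "f = auto_of p g"
  proof
    fix z show "f z = auto_of p g z"
    proof (cases "z \<in> carrier P")
      case True
      then show ?thesis
        by (cases z rule: carrier_cases) (auto simp: f_None f_face auto_of_face[OF compat])
    next
      case False
      then show ?thesis using ext by (auto simp: auto_of_def extensional_def)
    qed
  qed
  ultimately show ?thesis by (rule that)
qed

text \<open>Reduces the group to a concrete action of a candidate \<open>H\<close>. Since the flip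
  graph is connected, faithfulness and completeness are tested only on the labels and at the base
  state \<open>x0\<close>.\<close>

theorem automorphism_group_iso:
  fixes H (structure)
  assumes H: "group H" and x0: "x0 \<in> X"
    and compat: "\<And>h. h \<in> carrier H \<Longrightarrow> compat (p h) (g h)"
    and mult: "\<And>h k l. h \<in> carrier H \<Longrightarrow> k \<in> carrier H \<Longrightarrow> l \<in> Lab \<Longrightarrow> p (h \<otimes> k) l = p h (p k l)"
      "\<And>h k x. h \<in> carrier H \<Longrightarrow> k \<in> carrier H \<Longrightarrow> x \<in> X \<Longrightarrow> g (h \<otimes> k) x = g h (g k x)"
    and faithful: "\<And>h k. h \<in> carrier H \<Longrightarrow> k \<in> carrier H \<Longrightarrow> (\<And>l. l \<in> Lab \<Longrightarrow> p h l = p k l) \<Longrightarrow>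
        g h x0 = g k x0 \<Longrightarrow> h = k"
    and complete: "\<And>q f. compat q f \<Longrightarrow> \<exists>h\<in>carrier H. (\<forall>l\<in>Lab. p h l = q l) \<and> g h x0 = f x0"
  shows "order_automorphism_group P \<cong> H"
proof -
  let ?A = "order_automorphism_group P"
  let ?\<Phi> = "\<lambda>h. auto_of (p h) (g h)"
  interpret H: group H by fact
  have "?\<Phi> \<in> hom H ?A"
  proof (rule homI)
    fix h k assume hk: "h \<in> carrier H" "k \<in> carrier H"
    have "?\<Phi> (h \<otimes> k) = compose (carrier P) (?\<Phi> h) (?\<Phi> k)"
      using hk compat mult by (intro auto_of_comp) auto
    moreover have "auto_of (p h) (g h) \<in> Bij (carrier P)" if "h \<in> carrier H" for h
      using auto_of_in[OF compat[OF that]] by (simp add: order_automorphism_group_def)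
    ultimately show "?\<Phi> (h \<otimes> k) = ?\<Phi> h \<otimes>\<^bsub>?A\<^esub> ?\<Phi> k"
      using hk by (simp add: order_automorphism_group_def BijGroup_def)
  qed (use compat auto_of_in in auto)
  moreover have "inj_on ?\<Phi> (carrier H)"
  proof (rule inj_onI)
    fix h k assume hk: "h \<in> carrier H" "k \<in> carrier H" "?\<Phi> h = ?\<Phi> k"
    have "X \<noteq> {}" using x0 by blast
    then show "h = k"
      using faithful[OF hk(1,2)] auto_of_inj[OF compat compat hk(3)] hk x0 by blast
  qed
  moreover have "f \<in> ?\<Phi> ` carrier H" if f: "f \<in> carrier ?A" for f
  proof -
    obtain q k where qk: "compat q k" "f = auto_of q k"
      using automorphism_auto_of[OF f] x0 by blast
    obtain h where h: "h \<in> carrier H" "\<forall>l\<in>Lab. p h l = q l" "g h x0 = k x0"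
      using complete qk by blast
    have gk: "g h x = k x" if "x \<in> X" for x
      using compat_eqI[OF compat[OF h(1)] qk(1) _ x0 h(3) that] h by blast
    have "?\<Phi> h z = auto_of q k z" for z
    proof (cases "z \<in> carrier P")
      case True
      then show ?thesis
      proof (cases z rule: carrier_cases)
        case (face L x)
        then have "p h ` L = q ` L" using h(2) by (intro image_cong) auto
        then show ?thesis using face gk by (simp add: auto_of_face[OF compat[OF h(1)]] auto_of_face[OF qk(1)])
      qed simp
    qed (simp add: auto_of_def)
    then have "?\<Phi> h = f" using qk by auto
    then show ?thesis using h by blast
  qed
  ultimately have "?\<Phi> \<in> iso H ?A"
    using auto_of_in compat by (auto simp: iso_def bij_betw_def)
  then show ?thesis
    using H.iso_sym is_isoI by blast
qed

end

section \<open>Rotations of labeled binary trees\<close>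

fun rlab :: "'a tree \<Rightarrow> 'a option" where
  "rlab Leaf = None"
| "rlab (Node l x r) = Some x"

lemma rlab_Some: "rlab t = Some x \<longleftrightarrow> (\<exists>l r. t = Node l x r)"
  by (cases t) auto

lemma rlab_in: "rlab t = Some x \<Longrightarrow> x \<in> set_tree t"
  by (cases t) auto

text \<open>
  The rotation \<open>x(c(a, b), d) \<leftrightarrow> x(a, c(b, d))\<close>. Unlike the rotation of search trees it moves
  the label \<open>c\<close> along with the edge above it, and leaves \<open>x\<close> in place.
\<close>

fun rot :: "'a \<Rightarrow> 'a tree \<Rightarrow> 'a tree" where
  "rot c Leaf = Leaf"
| "rot c (Node l x r) =
     (if rlab l = Some c then Node (left l) x (Node (right l) c r)
      else if rlab r = Some c then Node (Node l c (left r)) x (right r)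
      else Node (rot c l) x (rot c r))"

lemma mset_inorder_rot: "mset (inorder (rot c t)) = mset (inorder t)"
  by (induction t) (auto simp: rlab_Some)

lemma set_tree_rot [simp]: "set_tree (rot c t) = set_tree t"
  using mset_eq_setD[OF mset_inorder_rot[of c t]] by simp

lemma distinct_rot [simp]: "distinct (inorder (rot c t)) \<longleftrightarrow> distinct (inorder t)"
  by (rule mset_eq_imp_distinct_iff[OF mset_inorder_rot])

lemma size_rot [simp]: "size (rot c t) = size t"
  using mset_eq_length[OF mset_inorder_rot[of c t]] by simp

lemma size1_rot [simp]: "size1 (rot c t) = size1 t"
  by (simp add: size1_size)

lemma rlab_rot [simp]: "rlab (rot c t) = rlab t"
  by (cases t) auto

lemma rot_notin: "c \<notin> set_tree t \<Longrightarrow> rot c t = t"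
  by (induction t) (auto dest: rlab_in)

lemma rot_left: "rlab l \<noteq> Some c \<Longrightarrow> c \<notin> set_tree r \<Longrightarrow> rot c (Node l x r) = Node (rot c l) x r"
  by (auto simp: rot_notin dest: rlab_in)

lemma rot_right: "rlab r \<noteq> Some c \<Longrightarrow> c \<notin> set_tree l \<Longrightarrow> rot c (Node l x r) = Node l x (rot c r)"
  by (auto simp: rot_notin dest: rlab_in)

lemma rot_invol: "distinct (inorder t) \<Longrightarrow> rot c (rot c t) = t"
proof (induction t)
  case (Node l x r)
  then show ?case
    by (auto simp: rlab_Some rot_notin)
qed simp

lemma mirror_rot: "distinct (inorder t) \<Longrightarrow> mirror (rot c t) = rot c (mirror t)"
proof (induction t)
  case (Node l x r)
  have [simp]: "rlab (mirror t) = rlab t" for t :: "'a tree" by (cases t) auto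
  show ?case using Node
    by (auto simp: rlab_Some)
qed simp

lemma rlab_map [simp]: "rlab (map_tree f t) = map_option f (rlab t)"
  by (cases t) auto

lemma map_rot:
  "inj_on f A \<Longrightarrow> set_tree t \<subseteq> A \<Longrightarrow> c \<in> A \<Longrightarrow> map_tree f (rot c t) = rot (f c) (map_tree f t)"
proof (induction t)
  case (Node l x r)
  have *: "rlab (map_tree f s) = Some (f c) \<longleftrightarrow> rlab s = Some c" if "set_tree s \<subseteq> A" for s
    using that Node(3,5) by (cases s) (auto simp: inj_on_eq_iff)
  have **: "left (map_tree f s) = map_tree f (left s)" "right (map_tree f s) = map_tree f (right s)" for s
    by (cases s; simp)+
  show ?case using Node *[of l] *[of r] by (auto simp: ** rlab_Some)
qed simp

section \<open>Connectivity under rotations that keep the root\<close>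

inductive reach :: "'a tree \<Rightarrow> 'a tree \<Rightarrow> bool" where
  reach_refl: "reach t t"
| reach_step: "reach t u \<Longrightarrow> c \<in> set_tree u \<Longrightarrow> rlab u \<noteq> Some c \<Longrightarrow> reach t (rot c u)"

lemma reach_inv: "reach t u \<Longrightarrow> mset (inorder u) = mset (inorder t) \<and> rlab u = rlab t"
  by (induction rule: reach.induct) (auto simp: mset_inorder_rot)

lemma reach_inv2:
  assumes "reach t u"
  shows "set_tree u = set_tree t" "distinct (inorder u) = distinct (inorder t)"
  using reach_inv[OF assms] mset_eq_setD[of "inorder u" "inorder t"] mset_eq_imp_distinct_iff by auto

lemma reach_trans: "reach u w \<Longrightarrow> reach t u \<Longrightarrow> reach t w"
  by (induction rule: reach.induct) (auto intro: reach.intros)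

lemma reach_right: "reach r r' \<Longrightarrow> distinct (inorder (Node l x r)) \<Longrightarrow> reach (Node l x r) (Node l x r')"
proof (induction rule: reach.induct)
  case (reach_step t u c)
  then have *: "c \<noteq> x" "c \<notin> set_tree l" using reach_inv2[OF reach_step(1)] by auto
  have "rot c (Node l x u) = Node l x (rot c u)" using * reach_step(3) by (intro rot_right)
  moreover have "reach (Node l x t) (rot c (Node l x u))"
    using reach_step * by (intro reach.reach_step) auto
  ultimately show ?case by simp
qed (rule reach_refl)

text \<open>The fan, that is, nested edges with a common right end. It is the normal form for
  connectivity.\<close>

fun rcomb :: "'a list \<Rightarrow> 'a tree" where
  "rcomb [] = Leaf"
| "rcomb (x # xs) = Node Leaf x (rcomb xs)"

lemma inorder_rcomb [simp]: "inorder (rcomb xs) = xs"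
  by (induction xs) auto

lemma set_rcomb [simp]: "set_tree (rcomb xs) = set xs"
  by (induction xs) auto

text \<open>Rotating the left child \<open>c\<close> of the root hands its right part to the right
  subtree, so the left subtree shrinks to a leaf (inner induction). Then the right subtree, being
  smaller than the whole, is made a fan (outer induction).\<close>

lemma reach_rcomb:
  fixes t :: "'a tree"
  shows "size t \<le> n \<Longrightarrow> t = Node l x r \<Longrightarrow> distinct (inorder t) \<Longrightarrow> \<exists>xs. reach t (rcomb (x # xs))"
proof (induction n arbitrary: t l x r)
  case (Suc n)
  have "size (Node l x r) \<le> Suc n \<Longrightarrow> distinct (inorder (Node l x r)) \<Longrightarrow>
      \<exists>xs. reach (Node l x r) (rcomb (x # xs))" for l r :: "'a tree" and x
  proof (induction l arbitrary: r)
    case Leaf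
    show ?case
    proof (cases r)
      case Leaf
      then show ?thesis by (intro exI[of _ "[]"]) (simp add: reach_refl)
    next
      case (Node a y b)
      then obtain ys where "reach r (rcomb (y # ys))" using Suc.IH[of r a y b] Leaf by auto
      then have "reach (Node Leaf x r) (Node Leaf x (rcomb (y # ys)))" using Leaf by (intro reach_right)
      then show ?thesis by (metis rcomb.simps(2))
    qed
  next
    case (Node a c b)
    have *: "rot c (Node (Node a c b) x r) = Node a x (Node b c r)" by simp
    have "reach (Node (Node a c b) x r) (rot c (Node (Node a c b) x r))"
      using Node.prems by (intro reach_step reach_refl) auto
    moreover have "\<exists>xs. reach (Node a x (Node b c r)) (rcomb (x # xs))"
      using Node.prems by (intro Node.IH(1)) auto
    ultimately show ?case using reach_trans unfolding * by blast
  qed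
  then show ?case using Suc.prems by blast
qed simp

text \<open>The edges \<open>d\<close> and \<open>e\<close> cut a pentagon. Flipping them
  alternately runs through its five triangulations and returns after five flips with the two labels
  exchanged.\<close>

lemma reach_swap:
  assumes "distinct (x # d # e # ws)"
  shows "reach (rcomb (x # d # e # ws)) (rcomb (x # e # d # ws))"
proof -
  let ?t = "rcomb (x # d # e # ws)"
  have "rcomb (x # e # d # ws) = rot d (rot e (rot d (rot e (rot d ?t))))"
    using assms by (auto simp: rot_notin dest: rlab_in)
  moreover have "reach ?t (rot d (rot e (rot d (rot e (rot d ?t)))))"
    by (intro reach_step reach_refl) (use assms in auto)
  ultimately show ?thesis by simp
qed

lemma reach_front:
  "distinct (x # us @ a # vs) \<Longrightarrow> reach (rcomb (x # us @ a # vs)) (rcomb (x # a # us @ vs))"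
proof (induction us arbitrary: x)
  case (Cons u us)
  then have "reach (rcomb (u # us @ a # vs)) (rcomb (u # a # us @ vs))" by auto
  then have "reach (rcomb (x # u # us @ a # vs)) (rcomb (x # u # a # us @ vs))"
    using reach_right[of "rcomb (u # us @ a # vs)" _ Leaf x] Cons.prems by auto
  moreover have "reach (rcomb (x # u # a # us @ vs)) (rcomb (x # a # u # us @ vs))"
    using Cons.prems by (intro reach_swap) auto
  ultimately show ?case using reach_trans by auto
qed (simp add: reach_refl)

text \<open>Selection sort: the label due first is brought to the front by adjacent exchanges, then
  the recursion descends into the right subtree.\<close>

lemma reach_perm:
  "mset ys = mset xs \<Longrightarrow> distinct (x # xs) \<Longrightarrow> reach (rcomb (x # ys)) (rcomb (x # xs))"
proof (induction xs arbitrary: x ys)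
  case (Cons a xs)
  then have "a \<in> set ys" by (metis list.set_intros(1) set_mset_mset)
  then obtain us vs where ys: "ys = us @ a # vs" by (meson split_list)
  then have m: "mset (us @ vs) = mset xs" using Cons.prems by simp
  have d: "distinct (x # ys)" using Cons.prems by (metis mset.simps(2) mset_eq_imp_distinct_iff)
  have "reach (rcomb (x # ys)) (rcomb (x # a # us @ vs))"
    unfolding ys by (rule reach_front) (use d ys in simp)
  moreover have "reach (rcomb (a # us @ vs)) (rcomb (a # xs))" using Cons m by auto
  then have "reach (Node Leaf x (rcomb (a # us @ vs))) (Node Leaf x (rcomb (a # xs)))"
    by (rule reach_right) (use d ys in auto)
  ultimately show ?case using reach_trans by auto
qed (simp add: reach_refl)

lemma reach_rcomb_perm:
  assumes "distinct (inorder t)" "rlab t = Some x" "distinct (x # xs)" "set_tree t = set (x # xs)"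
  shows "reach t (rcomb (x # xs))"
proof -
  obtain ys where ys: "reach t (rcomb (x # ys))"
    using reach_rcomb[of t "size t"] assms by (auto simp: rlab_Some)
  have "distinct (x # ys)" "set (x # ys) = set (x # xs)"
    using reach_inv2[OF ys] assms by auto
  then have "mset (x # ys) = mset (x # xs)" using assms set_eq_iff_mset_eq_distinct by metis
  then show ?thesis using reach_trans[OF reach_perm ys] assms by simp
qed

section \<open>Adjacent edges and zigzags\<close>

lemma rlab_notin: "c \<notin> set_tree t \<Longrightarrow> (rlab t = Some c) = False"
  by (auto dest: rlab_in)

text \<open>\<open>adj t c d\<close>: the edges \<open>c\<close> and \<open>d\<close> bound a common triangle, \<open>c\<close> being the upper or the left one.\<close>

fun adj :: "'a tree \<Rightarrow> 'a \<Rightarrow> 'a \<Rightarrow> bool" where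
  "adj Leaf c d \<longleftrightarrow> False"
| "adj (Node l x r) c d \<longleftrightarrow> rlab l = Some c \<and> rlab r = Some d \<or>
     c = x \<and> (rlab l = Some d \<or> rlab r = Some d) \<or> adj l c d \<or> adj r c d"

lemma adj_in: "adj t c d \<Longrightarrow> c \<in> set_tree t \<and> d \<in> set_tree t"
  by (induction t) (auto dest: rlab_in)

lemma adj_not_root: "adj t c d \<Longrightarrow> distinct (inorder t) \<Longrightarrow> rlab t \<noteq> Some d"
  by (induction t) (auto dest: rlab_in adj_in)

lemma node_neq [simp]: "t \<noteq> Node t x r" "t \<noteq> Node l x t" "Node t x r \<noteq> t" "Node l x t \<noteq> t"
proof -
  have "size t \<noteq> size (Node t x r)" "size t \<noteq> size (Node l x t)" by simp_all
  then show "t \<noteq> Node t x r" "t \<noteq> Node l x t" "Node t x r \<noteq> t" "Node l x t \<noteq> t"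
    by metis+
qed

text \<open>Two edges of a common triangle lie in a pentagon. Its five triangulations carry ten
  labelings, and alternate rotations run through all ten; commuting would close the cycle after four
  steps.\<close>

lemma adj_rot_neq:
  "distinct (inorder t) \<Longrightarrow> adj t c d \<Longrightarrow> rlab t \<noteq> Some c \<Longrightarrow> rot c (rot d t) \<noteq> rot d (rot c t)"
proof (induction t)
  case (Node l x r)
  note d = Node.prems(1)
  consider (sib) "rlab l = Some c" "rlab r = Some d" | (left) "adj l c d" | (right) "adj r c d"
    using Node.prems by auto
  then show ?case
  proof cases
    case sib
    then obtain a b a' b' where "l = Node a c b" "r = Node a' d b'" by (auto simp: rlab_Some)
    then show ?thesis using d by (auto simp: rot_notin rlab_notin)
  next
    case left
    have nr: "rlab l \<noteq> Some d" "c \<notin> set_tree r" "d \<notin> set_tree r" using left d adj_in[OF left] adj_not_root[OF left] by auto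
    show ?thesis
    proof (cases "rlab l = Some c")
      case True
      then obtain a b where l: "l = Node a c b" by (auto simp: rlab_Some)
      then have "rlab a = Some d \<or> rlab b = Some d" using left d by (auto dest: rlab_in adj_in)
      then show ?thesis
      proof
        assume "rlab a = Some d"
        then obtain u w where "a = Node u d w" by (auto simp: rlab_Some)
        moreover from this have "c \<noteq> d" using d l by auto
        ultimately show ?thesis using d l by (simp add: rot_notin rlab_notin)
      next
        assume "rlab b = Some d"
        then obtain u w where "b = Node u d w" by (auto simp: rlab_Some)
        moreover from this have "c \<noteq> d" using d l by auto
        ultimately show ?thesis using d l by (simp add: rot_notin rlab_notin)
      qed
    next
      case False
      then have "rot c (rot d (Node l x r)) = Node (rot c (rot d l)) x r"
        "rot d (rot c (Node l x r)) = Node (rot d (rot c l)) x r"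
        using nr by (simp_all add: rot_left del: rot.simps)
      then show ?thesis using Node.IH(1) d left False by auto
    qed
  next
    case right
    have nr: "rlab r \<noteq> Some d" "c \<notin> set_tree l" "d \<notin> set_tree l" using right d adj_in[OF right] adj_not_root[OF right] by auto
    show ?thesis
    proof (cases "rlab r = Some c")
      case True
      then obtain a b where r: "r = Node a c b" by (auto simp: rlab_Some)
      then have "rlab a = Some d \<or> rlab b = Some d" using right d by (auto dest: rlab_in adj_in)
      then show ?thesis
      proof
        assume "rlab a = Some d"
        then obtain u w where "a = Node u d w" by (auto simp: rlab_Some)
        moreover from this have "c \<noteq> d" using d r by auto
        ultimately show ?thesis using d r by (simp add: rot_notin rlab_notin)
      next
        assume "rlab b = Some d"
        then obtain u w where "b = Node u d w" by (auto simp: rlab_Some)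
        moreover from this have "c \<noteq> d" using d r by auto
        ultimately show ?thesis using d r by (simp add: rot_notin rlab_notin)
      qed
    next
      case False
      then have "rot c (rot d (Node l x r)) = Node l x (rot c (rot d r))"
        "rot d (rot c (Node l x r)) = Node l x (rot d (rot c r))"
        using nr by (simp_all add: rot_right del: rot.simps)
      then show ?thesis using Node.IH(2) d right False by auto
    qed
  qed
qed simp

text \<open>The flag says on which side the next edge hangs, and it alternates. In the half polygon
  no vertex lies on three of these edges.\<close>

fun zigzag :: "bool \<Rightarrow> 'a list \<Rightarrow> 'a tree" where
  "zigzag b [] = Leaf"
| "zigzag b (x # xs) = (if b then Node Leaf x (zigzag (\<not> b) xs) else Node (zigzag (\<not> b) xs) x Leaf)"

lemma set_zigzag [simp]: "set_tree (zigzag b xs) = set xs"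
  by (induction xs arbitrary: b) auto

lemma distinct_zigzag [simp]: "distinct (inorder (zigzag b xs)) \<longleftrightarrow> distinct xs"
  by (induction xs arbitrary: b) auto

lemma rlab_zigzag [simp]: "rlab (zigzag b (x # xs)) = Some x"
  by simp

lemma mirror_zigzag: "mirror (zigzag b xs) = zigzag (\<not> b) xs"
  by (induction xs arbitrary: b) auto

text \<open>Edges that are not neighbors in the list bound no common triangle, so each rotation
  leaves the quadrilateral of the other alone.\<close>

lemma zigzag_commute:
  "distinct (x # us @ c # ws @ d # vs) \<Longrightarrow> ws \<noteq> [] \<Longrightarrow>
    rot c (rot d (zigzag b (x # us @ c # ws @ d # vs))) = rot d (rot c (zigzag b (x # us @ c # ws @ d # vs)))"
proof (induction us arbitrary: x b)
  case Nil
  obtain S where S_def: "S = zigzag b (ws @ d # vs)" by blast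
  have S: "rlab S \<noteq> Some d" "rlab S \<noteq> Some c" "c \<notin> set_tree S"
    using Nil by (cases ws; cases b; auto simp: S_def)+
  have *: "zigzag b (x # [] @ c # ws @ d # vs) = (if b then Node Leaf x (Node S c Leaf) else Node (Node Leaf c S) x Leaf)"
    by (simp add: S_def)
  show ?case unfolding * using Nil.prems(1) S by (auto simp: rot_notin)
next
  case (Cons u us)
  define T where "T = zigzag (\<not> b) (u # us @ c # ws @ d # vs)"
  have T: "rlab T \<noteq> Some d" "rlab T \<noteq> Some c" and IH: "rot c (rot d T) = rot d (rot c T)"
    using Cons by (auto simp: T_def simp del: zigzag.simps)
  have "zigzag b (x # (u # us) @ c # ws @ d # vs) = (if b then Node Leaf x T else Node T x Leaf)"
    unfolding T_def by (simp del: zigzag.simps add: zigzag.simps(2)[of _ x])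
  then show ?case using T IH by simp
qed

text \<open>In a zigzag \<open>p\<close> and \<open>d\<close> are opposite sides of the
  quadrilateral cut by \<open>c\<close>, so the flipped \<open>c\<close> still separates them. In a
  fan they would be adjacent sides and end up in one triangle.\<close>

lemma zigzag_commute_rot:
  "distinct (x # us @ p # c # d # vs) \<Longrightarrow>
    rot p (rot d (rot c (zigzag b (x # us @ p # c # d # vs)))) = rot d (rot p (rot c (zigzag b (x # us @ p # c # d # vs))))"
proof (induction us arbitrary: x b)
  case Nil
  obtain S where S_def: "S = zigzag b vs" by blast
  have S: "c \<notin> set_tree S" "d \<notin> set_tree S" "p \<notin> set_tree S"
    using Nil by (auto simp: S_def)
  have *: "zigzag b (x # [] @ p # c # d # vs) =
      (if b then Node Leaf x (Node (Node Leaf c (Node S d Leaf)) p Leaf)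
       else Node (Node Leaf p (Node (Node Leaf d S) c Leaf)) x Leaf)"
    by (simp add: S_def)
  show ?case unfolding * using Nil.prems(1) S by (auto simp: rot_notin rlab_notin)
next
  case (Cons u us)
  define T where "T = zigzag (\<not> b) (u # us @ p # c # d # vs)"
  have T: "rlab T \<noteq> Some d" "rlab T \<noteq> Some c" "rlab T \<noteq> Some p"
    and IH: "rot p (rot d (rot c T)) = rot d (rot p (rot c T))"
    using Cons by (auto simp: T_def simp del: zigzag.simps)
  have "zigzag b (x # (u # us) @ p # c # d # vs) = (if b then Node Leaf x T else Node T x Leaf)"
    unfolding T_def by (simp del: zigzag.simps add: zigzag.simps(2)[of _ x])
  then show ?case using T IH by simp
qed

text \<open>
  A tree whose edges are adjacent only along the path \<open>x # xs\<close> is a snake. By the second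
  condition on the turns (flipping the middle one of three edges at a common vertex makes the
  outer two adjacent), it is a zigzag.
\<close>

definition consecutive :: "'a \<Rightarrow> 'a \<Rightarrow> 'a list \<Rightarrow> bool" where
  "consecutive c d xs \<longleftrightarrow> (\<exists>us vs. xs = us @ c # d # vs \<or> xs = us @ d # c # vs)"

lemma consecutive_Cons:
  assumes "consecutive c d (x # xs)" "distinct (x # xs)"
  shows "c = x \<Longrightarrow> xs \<noteq> [] \<and> hd xs = d" "c \<noteq> x \<Longrightarrow> d \<noteq> x \<Longrightarrow> consecutive c d xs"
proof -
  obtain us vs where "x # xs = us @ c # d # vs \<or> x # xs = us @ d # c # vs"
    using assms by (auto simp: consecutive_def)
  then show "c = x \<Longrightarrow> xs \<noteq> [] \<and> hd xs = d" "c \<noteq> x \<Longrightarrow> d \<noteq> x \<Longrightarrow> consecutive c d xs"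
    using assms(2) unfolding consecutive_def by (cases us; auto)+
qed

lemma zigzag_unique:
  assumes "distinct (inorder t)" "rlab t = Some x" "set_tree t = set (x # xs)" "distinct (x # xs)"
    and "\<And>c d. adj t c d \<Longrightarrow> consecutive c d (x # xs)"
    and "\<And>us a b c vs. x # xs = us @ a # b # c # vs \<Longrightarrow> \<not> adj (rot b t) a c"
  shows "t = zigzag True (x # xs) \<or> t = zigzag False (x # xs)"
  using assms
proof (induction xs arbitrary: x t)
  case Nil
  then obtain l r where "t = Node l x r" by (auto simp: rlab_Some)
  then show ?case using Nil by (cases l; cases r) auto
next
  case (Cons y ys)
  obtain l r where t: "t = Node l x r" using Cons.prems by (auto simp: rlab_Some)
  \<comment> \<open>The root is adjacent to its children, and \<open>x\<close> has only the neighbor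
    \<open>y\<close> in the list; as labels are distinct, the root has a single child.\<close>
  have child: "d = y" if "rlab l = Some d \<or> rlab r = Some d" for d
    using Cons.prems(5)[of x d] that t consecutive_Cons(1)[OF _ Cons.prems(4)] by fastforce
  have step: "s = zigzag True (y # ys) \<or> s = zigzag False (y # ys)"
    if s: "s = l \<and> r = Leaf \<or> s = r \<and> l = Leaf" for s
  proof (rule Cons.IH)
    show ds: "distinct (inorder s)" using s t Cons.prems by auto
    have "insert x (set_tree s) = insert x (set (y # ys))" using s t Cons.prems(3) by auto
    moreover have "x \<notin> set_tree s" "x \<notin> set (y # ys)" using s t Cons.prems(1,4) by auto
    ultimately show "set_tree s = set (y # ys)" using insert_ident by metis
    then have "s \<noteq> Leaf" by auto
    then show ry: "rlab s = Some y" using child s by (cases s) auto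
    show "distinct (y # ys)" using Cons.prems by simp
    show "consecutive c d (y # ys)" if "adj s c d" for c d
    proof -
      have "adj t c d" using that s t by auto
      moreover have "c \<noteq> x" "d \<noteq> x" using adj_in[OF that] s t Cons.prems(1) by auto
      ultimately show ?thesis using consecutive_Cons(2)[OF _ Cons.prems(4)] Cons.prems(5) by blast
    qed
    show "\<not> adj (rot b s) a c" if "y # ys = us @ a # b # c # vs" for us a b c vs
    proof -
      have "y \<noteq> b" using that Cons.prems(4) by (cases us) auto
      then have "rot b t = Node (rot b l) x (rot b r)" using t s ry by auto
      moreover have "\<not> adj (rot b t) a c" using Cons.prems(6)[of "x # us"] that by simp
      ultimately show ?thesis using s by auto
    qed
  qed
  \<comment> \<open>If \<open>z\<close> hung on the same side of \<open>y\<close> as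
    \<open>y\<close> does of \<open>x\<close>, the three edges would form a fan and rotating
    \<open>y\<close> would make \<open>x\<close> and \<open>z\<close> adjacent.\<close>
  have turn: "\<not> adj (rot y t) x z" if "ys = z # zs" for z zs
    using Cons.prems(6)[of "[]"] that by simp
  have ne: "x \<noteq> y" using Cons.prems by simp
  show ?case
  proof (cases "l = Leaf")
    case True
    then have "r = zigzag True (y # ys) \<or> r = zigzag False (y # ys)" using step by blast
    then have "r = zigzag False (y # ys)"
      using True t turn ne by (cases ys) auto
    then show ?thesis using t True by simp
  next
    case False
    then have "rlab l = Some y" using child by (cases l) auto
    then have "r = Leaf" using child[of "_"] Cons.prems(1) t by (cases r) (auto dest!: rlab_in)
    then have "l = zigzag True (y # ys) \<or> l = zigzag False (y # ys)" using step by blast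
    then have "l = zigzag True (y # ys)"
      using \<open>r = Leaf\<close> t turn ne by (cases ys) auto
    then show ?thesis using t \<open>r = Leaf\<close> by simp
  qed
qed

text \<open>In the fan \<open>d\<close> and \<open>e\<close> generate a cycle of ten labeled
  triangulations, so neither a relation of length four nor one of length six closes up.\<close>

lemma rcomb_braid_neq:
  assumes "distinct (x # d # e # ws)"
  defines "t \<equiv> rcomb (x # d # e # ws)"
  shows "rot d (rot e t) \<noteq> rot e (rot d t)" "rot d (rot e (rot d t)) \<noteq> rot e (rot d (rot e t))"
proof -
  have "rlab (rcomb ws) \<noteq> Some d" "rlab (rcomb ws) \<noteq> Some e" "rot d (rcomb ws) = rcomb ws" "rot e (rcomb ws) = rcomb ws"
    using assms(1) by (auto simp: rot_notin dest: rlab_in)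
  then show "rot d (rot e t) \<noteq> rot e (rot d t)" "rot d (rot e (rot d t)) \<noteq> rot e (rot d (rot e t))"
    using assms(1) by (auto simp: t_def)
qed

section \<open>Triangulations as trees and their rigidity\<close>

text \<open>
  The state \<open>(p, t)\<close> stands for the triangulation with central diagonal from vertex \<open>p\<close> to vertex
  \<open>p + N\<close>, the half polygon on the vertices \<open>p, \<dots>, p + N\<close> being cut up as prescribed by the
  binary tree \<open>t\<close>: a node with \<open>k\<close> leaves below it is a diagonal spanning \<open>k\<close> sides.
\<close>

definition mstates :: "'c set \<Rightarrow> (nat \<times> 'c option tree) set" where
  "mstates Col = {(p, t). p < card Col + 2 \<and> rlab t = Some None \<and> distinct (inorder t) \<and>
     set_tree t = labels Col}"

text \<open>The new central diagonal starts at the apex \<open>p + size1 l\<close> over the old one.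
  Its half polygon consists of the part below the right subtree followed by the reflected copy of
  the part below the left one, so the subtrees trade places. Positions count modulo \<open>N\<close>
  because \<open>p\<close> and \<open>p + N\<close> are the two ends of one diagonal.\<close>

definition mflip :: "nat \<Rightarrow> 'c option \<Rightarrow> nat \<times> 'c option tree \<Rightarrow> nat \<times> 'c option tree" where
  "mflip N l x = (if l = None then ((fst x + size1 (left (snd x))) mod N, Node (right (snd x)) None (left (snd x)))
     else (fst x, rot l (snd x)))"

lemma mflip_simps [simp]:
  "mflip N None (p, Node l a r) = ((p + size1 l) mod N, Node r None l)"
  "mflip N (Some c) (p, t) = (p, rot (Some c) t)"
  by (simp_all add: mflip_def)

section \<open>The flip system of tree states\<close>

lemma card_labels: "finite Col \<Longrightarrow> card (labels Col) = card Col + 1"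
  by (simp add: labels_def card_image)

locale states =
  fixes Col :: "'c set"
  assumes finite_Col: "finite Col"
begin

definition N :: nat where "N = card Col + 2"
abbreviation "X \<equiv> mstates Col"
abbreviation "F \<equiv> mflip N"

lemma N_pos [simp]: "0 < N" "N \<noteq> 0"
  by (simp_all add: N_def)

lemma mem_X: "(p, t) \<in> X \<longleftrightarrow>
    p < N \<and> rlab t = Some None \<and> distinct (inorder t) \<and> set_tree t = labels Col"
  by (simp add: mstates_def N_def)

lemma stateE:
  assumes "x \<in> X"
  obtains p l r where "x = (p, Node l None r)" "p < N" "distinct (inorder (Node l None r))"
    "set_tree (Node l None r) = labels Col" "size1 l + size1 r = N"
proof -
  obtain p l r where x: "x = (p, Node l None r)" "p < N" "distinct (inorder (Node l None r))"
    "set_tree (Node l None r) = labels Col"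
    using assms by (cases x) (auto simp: mem_X rlab_Some)
  have "size (Node l None r) = card (labels Col)"
    using x(3,4) by (metis distinct_card length_inorder set_inorder)
  then have "size1 l + size1 r = N" using card_labels[OF finite_Col] by (simp add: size1_size N_def)
  then show ?thesis using x that by blast
qed

lemma stateI:
  "p < N \<Longrightarrow> distinct (inorder (Node l None r)) \<Longrightarrow> set_tree (Node l None r) = labels Col \<Longrightarrow> (p, Node l None r) \<in> X"
  by (auto simp: mem_X)

lemma rot_state: "(p, t) \<in> X \<Longrightarrow> (p, rot c t) \<in> X"
  by (auto simp: mem_X)

lemma F_closed: "x \<in> X \<Longrightarrow> F l x \<in> X"
proof (cases l)
  case None
  assume "x \<in> X"
  then show ?thesis
  proof (cases rule: stateE)
    case (1 p l r)
    then show ?thesis using None by (auto intro!: stateI)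
  qed
next
  case (Some c)
  assume "x \<in> X"
  then show ?thesis using Some by (cases x) (simp add: rot_state)
qed

lemma F_invol: "x \<in> X \<Longrightarrow> F l (F l x) = x"
proof (cases l)
  case None
  assume "x \<in> X"
  then show ?thesis
  proof (cases rule: stateE)
    case (1 p l r)
    then have "((p + size1 l) mod N + size1 r) mod N = (p + N) mod N"
      by (metis add.assoc mod_add_left_eq)
    then show ?thesis using None 1 by simp
  qed
next
  case (Some c)
  assume "x \<in> X"
  then show ?thesis using Some by (cases x) (simp add: rot_invol mem_X)
qed

lemma orb_reach:
  assumes "reach t u" "(p, t) \<in> X"
  shows "(p, u) \<in> orb F (labels Col) (p, t)"
  using assms
proof (induction rule: reach.induct)
  case (reach_step t u c)
  have "set_tree u = labels Col" "rlab u = Some None"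
    using reach_inv[OF reach_step(1)] reach_inv2[OF reach_step(1)] reach_step(5) by (auto simp: mem_X)
  then obtain d where "c = Some d" "c \<in> labels Col" using reach_step by (cases c) auto
  then show ?case using orb_step[where F=F and l=c, OF reach_step(4)[OF reach_step(5)]] by simp
qed simp

lemma orb_comb:
  assumes "(p, t) \<in> X" "distinct cs" "set cs = Col"
  shows "(p, rcomb (None # map Some cs)) \<in> orb F (labels Col) (p, t)"
proof (rule orb_reach[OF _ assms(1)])
  show "reach t (rcomb (None # map Some cs))"
    using assms by (intro reach_rcomb_perm) (auto simp: mem_X labels_def distinct_map)
qed

lemma orb_sym: "x \<in> X \<Longrightarrow> y \<in> orb F L x \<Longrightarrow> x \<in> orb F L y"
proof -
  assume x: "x \<in> X" and y: "y \<in> orb F L x"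
  from y have "y \<in> X \<and> x \<in> orb F L y"
  proof (induction rule: orb_induct)
    case (step z l)
    then have "z \<in> orb F L (F l z)" using orb_step[where F=F and l=l and x="F l z", OF orb_refl] F_invol by auto
    then show ?case using step.IH F_closed orb_trans[where F=F and z=x, of z L "F l z"] by blast
  qed (use x in auto)
  then show ?thesis ..
qed

text \<open>Colored flips lead every state to the fan at its own position. The central flip of a fan
  moves the position on by one, because the left subtree of the fan is a leaf.\<close>

lemma connected:
  assumes "x \<in> X" "y \<in> X"
  shows "y \<in> orb F (labels Col) x"
proof -
  obtain cs where cs: "distinct cs" "set cs = Col" using finite_distinct_list[OF finite_Col] by blast
  let ?t = "rcomb (None # map Some cs)"
  have in_X: "(p, ?t) \<in> X" if "p < N" for p
    using cs that by (auto simp: mem_X labels_def distinct_map)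
  have up: "((p + 1) mod N, ?t) \<in> orb F (labels Col) (p, ?t)" if "p < N" for p
  proof -
    have "F None (p, ?t) = ((p + 1) mod N, Node (rcomb (map Some cs)) None Leaf)" by simp
    then have a: "((p + 1) mod N, Node (rcomb (map Some cs)) None Leaf) \<in> orb F (labels Col) (p, ?t)"
      using orb_step[where F=F and l=None and L="labels Col", OF orb_refl, of "(p, ?t)"] by (simp add: labels_def)
    have b: "((p + 1) mod N, Node (rcomb (map Some cs)) None Leaf) \<in> X"
      using cs by (intro stateI) (auto simp: labels_def distinct_map)
    show ?thesis by (rule orb_trans[OF a orb_comb[OF b cs]])
  qed
  have base: "(p, ?t) \<in> orb F (labels Col) (0, ?t)" if "p < N" for p
    using that
  proof (induction p)
    case (Suc p)
    then have "(p, ?t) \<in> orb F (labels Col) (0, ?t)" "((p + 1) mod N, ?t) \<in> orb F (labels Col) (p, ?t)"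
      using up[of p] by auto
    then have "((p + 1) mod N, ?t) \<in> orb F (labels Col) (0, ?t)" by (rule orb_trans)
    then show ?case using Suc.prems by simp
  qed simp
  have all: "x \<in> orb F (labels Col) (0, ?t)" if "x \<in> X" for x
  proof -
    obtain p t where x: "x = (p, t)" by (cases x)
    have "p < N" using that x by (auto simp: mem_X)
    have "x \<in> orb F (labels Col) (p, ?t)"
      using orb_sym[OF that] orb_comb[of p t, OF _ cs] that x by blast
    then show ?thesis by (rule orb_trans[OF base[OF \<open>p < N\<close>]])
  qed
  show ?thesis using orb_trans[OF orb_sym[OF in_X[of 0] all[OF assms(1)]] all[OF assms(2)]] by simp
qed

sublocale flip_system X "labels Col" F
  by unfold_locales (use F_closed F_invol connected in blast)+

text \<open>For two colors this is the pentagon argument of \<open>adj_rot_neq\<close>. If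
  \<open>c\<close> is the central label, flipping \<open>d\<close> first changes the size of the
  left subtree by a number strictly between 0 and \<open>N\<close>, so the two orders leave the
  central diagonal at different positions.\<close>

lemma adj_not_commute:
  assumes x: "(p, t) \<in> X" and a: "adj t c d"
  shows "F c (F d (p, t)) \<noteq> F d (F c (p, t))"
proof -
  obtain l r where t: "t = Node l None r" and d: "distinct (inorder (Node l None r))"
    and s: "size1 l + size1 r = N"
    using x by (elim stateE) auto
  have "d \<noteq> None" using adj_not_root[OF a] d t by auto
  then obtain d' where d': "d = Some d'" by auto
  show ?thesis
  proof (cases c)
    case None
    have "None \<notin> set_tree l" "None \<notin> set_tree r" using d by auto
    then have "rlab l = Some d \<or> rlab r = Some d" using a t None by (auto dest: adj_in rlab_in)
    then show ?thesis
    proof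
      assume "rlab l = Some d"
      then obtain u w where l: "l = Node u d w" by (auto simp: rlab_Some)
      have "(p + size1 u) mod N \<noteq> (p + size1 l) mod N"
      proof
        assume "(p + size1 u) mod N = (p + size1 l) mod N"
        then have "N dvd (p + size1 l) - (p + size1 u)" using mod_eq_dvd_iff_nat[of "p + size1 u" "p + size1 l" N] l by simp
        then have "N dvd size1 w" using l by simp
        moreover have "size1 w > 0" "size1 w < N" using s l by (auto simp: size1_size)
        ultimately show False by (metis dvd_imp_le not_le)
      qed
      then show ?thesis using None t l d' by simp
    next
      assume "rlab r = Some d"
      then obtain u w where r: "r = Node u d w" by (auto simp: rlab_Some)
      have nl: "rlab l \<noteq> Some d" using d r by (auto dest: rlab_in)
      have "(p + size1 l + size1 u) mod N \<noteq> (p + size1 l) mod N"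
      proof
        assume "(p + size1 l + size1 u) mod N = (p + size1 l) mod N"
        then have "N dvd (p + size1 l + size1 u) - (p + size1 l)" using mod_eq_dvd_iff_nat[of "p + size1 l" "p + size1 l + size1 u" N] by simp
        then have "N dvd size1 u" by simp
        moreover have "size1 u > 0" "size1 u < N" using s r by (auto simp: size1_size)
        ultimately show False by (metis dvd_imp_le not_le)
      qed
      then show ?thesis using None t r d' nl by (simp add: add.assoc)
    qed
  next
    case (Some c')
    then show ?thesis using adj_rot_neq[of t c d] a d t d' by simp
  qed
qed

lemma None_commute:
  assumes "(p, Node l None r) \<in> X" "rlab l \<noteq> Some (Some d)" "rlab r \<noteq> Some (Some d)"
  shows "F None (F (Some d) (p, Node l None r)) = F (Some d) (F None (p, Node l None r))"
  using assms by simp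

text \<open>If \<open>c\<close> is not a child of the root, the two flips commute. Otherwise the
  central diagonal and the pair \<open>c\<close> cut a centrally symmetric hexagon, which has six
  such triangulations; the flips alternate around this 6-cycle, so the two ways of three steps
  meet.\<close>

lemma None_braid:
  assumes "x \<in> X"
  shows "F None (F (Some c) x) = F (Some c) (F None x) \<or>
    F (Some c) (F None (F (Some c) x)) = F None (F (Some c) (F None x))"
  using assms
proof (cases rule: stateE)
  case (1 p l r)
  consider "rlab l \<noteq> Some (Some c)" "rlab r \<noteq> Some (Some c)"
    | a b where "l = Node a (Some c) b" | a b where "r = Node a (Some c) b"
    by (auto simp: rlab_Some)
  then show ?thesis
  proof cases
    case 1
    then show ?thesis using None_commute[of p l r c] \<open>x = _\<close> assms by blast
  next
    case (2 a b)
    have "((p + size1 l) mod N + (size1 r + size1 a)) mod N = (p + size1 a + (size1 l + size1 r)) mod N"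
      by (metis (no_types, lifting) add.assoc add.commute mod_add_left_eq)
    then have "((p + size1 l) mod N + (size1 r + size1 a)) mod N = (p + size1 a) mod N"
      using 1(5) by simp
    then show ?thesis using 1 2 by (auto simp: rlab_notin)
  next
    case (3 a b)
    have "rlab l \<noteq> Some (Some c)" using 1 3 by (auto dest: rlab_in)
    moreover have "((p + (size1 l + size1 a)) mod N + size1 b) mod N = (p + (size1 l + size1 r)) mod N"
      using 3 by (metis add.assoc mod_add_left_eq size1.simps(2))
    ultimately show ?thesis using 1 3 by (auto simp: rlab_notin mod_simps add.assoc)
  qed
qed

text \<open>If \<open>None\<close> went to a color \<open>d\<close>, then injectivity and a second
  color give some \<open>c'\<close> sent to a color \<open>e\<close>. The relations between the
  central flip and \<open>c'\<close> would carry over to \<open>d\<close> and \<open>e\<close> at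
  every state, but the fan with \<open>d\<close> and \<open>e\<close> below the root violates
  both.\<close>

lemma compat_fixes_None:
  assumes c: "compat q g" and "card Col \<ge> 2"
  shows "q None = None"
proof (rule ccontr)
  assume "q None \<noteq> None"
  then obtain d where d: "q None = Some d" by auto
  have q: "inj_on q (labels Col)" "q ` labels Col = labels Col" using c by (auto simp: compat_def bij_betw_def)
  obtain c1 where c1: "c1 \<in> Col" using assms(2) by fastforce
  have "Col - {c1} \<noteq> {}" using assms(2) finite_Col
    by (metis card_1_singleton_iff Diff_eq_empty_iff One_nat_def Suc_1 c1 insert_absorb not_less_eq_eq order_refl subset_singletonD empty_iff)
  then obtain c2 where c2: "c2 \<in> Col" "c2 \<noteq> c1" by blast
  have "q (Some c1) \<noteq> q (Some c2)" using q(1) c1 c2 by (auto simp: inj_on_def labels_def)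
  then obtain c' where c': "c' \<in> Col" "q (Some c') \<noteq> None" using c1 c2 by metis
  then obtain e where e: "q (Some c') = Some e" by auto
  have L: "None \<in> labels Col" "Some c' \<in> labels Col" using c' by (auto simp: labels_def)
  have de: "d \<in> Col" "e \<in> Col" using q(2) d e L by (force simp: labels_def)+
  have "d \<noteq> e" using q(1) L d e by (metis inj_onD option.distinct(1))
  obtain cs where cs: "distinct cs" "set cs = Col - {d, e}" using finite_distinct_list[of "Col - {d, e}"] finite_Col by blast
  let ?ls = "None # Some d # Some e # map Some cs"
  have dist: "distinct ?ls" using cs \<open>d \<noteq> e\<close> by (auto simp: distinct_map)
  have "(0, rcomb ?ls) \<in> X" using dist cs de by (auto simp: mem_X labels_def)
  then obtain x where x: "x \<in> X" "g x = (0, rcomb ?ls)" using c by (metis bij_betw_def compat_def imageE)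
  have gF: "g (F l y) = F (q l) (g y)" if "l \<in> labels Col" "y \<in> X" for l y
    using c that by (auto simp: compat_def)
  from None_braid[OF x(1), of c'] have
    "F (Some d) (F (Some e) (g x)) = F (Some e) (F (Some d) (g x)) \<or>
     F (Some e) (F (Some d) (F (Some e) (g x))) = F (Some d) (F (Some e) (F (Some d) (g x)))"
    using x(1) F_closed L by (metis gF d e)
  then show False using rcomb_braid_neq[OF dist] unfolding x(2) by (auto simp del: rcomb.simps rot.simps)
qed

section \<open>Rigidity of zigzag states\<close>

lemma zigzag_state:
  assumes "distinct cs" "set cs = Col" "p < N"
  shows "(p, zigzag b (None # map Some cs)) \<in> X"
  using assms by (auto simp: mem_X labels_def distinct_map)

lemma split2:
  assumes "c \<in> set xs" "d \<in> set xs" "c \<noteq> d" "\<not> consecutive c d xs"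
  obtains us ws vs where "ws \<noteq> []" "xs = us @ c # ws @ d # vs \<or> xs = us @ d # ws @ c # vs"
proof -
  obtain us ys where xs: "xs = us @ c # ys" using assms(1) by (meson split_list)
  show ?thesis
  proof (cases "d \<in> set ys")
    case True
    then obtain ws vs where "ys = ws @ d # vs" by (meson split_list)
    then show ?thesis using xs that[of ws us vs] assms(4) by (cases ws) (auto simp: consecutive_def)
  next
    case False
    then have "d \<in> set us" using assms xs by auto
    then obtain ws vs where "us = ws @ d # vs" by (meson split_list)
    then show ?thesis using xs that[of vs ws ys] assms(4) by (cases vs) (auto simp: consecutive_def)
  qed
qed

lemma compat_id_rigid:
  assumes c: "compat q g" and q: "\<And>l. l \<in> labels Col \<Longrightarrow> q l = l"
    and cs: "distinct cs" "set cs = Col"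
  obtains p b where "p < N" "g (0, zigzag True (None # map Some cs)) = (p, zigzag b (None # map Some cs))"
proof -
  let ?ls = "None # map Some cs"
  let ?t = "zigzag True ?ls"
  have dist: "distinct ?ls" and set: "set ?ls = labels Col" using cs by (auto simp: distinct_map labels_def)
  have x0: "(0, ?t) \<in> X" by (rule zigzag_state[OF cs]) simp
  obtain p t where y: "g (0, ?t) = (p, t)" by (cases "g (0, ?t)")
  have y_in: "(p, t) \<in> X" using c x0 y by (metis bij_betwE compat_def)
  then have t: "p < N" "rlab t = Some None" "distinct (inorder t)" "set_tree t = labels Col"
    by (auto simp: mem_X)
  have gF: "g (F l x) = F l (g x)" if "l \<in> labels Col" "x \<in> X" for l x
    using c that q by (auto simp: compat_def)
  \<comment> \<open>Labels are fixed, so a commutation at \<open>x\<close> passes to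
    \<open>g x\<close>. Together with \<open>adj_not_commute\<close>, edges whose flips commute at
    the zigzag cannot be adjacent in its image.\<close>
  have transfer: "F a (F b (g x)) = F b (F a (g x))"
    if "x \<in> X" "a \<in> labels Col" "b \<in> labels Col" "F a (F b x) = F b (F a x)" for a b x
    using that F_closed by (metis gF)
  have far: "F a (F d (0, ?t)) = F d (F a (0, ?t))"
    if ls: "?ls = us @ a # ws @ d # vs" and "ws \<noteq> []" for us ws vs a d
  proof (cases us)
    case Nil
    then have a: "a = None" and cs': "map Some cs = ws @ d # vs" using ls by auto
    then obtain d' where d': "d = Some d'" by (metis in_set_conv_decomp ex_map_conv)
    have "rlab (zigzag False (map Some cs)) \<noteq> Some d"
      using cs' \<open>ws \<noteq> []\<close> dist by (cases ws) auto
    then show ?thesis using None_commute[of 0 Leaf "zigzag False (map Some cs)" d'] x0 a d' by simp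
  next
    case (Cons u us')
    then have "map Some cs = us' @ a # ws @ d # vs" using ls by auto
    then have "a \<in> Some ` set cs" "d \<in> Some ` set cs"
      by (metis in_set_conv_decomp list.set_map append_assoc append_Cons)+
    then obtain a' d' where "a = Some a'" "d = Some d'" by auto
    moreover have "?ls = u # us' @ a # ws @ d # vs" using ls Cons by simp
    ultimately show ?thesis using zigzag_commute[of u us' a ws d vs True] dist \<open>ws \<noteq> []\<close> by (simp del: zigzag.simps rot.simps)
  qed
  have "t = zigzag True ?ls \<or> t = zigzag False ?ls"
  proof (rule zigzag_unique)
    show "consecutive a d ?ls" if "adj t a d" for a d
    proof (rule ccontr)
      assume n: "\<not> consecutive a d ?ls"
      have nc: "F a (F d (p, t)) \<noteq> F d (F a (p, t))" using adj_not_commute[OF y_in that] .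
      then have ne: "a \<noteq> d" by auto
      have ad: "a \<in> set ?ls" "d \<in> set ?ls" using adj_in[OF that] t(4) set by auto
      from split2[OF ad ne n] obtain us ws vs where
        *: "ws \<noteq> []" "?ls = us @ a # ws @ d # vs \<or> ?ls = us @ d # ws @ a # vs" .
      from *(2) have "F a (F d (0, ?t)) = F d (F a (0, ?t))"
      proof
        assume "?ls = us @ a # ws @ d # vs"
        then show ?thesis using *(1) by (rule far)
      next
        assume "?ls = us @ d # ws @ a # vs"
        then show ?thesis using *(1) by (rule far[symmetric])
      qed
      then show False using transfer[OF x0, of a d] nc ad set y by auto
    qed
    \<comment> \<open>The same comparison after flipping \<open>b\<close>: in a zigzag the flips of
      its neighbors \<open>a\<close> and \<open>d\<close> then commute, which excludes a fan in the
      image.\<close>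
    show "\<not> adj (rot b t) a d" if ls: "?ls = us @ a # b # d # vs" for us a b d vs
    proof
      assume adj: "adj (rot b t) a d"
      \<comment> \<open>Only the first entry of the list is the central label, so \<open>b\<close>
        and \<open>d\<close> are colors, while \<open>a\<close> may be central.\<close>
      obtain us' where us': "map Some cs = us' @ b # d # vs" using ls by (cases us) auto
      then obtain b' d' where b': "b = Some b'" "d = Some d'"
        by (metis in_set_conv_decomp list.set_map append_assoc append_Cons imageE append_Nil)
      have L: "a \<in> labels Col" "b \<in> labels Col" "d \<in> labels Col" using ls set by (metis in_set_conv_decomp append_assoc append_Cons append_Nil)+
      have Fx: "F b (0, ?t) \<in> X" by (rule F_closed[OF L(2) x0])
      have "F a (F d (F b (0, ?t))) = F d (F a (F b (0, ?t)))"
      proof (cases us)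
        case Nil
        then have a: "a = None" and cs': "map Some cs = b # d # vs" using ls by auto
        have *: "F b (0, ?t) = (0, Node (Node Leaf b (zigzag True (d # vs))) None Leaf)"
          using cs' b' by simp
        show ?thesis using Fx dist cs' unfolding * a b'(2) by (intro None_commute) (auto simp: b')
      next
        case (Cons u us')
        then have "map Some cs = us' @ a # b # d # vs" using ls by auto
        then have "a \<in> Some ` set cs"
          by (metis in_set_conv_decomp list.set_map)
        then obtain a' where "a = Some a'" by auto
        moreover have "?ls = u # us' @ a # b # d # vs" using ls Cons by simp
        ultimately show ?thesis using zigzag_commute_rot[of u us' a b d vs True] dist b' by (simp del: zigzag.simps rot.simps)
      qed
      then have "F a (F d (g (F b (0, ?t)))) = F d (F a (g (F b (0, ?t))))"
        using transfer[OF Fx] L by blast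
      moreover have "g (F b (0, ?t)) = (p, rot b t)" using gF[OF L(2) x0] y b' by simp
      ultimately show False using adj_not_commute[OF rot_state[OF y_in] adj] by simp
    qed
  qed (use t dist set in auto)
  then show ?thesis using that[OF t(1)] y by blast
qed

end

section \<open>Dihedral symmetries and recolorings\<close>

lemma (in flip_system) compat_comp:
  assumes "compat p g" "compat q h"
  shows "compat (p \<circ> q) (g \<circ> h)"
proof -
  have "q l \<in> Lab" if "l \<in> Lab" for l using assms(2) that by (auto simp: compat_def bij_betw_def)
  moreover have "h x \<in> X" if "x \<in> X" for x using assms(2) that by (auto simp: compat_def bij_betw_def)
  ultimately show ?thesis
    using assms by (auto simp: compat_def intro: bij_betw_trans)
qed

context states
begin

text \<open>The reflection of indices j to i - j maps the half polygon from p to p + N onto the one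
  from i - p - N to i - p, read backwards. Hence the mirrored tree, at position i - p modulo
  \<open>N\<close>.\<close>

definition dih :: "int \<times> bool \<Rightarrow> nat \<times> 'c option tree \<Rightarrow> nat \<times> 'c option tree" where
  "dih d x = (nat ((if snd d then fst d - int (fst x) else fst d + int (fst x)) mod int N),
     if snd d then mirror (snd x) else snd x)"

definition recolor :: "('c \<Rightarrow> 'c) \<Rightarrow> nat \<times> 'c option tree \<Rightarrow> nat \<times> 'c option tree" where
  "recolor \<tau> x = (fst x, map_tree (map_option \<tau>) (snd x))"

lemma nat_mod_eq: "nat (a mod int N) = nat (b mod int N) \<longleftrightarrow> a mod int N = b mod int N"
  by (auto simp: nat_eq_iff2)

lemma rlab_mirror [simp]: "rlab (mirror t) = rlab t"
  by (cases t) auto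

lemma set_tree_mirror [simp]: "set_tree (mirror t) = set_tree t"
  using set_inorder[of "mirror t"] by (simp add: inorder_mirror)

lemma dih_in: "x \<in> X \<Longrightarrow> dih d x \<in> X"
proof -
  have "nat (z mod int N) < N" for z by (simp add: nat_less_iff)
  then show "x \<in> X \<Longrightarrow> dih d x \<in> X"
    by (cases x) (simp add: dih_def mem_X inorder_mirror)
qed

lemma dih_comp:
  "dih d (dih e x) = dih (if snd d then fst d - fst e else fst d + fst e, snd d \<noteq> snd e) x"
proof -
  have "(fst d - (fst e - int (fst x)) mod int N) mod int N = (fst d - fst e + int (fst x)) mod int N"
    "(fst d - (fst e + int (fst x)) mod int N) mod int N = (fst d - fst e - int (fst x)) mod int N"
    "(fst d + (fst e - int (fst x)) mod int N) mod int N = (fst d + fst e - int (fst x)) mod int N"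
    "(fst d + (fst e + int (fst x)) mod int N) mod int N = (fst d + fst e + int (fst x)) mod int N"
    by (simp_all add: mod_simps algebra_simps)
  then show ?thesis by (cases "snd d"; cases "snd e") (simp_all add: dih_def)
qed

lemma dih_mod: "dih (i mod int N, s) x = dih (i, s) x"
  by (simp add: dih_def mod_simps)

lemma dih_id: "x \<in> X \<Longrightarrow> dih (0, False) x = x"
  by (cases x) (simp add: dih_def mem_X)

lemma dih_F:
  assumes "x \<in> X"
  shows "dih d (F l x) = F l (dih d x)"
proof (cases l)
  case (Some c)
  obtain p t where "x = (p, t)" by (cases x)
  then show ?thesis using Some assms by (simp add: dih_def mem_X mirror_rot)
next
  case None
  from assms show ?thesis
  proof (cases rule: stateE)
    case (1 p u w)
    have A: "(nat (z mod int N) + k) mod N = nat ((z + int k) mod int N)" for z k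
    proof -
      have "int ((nat (z mod int N) + k) mod N) = (z + int k) mod int N"
        by (simp add: zmod_int mod_simps)
      then show ?thesis by linarith
    qed
    have B: "(i + int ((p + k) mod N)) mod int N = (i + int p + int k) mod int N"
      "(i - int ((p + k) mod N)) mod int N = (i - int p - int k) mod int N" for i k
      by (simp_all add: zmod_int mod_simps algebra_simps)
    \<comment> \<open>The central flip of the mirrored tree moves past the former right subtree. As
      \<open>size1 u\<close> and \<open>size1 w\<close> add up to \<open>N\<close>, moving forward
      by one is moving back by the other.\<close>
    have "fst d - int p + int (size1 w) = fst d - int p - int (size1 u) + int N" using 1(5) by linarith
    then have C: "(fst d - int p - int (size1 u)) mod int N = (fst d - int p + int (size1 w)) mod int N"
      by (metis mod_add_self2)
    show ?thesis unfolding None 1(1)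
      by (cases "snd d") (simp_all only: dih_def mflip_simps fst_conv snd_conv A B C if_True if_False
          mirror.simps size1_mirror)
  qed
qed

lemma compat_dih: "compat id (dih d)"
proof -
  let ?e = "(if snd d then fst d else - fst d, snd d)"
  have "dih ?e (dih d x) = x" "dih d (dih ?e x) = x" if "x \<in> X" for x
    using dih_id[OF that] unfolding dih_comp by simp_all
  then have "bij_betw (dih d) X X"
    by (intro bij_betw_byWitness[where f' = "dih ?e"]) (auto intro: dih_in)
  then show ?thesis using dih_F by (simp add: compat_def)
qed

lemma recolor_comp: "recolor \<tau> (recolor \<rho> x) = recolor (\<tau> \<circ> \<rho>) x"
  by (simp add: recolor_def tree.map_comp option.map_comp comp_def)

lemma recolor_id: "recolor (\<lambda>c. c) x = x"
proof -
  have "map_option (\<lambda>c. c) = (\<lambda>l :: 'c option. l)" by (rule ext) (simp add: option.map_ident)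
  then show ?thesis by (simp add: recolor_def tree.map_ident)
qed

lemma recolor_cong:
  "x \<in> X \<Longrightarrow> (\<And>c. c \<in> Col \<Longrightarrow> \<tau> c = \<rho> c) \<Longrightarrow> recolor \<tau> x = recolor \<rho> x"
  by (cases x) (auto simp: recolor_def mem_X labels_def intro!: tree.map_cong)

lemma bij_map_option:
  assumes "bij_betw \<tau> Col Col"
  shows "bij_betw (map_option \<tau>) (labels Col) (labels Col)"
proof -
  have "inj_on (map_option \<tau>) (labels Col)" using assms by (auto simp: inj_on_def labels_def bij_betw_def)
  moreover have "map_option \<tau> ` labels Col = insert None (Some ` (\<tau> ` Col))" by (simp add: labels_def image_image)
  ultimately show ?thesis using assms by (simp add: bij_betw_def labels_def)
qed

lemma recolor_in:
  assumes "bij_betw \<tau> Col Col" "x \<in> X"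
  shows "recolor \<tau> x \<in> X"
proof -
  have "inj_on (map_option \<tau>) (labels Col)" "map_option \<tau> ` labels Col = labels Col"
    using bij_map_option[OF assms(1)] by (auto simp: bij_betw_def)
  then show ?thesis using assms(2)
    by (cases x) (simp add: recolor_def mem_X inorder_map distinct_map tree.set_map)
qed

lemma compat_recolor:
  assumes \<tau>: "bij_betw \<tau> Col Col"
  shows "compat (map_option \<tau>) (recolor \<tau>)"
proof -
  let ?\<rho> = "inv_into Col \<tau>"
  have \<rho>: "bij_betw ?\<rho> Col Col" using bij_betw_inv_into[OF \<tau>] .
  have "recolor ?\<rho> (recolor \<tau> x) = x" "recolor \<tau> (recolor ?\<rho> x) = x" if "x \<in> X" for x
    unfolding recolor_comp
    using recolor_cong[OF that, of "?\<rho> \<circ> \<tau>" "\<lambda>c. c"] recolor_cong[OF that, of "\<tau> \<circ> ?\<rho>" "\<lambda>c. c"]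
      bij_betw_inv_into_left[OF \<tau>] bij_betw_inv_into_right[OF \<tau>] recolor_id by auto
  then have "bij_betw (recolor \<tau>) X X"
    using recolor_in[OF \<tau>] recolor_in[OF \<rho>] by (intro bij_betw_byWitness[where f' = "recolor ?\<rho>"]) auto
  moreover have "recolor \<tau> (F l x) = F (map_option \<tau> l) (recolor \<tau> x)" if "l \<in> labels Col" "x \<in> X" for l x
  proof (cases l)
    case None
    from that(2) show ?thesis
      by (cases rule: stateE) (simp add: None recolor_def )
  next
    case (Some c)
    have "inj_on (map_option \<tau>) (labels Col)" using bij_map_option[OF \<tau>] by (simp add: bij_betw_def)
    then have "map_tree (map_option \<tau>) (rot l (snd x)) = rot (map_option \<tau> l) (map_tree (map_option \<tau>) (snd x))"
      using that by (intro map_rot) (cases x; auto simp: mem_X)+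
    then show ?thesis using Some by (cases x) (simp add: recolor_def)
  qed
  ultimately show ?thesis using bij_map_option[OF \<tau>] by (simp add: compat_def)
qed

lemma dih_recolor: "dih d (recolor \<tau> x) = recolor \<tau> (dih d x)"
proof -
  have "mirror (map_tree f t) = map_tree f (mirror t)" for f :: "'c option \<Rightarrow> 'c option" and t
    by (induction t) auto
  then show ?thesis by (simp add: dih_def recolor_def)
qed

section \<open>The group for at least two colors\<close>

lemma zigzag_b_eq: "xs \<noteq> [] \<Longrightarrow> distinct (x # xs) \<Longrightarrow> zigzag b (x # xs) = zigzag b' (x # xs) \<longleftrightarrow> b = b'"
  by (cases xs; cases b; cases b') auto

text \<open>Recolorings and symmetries of the polygon commute (\<open>dih_recolor\<close>), hence
  the direct product. Once a recoloring has undone the permutation of the labels, rigidity leaves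
  only the symmetries of the polygon.\<close>

theorem automorphism_group_large:
  assumes n: "card Col \<ge> 2" and model: "cyclohedron_model X Col F m v c enc"
  shows "order_automorphism_group (colorful_cyclohedron m v c Col)
    \<cong> sym_group (card Col) \<times>\<times> dihedral_group (card Col + 2)"
proof -
  interpret C: cyclohedron_model X Col F m v c enc by fact
  let ?n = "card Col"
  define H where "H = sym_group ?n \<times>\<times> dihedral_group (card Col + 2)"
  define A where "A = {1..?n}"
  obtain \<beta> where \<beta>: "bij_betw \<beta> A Col"
    using ex_bij_betw_nat_finite_1[OF finite_Col] unfolding A_def by blast
  define \<gamma> where "\<gamma> = inv_into A \<beta>"
  have \<gamma>: "bij_betw \<gamma> Col A" "\<And>a. a \<in> Col \<Longrightarrow> \<beta> (\<gamma> a) = a" "\<And>k. k \<in> A \<Longrightarrow> \<gamma> (\<beta> k) = k"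
    using bij_betw_inv_into[OF \<beta>] bij_betw_inv_into_right[OF \<beta>] bij_betw_inv_into_left[OF \<beta>]
    by (auto simp: \<gamma>_def)
  \<comment> \<open>\<open>sym_group\<close> permutes the numbers from 1 to n; conjugation by
    \<beta> transports its elements to permutations of \<open>Col\<close>.\<close>
  define \<tau> where "\<tau> \<sigma> = \<beta> \<circ> \<sigma> \<circ> \<gamma>" for \<sigma>
  have \<tau>_bij: "bij_betw (\<tau> \<sigma>) Col Col" if "\<sigma> permutes A" for \<sigma>
    unfolding \<tau>_def using \<gamma>(1) permutes_imp_bij[OF that] \<beta> by (intro bij_betw_trans)
  have \<tau>_comp: "\<tau> (\<sigma> \<circ> \<rho>) a = \<tau> \<sigma> (\<tau> \<rho> a)" if "\<rho> permutes A" "a \<in> Col" for \<sigma> \<rho> a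
  proof -
    have "\<rho> (\<gamma> a) \<in> A" using that \<gamma>(1) by (metis bij_betwE permutes_in_image)
    then show ?thesis using \<gamma>(3) by (simp add: \<tau>_def)
  qed
  obtain cs where cs: "distinct cs" "set cs = Col" using finite_distinct_list[OF finite_Col] by blast
  let ?t = "\<lambda>b. zigzag b (None # map Some cs)"
  define p where "p h = map_option (\<tau> (fst h))" for h :: "(nat \<Rightarrow> nat) \<times> (int \<times> bool)"
  define g where "g h = (\<lambda>x. dih (snd h) (recolor (\<tau> (fst h)) x))" for h
  have x0: "(0, ?t True) \<in> X" by (rule zigzag_state[OF cs]) simp
  have H: "group H"
    unfolding H_def by (intro DirProd_group sym_group_is_group group_dihedral_group) simp
  have carrier: "h \<in> carrier H \<longleftrightarrow> fst h permutes A \<and> 0 \<le> fst (snd h) \<and> fst (snd h) < int N" for h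
    by (cases h) (auto simp: H_def A_def DirProd_def sym_group_def dihedral_group_def N_def)
  have mult: "fst (h \<otimes>\<^bsub>H\<^esub> k) = fst h \<circ> fst k"
    "snd (h \<otimes>\<^bsub>H\<^esub> k) = ((if snd (snd h) then fst (snd h) - fst (snd k) else fst (snd h) + fst (snd k)) mod int N,
        snd (snd h) \<noteq> snd (snd k))" for h k
    by (cases h; cases k; auto simp: H_def DirProd_def sym_group_def dihedral_group_def N_def)+
  have compat: "compat (p h) (g h)" if "h \<in> carrier H" for h
  proof -
    have "compat (id \<circ> map_option (\<tau> (fst h))) (dih (snd h) \<circ> recolor (\<tau> (fst h)))"
      using that carrier \<tau>_bij by (intro compat_comp compat_dih compat_recolor) auto
    then show ?thesis by (simp add: p_def g_def comp_def)
  qed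
  have p_mult: "p (h \<otimes>\<^bsub>H\<^esub> k) l = p h (p k l)" if "h \<in> carrier H" "k \<in> carrier H" "l \<in> labels Col" for h k l
    using that \<tau>_comp carrier by (auto simp: p_def mult labels_def)
  have g_mult: "g (h \<otimes>\<^bsub>H\<^esub> k) x = g h (g k x)" if h: "h \<in> carrier H" "k \<in> carrier H" "x \<in> X" for h k x
  proof -
    have "recolor (\<tau> (fst h)) (recolor (\<tau> (fst k)) x) = recolor (\<tau> (fst h \<circ> fst k)) x"
      unfolding recolor_comp using that carrier \<tau>_comp by (intro recolor_cong) auto
    then have "g h (g k x) = dih (snd h) (dih (snd k) (recolor (\<tau> (fst h \<circ> fst k)) x))"
      by (simp add: g_def dih_recolor[symmetric])
    then show ?thesis unfolding dih_comp by (simp add: g_def mult dih_mod)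
  qed
  have p_eq: "\<sigma> = \<rho>" if "\<sigma> permutes A" "\<rho> permutes A" "\<And>a. a \<in> Col \<Longrightarrow> \<tau> \<sigma> a = \<tau> \<rho> a" for \<sigma> \<rho>
  proof
    fix k show "\<sigma> k = \<rho> k"
    proof (cases "k \<in> A")
      case True
      have "\<tau> \<sigma> (\<beta> k) = \<tau> \<rho> (\<beta> k)" using that(3) bij_betwE[OF \<beta>] True by blast
      then have "\<beta> (\<sigma> k) = \<beta> (\<rho> k)" using \<gamma>(3)[OF True] by (simp add: \<tau>_def)
      moreover have "\<sigma> k \<in> A" "\<rho> k \<in> A" using True that by (metis permutes_in_image)+
      ultimately show ?thesis using \<gamma>(3) by metis
    qed (use that in \<open>simp add: permutes_not_in\<close>)
  qed
  have g0: "dih d (0, ?t b) = (nat (fst d mod int N), ?t (b \<noteq> snd d))" for d b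
    by (cases "snd d") (simp_all add: dih_def mirror_zigzag del: zigzag.simps)
  \<comment> \<open>With an edge below the central one the two zigzags differ, so a reflection is
    visible at the base state.\<close>
  have "map Some cs \<noteq> []" "distinct (None # map Some cs)" using cs n by (auto simp: distinct_map)
  then have t_eq: "?t b = ?t b' \<longleftrightarrow> b = b'" for b b' by (rule zigzag_b_eq)
  show ?thesis unfolding H_def[symmetric]
  proof (rule C.automorphism_group_iso[OF H x0 compat p_mult g_mult])
    fix h k assume hk: "h \<in> carrier H" "k \<in> carrier H" "\<And>l. l \<in> labels Col \<Longrightarrow> p h l = p k l"
      "g h (0, ?t True) = g k (0, ?t True)"
    have \<tau>_eq: "\<tau> (fst h) a = \<tau> (fst k) a" if "a \<in> Col" for a
      using hk(3)[of "Some a"] that by (simp add: p_def labels_def)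
    then have 1: "fst h = fst k" using p_eq hk carrier by blast
    have "recolor (\<tau> (fst h)) (dih (snd h) (0, ?t True)) = recolor (\<tau> (fst h)) (dih (snd k) (0, ?t True))"
      using hk(4) 1 by (simp only: g_def dih_recolor)
    moreover have "inj_on (recolor (\<tau> (fst h))) X"
      using compat_recolor[OF \<tau>_bij] hk carrier by (simp add: compat_def bij_betw_def)
    ultimately have "dih (snd h) (0, ?t True) = dih (snd k) (0, ?t True)"
      using x0 dih_in by (meson inj_onD)
    then have "nat (fst (snd h) mod int N) = nat (fst (snd k) mod int N)" "snd (snd h) = snd (snd k)"
      unfolding g0 using t_eq by auto
    moreover have "fst (snd h) mod int N = fst (snd h)" "fst (snd k) mod int N = fst (snd k)"
      using hk carrier by simp_all
    ultimately have "fst (snd h) = fst (snd k)" "snd (snd h) = snd (snd k)"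
      by (metis nat_mod_eq, metis)
    then show "h = k" using 1 by (simp add: prod_eq_iff)
  next
    fix q f assume qf: "compat q f"
    have q: "bij_betw q (labels Col) (labels Col)" using qf by (simp add: compat_def)
    have qN: "q None = None" using compat_fixes_None[OF qf n] .
    define \<rho> where "\<rho> a = the (q (Some a))" for a
    have q\<rho>: "q (Some a) = Some (\<rho> a)" if "a \<in> Col" for a
    proof -
      have "q (Some a) \<noteq> q None" using q that by (auto simp: bij_betw_def inj_on_def labels_def)
      then show ?thesis using qN by (auto simp: \<rho>_def)
    qed
    have "inj_on \<rho> Col"
    proof (rule inj_onI)
      fix a b assume ab: "a \<in> Col" "b \<in> Col" "\<rho> a = \<rho> b"
      then have "q (Some a) = q (Some b)" using q\<rho> by simp
      then show "a = b" using q ab by (auto simp: bij_betw_def inj_on_def labels_def)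
    qed
    moreover have "\<rho> ` Col \<subseteq> Col"
    proof
      fix b assume "b \<in> \<rho> ` Col"
      then obtain a where "a \<in> Col" "b = \<rho> a" by blast
      then have "Some b \<in> labels Col" using q q\<rho>[of a] by (metis bij_betwE imageI insertCI labels_def)
      then show "b \<in> Col" by (auto simp: labels_def)
    qed
    ultimately have \<rho>: "bij_betw \<rho> Col Col" using finite_Col by (simp add: bij_betw_def endo_inj_surj)
    define \<sigma> where "\<sigma> k = (if k \<in> A then \<gamma> (\<rho> (\<beta> k)) else k)" for k
    have "bij_betw (\<gamma> \<circ> \<rho> \<circ> \<beta>) A A" using \<beta> \<rho> \<gamma>(1) by (intro bij_betw_trans)
    then have "bij_betw \<sigma> A A" by (rule bij_betw_cong[THEN iffD1, rotated]) (simp add: \<sigma>_def)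
    then have \<sigma>: "\<sigma> permutes A" by (rule bij_imp_permutes) (simp add: \<sigma>_def)
    have \<tau>\<sigma>: "\<tau> \<sigma> a = \<rho> a" if "a \<in> Col" for a
    proof -
      have "\<gamma> a \<in> A" "\<rho> a \<in> Col" using \<gamma>(1) \<rho> that bij_betwE by blast+
      then show ?thesis using \<gamma>(2) that by (simp add: \<tau>_def \<sigma>_def)
    qed
    \<comment> \<open>A pure recoloring with the same effect on labels as \<open>q\<close>.
      Composing \<open>f\<close> with its inverse leaves a pair with trivial label part, to which
      rigidity applies.\<close>
    let ?k = "(\<sigma>, (0, False))"
    interpret HH: group H by fact
    have k: "?k \<in> carrier H" using \<sigma> carrier by simp
    let ?j = "inv\<^bsub>H\<^esub> ?k"
    have pk: "p ?k l = q l" if "l \<in> labels Col" for l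
      using that qN q\<rho> \<tau>\<sigma> by (auto simp: p_def labels_def)
    have j: "?j \<in> carrier H" using k by simp
    have one: "\<one>\<^bsub>H\<^esub> = (id, (0, False))"
      by (simp add: H_def DirProd_def sym_group_def dihedral_group_def)
    have \<tau>id: "\<tau> id a = a" if "a \<in> Col" for a using \<gamma>(2) that by (simp add: \<tau>_def)
    have p1: "p \<one>\<^bsub>H\<^esub> l = l" if "l \<in> labels Col" for l
      using that \<tau>id by (auto simp: p_def one labels_def)
    have g1: "g \<one>\<^bsub>H\<^esub> x = x" if "x \<in> X" for x
    proof -
      have "recolor (\<tau> id) x = recolor (\<lambda>a. a) x" using \<tau>id that by (intro recolor_cong) auto
      then show ?thesis using dih_id[OF that] by (simp add: g_def one recolor_id)
    qed
    have "compat (p ?j \<circ> q) (g ?j \<circ> f)" using compat_comp compat[OF j] qf by blast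
    moreover have "(p ?j \<circ> q) l = l" if "l \<in> labels Col" for l
      using p_mult[OF j k that] p1[OF that] pk[OF that] HH.l_inv[OF k] by simp
    ultimately obtain i b where ib: "i < N" "(g ?j \<circ> f) (0, ?t True) = (i, ?t b)"
      using compat_id_rigid[OF _ _ cs] by metis
    have f0: "f (0, ?t True) \<in> X" using qf x0 by (metis bij_betwE compat_def)
    have "f (0, ?t True) = g ?k (g ?j (f (0, ?t True)))"
      using g_mult[OF k j f0] g1[OF f0] HH.r_inv[OF k] by simp
    also have "\<dots> = g ?k (i, ?t b)" using ib by simp
    \<comment> \<open>The base state has flag \<open>True\<close>, so a reflection is needed exactly
      when \<open>b\<close> is false.\<close>
    also have "(i, ?t b) = dih (int i, \<not> b) (0, ?t True)"
      unfolding g0 using ib(1) by simp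
    also have "g ?k \<dots> = g (\<sigma>, (int i, \<not> b)) (0, ?t True)"
      using dih_id[OF recolor_in[OF \<tau>_bij[OF \<sigma>] dih_in[OF x0]]] by (simp add: g_def dih_recolor del: zigzag.simps)
    finally have "g (\<sigma>, (int i, \<not> b)) (0, ?t True) = f (0, ?t True)" ..
    moreover have "(\<sigma>, (int i, \<not> b)) \<in> carrier H" using \<sigma> ib carrier by simp
    moreover have "p (\<sigma>, (int i, \<not> b)) l = q l" if "l \<in> labels Col" for l
      using pk[OF that] by (simp add: p_def)
    ultimately show "\<exists>h\<in>carrier H. (\<forall>l\<in>labels Col. p h l = q l) \<and> g h (0, ?t True) = f (0, ?t True)" by blast
  qed
qed

end

section \<open>Centrally symmetric polygons\<close>

text \<open>Twice the signed area of the triangle, the quantity whose sign \<open>ccw\<close>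
  tests.\<close>

definition area :: "complex \<Rightarrow> complex \<Rightarrow> complex \<Rightarrow> real" where
  "area a b c = Im (cnj (b - a) * (c - a))"

lemma area_rotate: "area b c a = area a b c"
  by (simp add: area_def algebra_simps)

lemma area_swap: "area a c b = - area a b c"
  by (simp add: area_def algebra_simps)

lemma area_self [simp]: "area a b a = 0" "area a b b = 0" "area a a b = 0"
  by (simp_all add: area_def algebra_simps)

lemma area_affine: "area a b ((1 - u) *\<^sub>R c + u *\<^sub>R d) = (1 - u) * area a b c + u * area a b d"
  by (simp add: area_def algebra_simps)

lemma area_reflection:
  "area (point_reflection z a) (point_reflection z b) (point_reflection z c) = area a b c"
  by (simp add: area_def point_reflection_def algebra_simps)

lemma area_closed_segment: "x \<in> closed_segment a b \<Longrightarrow> area a b x = 0"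
  by (auto simp: in_segment area_affine)

text \<open>Cramer's rule: an affine dependency of four points of the plane with triangle areas as
  coefficients.\<close>

lemma area_four_points:
  "of_real (area a c d) * b + of_real (area a b c) * d = of_real (area b c d) * a + of_real (area a b d) * c"
  by (simp add: area_def complex_eq_iff algebra_simps)

lemma area_sum: "area a c d + area a b c = area b c d + area a b d"
  by (simp add: area_def algebra_simps)

text \<open>Dividing the affine dependency by the common total \<open>s\<close> of
  \<open>area_sum\<close> exhibits one point as a strict convex combination both of
  \<open>a\<close>, \<open>c\<close> and of \<open>b\<close>, \<open>d\<close>.\<close>

lemma open_segments_meet:
  assumes "area a b c > 0" "area a c d > 0" "area b c d > 0" "area a b d > 0"
  shows "\<not> disjnt (open_segment a c) (open_segment b d)"
proof -
  define s where "s = area a c d + area a b c"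
  have s: "s > 0" "s = area b c d + area a b d" using assms area_sum[of a c d b] by (simp_all add: s_def)
  have ne: "a \<noteq> c" "b \<noteq> d" using assms by auto
  define x where "x = (of_real (area a c d) * b + of_real (area a b c) * d) / of_real s"
  have eq: "of_real p * u / of_real s = (p / s) *\<^sub>R u" for p :: real and u :: complex
    by (simp add: scaleR_conv_of_real)
  have "1 - area a b c / s = area a c d / s" "1 - area a b d / s = area b c d / s"
    using s(1) by (simp add: s_def field_simps) (use s in \<open>simp add: field_simps\<close>)
  moreover have "x = (area a c d / s) *\<^sub>R b + (area a b c / s) *\<^sub>R d"
    unfolding x_def add_divide_distrib eq ..
  moreover have "x = (area b c d / s) *\<^sub>R a + (area a b d / s) *\<^sub>R c"
  proof -
    have "x = (of_real (area b c d) * a + of_real (area a b d) * c) / of_real s"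
      using area_four_points[of a c d b] by (simp add: x_def)
    then show ?thesis by (simp only: add_divide_distrib eq)
  qed
  moreover have "0 < area a b c / s" "area a b c / s < 1" "0 < area a b d / s" "area a b d / s < 1"
    using s assms by (simp_all add: s_def)
  ultimately have "x \<in> open_segment b d" "x \<in> open_segment a c"
    using ne unfolding in_segment by metis+
  then show ?thesis by (auto simp: disjnt_def)
qed

lemma point_reflection_segment:
  "point_reflection z ` closed_segment a b = closed_segment (point_reflection z a) (point_reflection z b)"
proof -
  have "point_reflection z ` closed_segment a b \<subseteq> closed_segment (point_reflection z a) (point_reflection z b)" for a b
  proof clarify
    fix x assume "x \<in> closed_segment a b"
    then obtain u where u: "0 \<le> u" "u \<le> 1" "x = (1 - u) *\<^sub>R a + u *\<^sub>R b" by (auto simp: in_segment)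
    have "point_reflection z x = (1 - u) *\<^sub>R point_reflection z a + u *\<^sub>R point_reflection z b"
      unfolding u(3) point_reflection_def by (simp add: algebra_simps)
    then show "point_reflection z x \<in> closed_segment (point_reflection z a) (point_reflection z b)"
      using u by (auto simp: in_segment)
  qed
  note sub = this
  have r: "point_reflection z (point_reflection z x) = x" for x by (simp add: point_reflection_def)
  have "point_reflection z ` point_reflection z ` A = A" for A by (simp add: image_image r)
  then have "closed_segment (point_reflection z a) (point_reflection z b) \<subseteq> point_reflection z ` closed_segment a b"
    using image_mono[OF sub[of "point_reflection z a" "point_reflection z b"], of "point_reflection z"]
    unfolding r by simp
  then show ?thesis using sub by blast
qed

section \<open>Cyclic indexing of vertices and segments\<close>

locale cs_polygon =
  fixes N :: nat and v :: "nat \<Rightarrow> complex" and ctr :: complex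
  assumes cs: "cs_convex_polygon (2 * N) v ctr"
begin

abbreviation "M \<equiv> 2 * N"

text \<open>Vertices are indexed by all natural numbers modulo \<open>M\<close>, so that a segment
  can be read from any starting index and the central reflection becomes addition of
  \<open>N\<close>.\<close>

definition V :: "nat \<Rightarrow> complex" where "V i = v (i mod M)"

definition S :: "nat \<Rightarrow> nat \<Rightarrow> complex set" where "S i j = closed_segment (V i) (V j)"

lemma N_ge: "2 \<le> N"
  using cs by (simp add: cs_convex_polygon_def convex_polygon_def)

lemma V_mod: "V (i mod M) = V i"
  by (simp add: V_def)

lemma V_add [simp]: "V (i + M) = V i" "V (M + i) = V i"
  by (simp_all add: V_def)

lemma vertices_V: "vertices M v = V ` {w..<w + M}"
proof -
  have "\<exists>j\<in>{w..<w + M}. j mod M = i" if "i < M" for i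
  proof -
    have "0 < M" using N_ge by simp
    define j where "j = w + (i + M - w mod M) mod M"
    have "w mod M \<le> i + M" using \<open>0 < M\<close> by (metis add.commute less_imp_le mod_less_divisor trans_le_add1)
    have "j mod M = (w mod M + (i + M - w mod M)) mod M" unfolding j_def by (metis mod_add_eq mod_mod_trivial)
    also have "\<dots> = i" using \<open>w mod M \<le> i + M\<close> that by simp
    finally show ?thesis using \<open>0 < M\<close> by (intro bexI[of _ j]) (auto simp: j_def)
  qed
  moreover have "j mod M < M" for j using N_ge by simp
  ultimately show ?thesis unfolding vertices_def V_def by (auto simp: image_iff)
qed

lemma vertexE:
  assumes "p \<in> vertices M v"
  obtains i where "w \<le> i" "i < w + M" "p = V i"
  using assms unfolding vertices_V[of w] by auto

lemma V_vertex: "V i \<in> vertices M v"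
  using N_ge by (auto simp: V_def vertices_def)

text \<open>After reduction of \<open>i\<close> modulo \<open>M\<close>, none, one or two of the
  other indices pass \<open>M\<close>; turning the triangle cyclically brings the reduced indices
  into increasing order.\<close>

lemma area_pos:
  assumes "i < j" "j < k" "k < i + M"
  shows "area (V i) (V j) (V k) > 0"
proof -
  have conv: "area (v a) (v b) (v c) > 0" if "a < b" "b < c" "c < M" for a b c
    using cs that by (simp add: cs_convex_polygon_def convex_polygon_def ccw_def area_def)
  define q where "q = i - i mod M"
  define a where "a = i mod M"
  have a: "a < M" "i = q + a" using N_ge by (simp_all add: q_def a_def)
  have q: "q mod M = 0" by (simp add: q_def)
  define b where "b = j - q"
  define c where "c = k - q"
  have bc: "j = q + b" "k = q + c" "a < b" "b < c" "c < a + M" using assms a by (auto simp: b_def c_def)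
  have V: "V (q + x) = v (if x < M then x else x - M)" if "x < M + M" for x
  proof -
    have "(q + x) mod M = x mod M" using q by (metis add_0 mod_add_left_eq)
    then show ?thesis using that by (auto simp: V_def mod_if)
  qed
  consider "c < M" | "b < M" "M \<le> c" | "M \<le> b" by linarith
  then show ?thesis
  proof cases
    case 1
    then show ?thesis using conv[of a b c] bc a by (simp add: V)
  next
    case 2
    then have "area (V k) (V i) (V j) > 0" using conv[of "c - M" a b] bc a by (simp add: V)
    then show ?thesis by (simp add: area_rotate)
  next
    case 3
    then have "area (V j) (V k) (V i) > 0" using conv[of "b - M" "c - M" a] bc a by (simp add: V)
    then show ?thesis by (simp add: area_rotate)
  qed
qed

lemma area_neg:
  assumes "i < k" "k < j" "j < i + M"
  shows "area (V i) (V j) (V k) < 0"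
  using area_pos[OF assms] area_swap[of "V i" "V j" "V k"] by simp

lemma V_neq:
  assumes "i < j" "j < i + M"
  shows "V i \<noteq> V j"
proof
  assume eq: "V i = V j"
  show False
  proof (cases "j + 1 < i + M")
    case True
    then show False using area_pos[of i j "j + 1"] assms eq by simp
  next
    case False
    then show False using area_neg[of i "i + 1" j] assms eq N_ge by simp
  qed
qed

lemma V_eq_iff: "V i = V j \<longleftrightarrow> i mod M = j mod M"
proof
  assume eq: "V i = V j"
  have "i mod M < M" "j mod M < M" using N_ge by simp_all
  then show "i mod M = j mod M"
    using V_neq[of "i mod M" "j mod M"] V_neq[of "j mod M" "i mod M"] eq V_mod
    by (metis nat_neq_iff trans_less_add2)
qed (simp add: V_def)

lemma S_commute: "S i j = S j i"
  by (simp add: S_def closed_segment_commute)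

lemma S_add [simp]: "S (i + M) j = S i j" "S i (j + M) = S i j" "S (M + i) j = S i j" "S i (M + j) = S i j"
  by (simp_all add: S_def)

lemma S_eq_iff: "S i j = S k l \<longleftrightarrow> {V i, V j} = {V k, V l}"
  by (simp add: S_def)

lemma S_window:
  assumes "V k \<noteq> V l"
  obtains a b where "w \<le> a" "a < b" "b < w + M" "S k l = S a b"
proof -
  obtain a where a: "w \<le> a" "a < w + M" "V k = V a" using vertexE[OF V_vertex] by metis
  obtain b where b: "w \<le> b" "b < w + M" "V l = V b" using vertexE[OF V_vertex] by metis
  have eq: "S k l = S a b" using a b by (simp add: S_def)
  show ?thesis
  proof (cases "a < b")
    case False
    then have "b < a" using a b assms by (metis linorder_neqE_nat)
    then show ?thesis using that[of b a] a b eq S_commute by metis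
  qed (use that a b eq in blast)
qed

lemma S_eq_window:
  assumes "S i j = S k l" "w \<le> i" "i < j" "j < w + M" "w \<le> k" "k < l" "l < w + M"
  shows "i = k \<and> j = l"
proof -
  have inj: "a = b" if "V a = V b" "w \<le> a" "a < w + M" "w \<le> b" "b < w + M" for a b
  proof (rule ccontr)
    assume "a \<noteq> b"
    then consider "a < b" | "b < a" by linarith
    then show False using V_neq[of a b] V_neq[of b a] that by cases auto
  qed
  have "V i = V k \<and> V j = V l \<or> V i = V l \<and> V j = V k"
    using assms(1) by (auto simp: S_eq_iff doubleton_eq_iff)
  then show ?thesis using inj[of i k] inj[of j l] inj[of i l] inj[of j k] assms by auto
qed

section \<open>Crossing segments and the recognition of diagonals\<close>

lemma noncrossing_S:
  assumes "V i \<noteq> V j" "V k \<noteq> V l"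
  shows "noncrossing (S i j) (S k l) \<longleftrightarrow> disjnt (open_segment (V i) (V j)) (open_segment (V k) (V l))"
  using assms by (simp add: noncrossing_def S_def rel_interior_closed_segment)

lemma crossing:
  assumes "i < j" "j < k" "k < l" "l < i + M"
  shows "\<not> noncrossing (S i k) (S j l)"
proof -
  have "\<not> disjnt (open_segment (V i) (V k)) (open_segment (V j) (V l))"
    using assms by (intro open_segments_meet area_pos) auto
  then show ?thesis using noncrossing_S[of i k j l] V_neq[of i k] V_neq[of j l] assms by simp
qed

text \<open>Both ends of \<open>S k l\<close> lie on one closed side of the line through
  \<open>V i\<close> and \<open>V j\<close>, and at least one of them strictly, so inner points of
  \<open>S k l\<close> miss that line.\<close>

lemma noncrossing_outer:
  assumes ij: "i < j" "j < i + M" and kl: "j \<le> k" "k < l" "l \<le> i + M" "(k, l) \<noteq> (j, i + M)"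
  shows "noncrossing (S i j) (S k l)"
proof -
  have pos: "area (V i) (V j) (V m) \<ge> 0 \<and> (m \<noteq> j \<and> m \<noteq> i + M \<longrightarrow> area (V i) (V j) (V m) > 0)"
    if "j \<le> m" "m \<le> i + M" for m
    using area_pos[of i j m] that ij by (cases "m = j \<or> m = i + M") auto
  have ne: "V i \<noteq> V j" "V k \<noteq> V l" using V_neq[of i j] V_neq[of k l] ij kl by auto
  have "x \<notin> open_segment (V k) (V l)" if x: "x \<in> open_segment (V i) (V j)" for x
  proof
    assume "x \<in> open_segment (V k) (V l)"
    then obtain u where u: "0 < u" "u < 1" "x = (1 - u) *\<^sub>R V k + u *\<^sub>R V l" by (auto simp: in_segment)
    have "area (V i) (V j) x = 0" using x open_closed_segment area_closed_segment by blast
    then have eq: "(1 - u) * area (V i) (V j) (V k) + u * area (V i) (V j) (V l) = 0"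
      unfolding u(3) area_affine .
    have k: "0 \<le> (1 - u) * area (V i) (V j) (V k)" and l: "0 \<le> u * area (V i) (V j) (V l)"
      using pos[of k] pos[of l] u kl by auto
    have "k \<noteq> j \<or> l \<noteq> i + M" using kl by auto
    then have "0 < (1 - u) * area (V i) (V j) (V k) \<or> 0 < u * area (V i) (V j) (V l)"
      using pos[of k] pos[of l] u kl by auto
    then show False using eq k l by linarith
  qed
  then show ?thesis using noncrossing_S[OF ne] by (auto simp: disjnt_def)
qed

text \<open>The outer case for the same chord read from \<open>j\<close> to
  \<open>i + M\<close>.\<close>

lemma noncrossing_inner:
  assumes ij: "i < j" "j < i + M" and kl: "i \<le> k" "k < l" "l \<le> j" "(k, l) \<noteq> (i, j)"
  shows "noncrossing (S i j) (S k l)"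
proof -
  have "noncrossing (S j (i + M)) (S (k + M) (l + M))"
    using assms by (intro noncrossing_outer) auto
  then show ?thesis by (simp add: S_commute)
qed

lemma noncrossing_commute: "noncrossing d e \<longleftrightarrow> noncrossing e d"
  by (auto simp: noncrossing_def disjnt_sym)

lemma side_in: "S i (Suc i) \<in> sides M v"
proof -
  have "i mod M < M" using N_ge by simp
  moreover have "S i (Suc i) = closed_segment (v (i mod M)) (v (Suc (i mod M) mod M))"
    by (simp add: S_def V_def mod_Suc_eq)
  ultimately show ?thesis unfolding sides_def by blast
qed

lemma sideE:
  assumes "d \<in> sides M v"
  obtains i where "d = S i (Suc i)" "i < M"
proof -
  obtain i where i: "i < M" "d = closed_segment (v i) (v (Suc i mod M))" using assms by (auto simp: sides_def)
  then have "d = S i (Suc i)" by (simp add: S_def V_def)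
  then show ?thesis using that i by blast
qed

lemma diagonal_iff:
  assumes "i < j" "j < i + M"
  shows "S i j \<in> diagonals M v \<longleftrightarrow> i + 2 \<le> j \<and> j + 2 \<le> i + M"
proof
  assume d: "S i j \<in> diagonals M v"
  then have "S i j \<notin> sides M v" by (simp add: diagonals_def)
  moreover have "S i j = S j (i + M)" by (simp add: S_commute)
  ultimately have "j \<noteq> Suc i" "i + M \<noteq> Suc j" using side_in[of i] side_in[of j] by metis+
  then show "i + 2 \<le> j \<and> j + 2 \<le> i + M" using assms by auto
next
  assume ij: "i + 2 \<le> j \<and> j + 2 \<le> i + M"
  have "S i j \<notin> sides M v"
  proof
    assume "S i j \<in> sides M v"
    then obtain k where k: "S i j = S k (Suc k)" by (auto elim: sideE)
    obtain k' where k': "i \<le> k'" "k' < i + M" "V k = V k'" using vertexE[OF V_vertex] by metis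
    have "V (Suc k) = V (Suc k')" using k'(3) by (metis V_eq_iff mod_Suc_eq)
    then have eq: "S i j = S k' (Suc k')" using k k' by (simp add: S_def)
    show False
    proof (cases "Suc k' < i + M")
      case True
      then show False using S_eq_window[OF eq, of i] k' ij assms by auto
    next
      case False
      then have "Suc k' = i + M" using k' by simp
      then have "S i j = S i k'" using eq S_commute[of k'] by simp
      then show False using S_eq_window[of i j i k' i] k' ij assms False by auto
    qed
  qed
  then show "S i j \<in> diagonals M v" unfolding diagonals_def
    using V_vertex V_neq[OF assms] S_def by auto
qed

lemma segmentE:
  assumes "d \<in> diagonals M v \<union> sides M v"
  obtains i j where "w \<le> i" "i < j" "j < w + M" "d = S i j"
proof -
  have "\<exists>k l. V k \<noteq> V l \<and> d = S k l"
  proof (cases "d \<in> sides M v")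
    case True
    then obtain i where "d = S i (Suc i)" by (auto elim: sideE)
    moreover have "V i \<noteq> V (Suc i)" using N_ge by (intro V_neq) auto
    ultimately show ?thesis by blast
  next
    case False
    then obtain a b where ab: "a \<in> vertices M v" "b \<in> vertices M v" "a \<noteq> b" "d = closed_segment a b"
      using assms by (auto simp: diagonals_def)
    obtain i j where "a = V i" "b = V j" using vertexE[OF ab(1)] vertexE[OF ab(2)] by metis
    then show ?thesis using ab S_def by blast
  qed
  then show ?thesis using S_window that by metis
qed

text \<open>The reflection preserves orientation, so it maps each vertex and its successor to a
  vertex and its successor and is a shift by some \<open>s\<close>. As an involution it makes
  \<open>s\<close> a multiple of \<open>N\<close>, and the multiple is odd because otherwise all
  vertices would be the center.\<close>

lemma reflection_V: "point_reflection ctr (V i) = V (i + N)"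
proof -
  let ?r = "point_reflection ctr"
  have rr: "?r (?r x) = x" for x by (simp add: point_reflection_def)
  have "?r (V i) \<in> vertices M v" for i
    using cs V_vertex unfolding cs_convex_polygon_def by blast
  then have "\<exists>j. ?r (V i) = V j" for i using vertexE by metis
  then obtain \<rho> where \<rho>: "\<And>i. ?r (V i) = V (\<rho> i)" by metis
  \<comment> \<open>If the image of a side were not a side, the vertex after \<open>\<rho> i\<close>
    would lie strictly to its right, whereas no vertex lies to the right of the side itself.\<close>
  have succ: "V (\<rho> (Suc i)) = V (Suc (\<rho> i))" for i
  proof (rule ccontr)
    assume ne: "V (\<rho> (Suc i)) \<noteq> V (Suc (\<rho> i))"
    obtain b where b: "\<rho> i \<le> b" "b < \<rho> i + M" "V (\<rho> (Suc i)) = V b" using vertexE[OF V_vertex] by metis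
    have "V b \<noteq> V (\<rho> i)" using b(3) \<rho> V_neq[of i "Suc i"] N_ge rr by (metis Suc_1 lessI less_add_same_cancel1 nat_add_left_cancel_less add.commute add_Suc_right mult_2 not_less_eq numeral_2_eq_2 order_less_le_trans plus_1_eq_Suc one_less_numeral_iff semiring_norm(76) trans_less_add1)
    then have "b \<noteq> \<rho> i" by auto
    moreover have "b \<noteq> Suc (\<rho> i)" using ne b by auto
    ultimately have neg: "area (V (\<rho> i)) (V b) (V (Suc (\<rho> i))) < 0" using b by (intro area_neg) auto
    obtain c where c: "i \<le> c" "c < i + M" "?r (V (Suc (\<rho> i))) = V c" using \<rho> vertexE[OF V_vertex] by metis
    have "area (V (\<rho> i)) (V b) (V (Suc (\<rho> i))) = area (V i) (V (Suc i)) (V c)"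
      using area_reflection[of ctr "V i" "V (Suc i)" "V c"] \<rho> b c rr by metis
    moreover have "area (V i) (V (Suc i)) (V c) \<ge> 0"
      using area_pos[of i "Suc i" c] c by (cases "c = i \<or> c = Suc i") (auto simp: less_imp_le)
    ultimately show False using neg by simp
  qed
  define s where "s = \<rho> 0"
  have shift: "V (\<rho> i) = V (i + s)" for i
  proof (induction i)
    case (Suc i)
    then have "V (Suc (\<rho> i)) = V (Suc (i + s))" by (metis V_eq_iff mod_Suc_eq)
    then show ?case using succ by simp
  qed (simp add: s_def)
  have "V 0 = V (0 + s + s)" using rr \<rho> shift by metis
  then have "(2 * s) mod (2 * N) = 0" unfolding V_eq_iff by (simp add: mult_2)
  then have "s mod N = 0" by (simp add: mult_mod_right[symmetric])
  then obtain k where k: "s = N * k" by auto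
  have "odd k"
  proof
    assume "even k"
    then obtain q where "k = 2 * q" by (rule evenE)
    then have "s = q * M" using k by simp
    then have "V (i + s) = V i" for i by (simp add: V_def)
    then have "?r (V i) = V i" for i using \<rho> shift by metis
    then have "V i = ctr" for i by (metis add_left_cancel mult_2 point_reflection_def diff_eq_eq mult_cancel_left zero_neq_numeral)
    then have "V 0 = V 1" by metis
    then show False using V_neq[of 0 1] N_ge by simp
  qed
  then obtain q where "k = 2 * q + 1" by (auto elim: oddE)
  then have "i + s = (i + N) + q * M" using k by (simp add: algebra_simps)
  then have "V (i + s) = V (i + N)" unfolding V_eq_iff by (simp only: mod_mult_self1)
  then show ?thesis using \<rho> shift by simp
qed

lemma opposite_S: "opposite ctr (S i j) = S (i + N) (j + N)"
  by (simp add: S_def point_reflection_segment reflection_V)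

text \<open>The center is the midpoint of \<open>V i\<close> and \<open>V (i + N)\<close>. If it
  lies on the line through \<open>V i\<close> and \<open>V j\<close>, so does
  \<open>V (i + N)\<close>, and no three vertices are collinear.\<close>

lemma central_iff:
  assumes "i < j" "j < i + M"
  shows "central ctr (S i j) \<longleftrightarrow> j = i + N"
proof -
  have mid: "ctr = (1 - 1/2) *\<^sub>R V k + (1/2) *\<^sub>R V (k + N)" for k
    unfolding reflection_V[symmetric] point_reflection_def
    by (simp add: scaleR_conv_of_real algebra_simps)
  show ?thesis
  proof
    assume "j = i + N"
    then show "central ctr (S i j)" unfolding central_def S_def in_segment
      using mid[of i] by (intro exI[of _ "1/2"]) auto
  next
    assume "central ctr (S i j)"
    then have "area (V i) (V j) ctr = 0" unfolding central_def S_def by (rule area_closed_segment)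
    then have 0: "area (V i) (V j) (V (i + N)) = 0"
      unfolding mid[of i] area_affine by simp
    show "j = i + N"
      using area_pos[of i j "i + N"] area_neg[of i "i + N" j] 0 assms N_ge
      by (metis add_less_cancel_left less_add_same_cancel1 less_irrefl linorder_neqE_nat mult_2 not_gr_zero not_numeral_le_zero nat_add_left_cancel_less le_zero_eq add_gr_0)
  qed
qed

section \<open>Triangles of a triangulation and its central diagonal\<close>

lemma triangulationD:
  assumes "triangulation M v t"
  shows "t \<subseteq> diagonals M v" "pairwise noncrossing t"
  using assms by (simp_all add: triangulation_def)

lemma side_noncrossing:
  assumes "e \<in> diagonals M v \<union> sides M v" "e \<noteq> S i (Suc i)"
  shows "noncrossing (S i (Suc i)) e"
proof -
  obtain a b where ab: "Suc i \<le> a" "a < b" "b < Suc i + M" "e = S a b"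
    using segmentE[OF assms(1)] by metis
  have "(a, b) \<noteq> (Suc i, i + M)" using assms(2) S_commute[of "Suc i" i] S_add(2) unfolding ab(4) by blast
  then show ?thesis using ab(1-3) N_ge noncrossing_outer[of i "Suc i" a b] unfolding ab(4) by simp
qed

lemma pairwise_noncrossing:
  assumes t: "triangulation M v t" and "e \<in> t \<union> sides M v" "f \<in> t \<union> sides M v" "e \<noteq> f"
  shows "noncrossing e f"
proof -
  have side: "noncrossing d f" if df: "d \<in> sides M v" "f \<in> t \<union> sides M v" "d \<noteq> f" for d f
  proof -
    obtain i where "d = S i (Suc i)" using sideE[OF df(1)] by metis
    then show ?thesis using side_noncrossing[of f i] df triangulationD[OF t] by auto
  qed
  consider "e \<in> sides M v" | "f \<in> sides M v" | "e \<in> t" "f \<in> t" using assms by blast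
  then show ?thesis
  proof cases
    case 1
    then show ?thesis using side[OF _ assms(3,4)] by simp
  next
    case 2
    then have "noncrossing f e" using side[OF _ assms(2)] assms(4) by simp
    then show ?thesis by (simp add: noncrossing_commute)
  next
    case 3
    then show ?thesis using triangulationD(2)[OF t] assms(4) unfolding pairwise_def by blast
  qed
qed

lemma no_crossing:
  assumes "triangulation M v t" "S i k \<in> t \<union> sides M v" "S j l \<in> t \<union> sides M v"
    and "i < j" "j < k" "k < l" "l < i + M"
  shows False
proof -
  have "S i k \<noteq> S j l" using S_eq_window[of i k j l i] assms by auto
  then show False using pairwise_noncrossing[OF assms(1-3)] crossing[OF assms(4-7)] by blast
qed

lemma triangulation_maximal:
  assumes t: "triangulation M v t" and d: "d \<in> diagonals M v" "\<And>e. e \<in> t \<Longrightarrow> e \<noteq> d \<Longrightarrow> noncrossing d e"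
  shows "d \<in> t"
proof -
  have "pairwise noncrossing (insert d t)"
    using triangulationD(2)[OF t] d(2) noncrossing_commute[of d] unfolding pairwise_insert by metis
  then have "insert d t = t"
    using t d(1) triangulationD(1)[OF t] unfolding triangulation_def by (metis insert_subset subset_insertI)
  then show ?thesis by blast
qed

text \<open>By maximality some edge of \<open>t\<close> crosses the absent diagonal; the two
  noncrossing lemmas exclude every position of its ends except one strictly on each side.\<close>

lemma crossing_edge:
  assumes t: "triangulation M v t" and d: "S i j \<in> diagonals M v" "S i j \<notin> t" and ij: "i < j" "j < i + M"
  obtains a b where "S a b \<in> t" "i < a" "a < j" "j < b" "b < i + M"
proof -
  obtain e where e: "e \<in> t" "\<not> noncrossing (S i j) e"
    using triangulation_maximal[OF t d(1)] d(2) by blast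
  then have "e \<in> diagonals M v \<union> sides M v" using triangulationD[OF t] by blast
  then obtain a b where ab: "i \<le> a" "a < b" "b < i + M" "e = S a b" by (rule segmentE[of e i])
  have ne: "(a, b) \<noteq> (i, j)" using e d ab by auto
  have "b > j"
    using noncrossing_inner[of i j a b] ij ab ne e by (meson not_less)
  moreover have "a < j"
  proof (rule ccontr)
    assume "\<not> a < j"
    then show False using noncrossing_outer[of i j a b] ij ab e by auto
  qed
  moreover have "a \<noteq> i"
  proof
    assume "a = i"
    then have "e = S b (i + M)" using ab S_commute by simp
    then show False using noncrossing_outer[of i j b "i + M"] ij ab e \<open>b > j\<close> by auto
  qed
  ultimately show ?thesis using that ab e by auto
qed

text \<open>Take the last \<open>k\<close> before \<open>j\<close> that is joined to
  \<open>i\<close>. An edge crossing a missing \<open>S k j\<close> would cross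
  \<open>S i j\<close>, cross \<open>S i k\<close>, or join \<open>i\<close> to a vertex beyond
  \<open>k\<close>.\<close>

lemma apex:
  assumes t: "triangulation M v t" and ij: "i + 2 \<le> j" "j < i + M" "S i j \<in> t \<union> sides M v"
  obtains k where "i < k" "k < j" "S i k \<in> t \<union> sides M v" "S k j \<in> t \<union> sides M v"
proof -
  let ?K = "{k. i < k \<and> k < j \<and> S i k \<in> t \<union> sides M v}"
  have fin: "finite ?K" by (rule finite_subset[of _ "{..<j}"]) auto
  have "Suc i \<in> ?K" using ij side_in by auto
  then have "Max ?K \<in> ?K" using fin Max_in by blast
  define k where "k = Max ?K"
  have k: "i < k" "k < j" "S i k \<in> t \<union> sides M v" using \<open>Max ?K \<in> ?K\<close> by (auto simp: k_def)
  have max: "l \<le> k" if "i < l" "l < j" "S i l \<in> t \<union> sides M v" for l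
    using Max_ge[OF fin, of l] that by (simp add: k_def)
  have "S k j \<in> t \<union> sides M v"
  proof (rule ccontr)
    assume n: "S k j \<notin> t \<union> sides M v"
    then have "j \<noteq> Suc k" using side_in by auto
    then have "S k j \<in> diagonals M v" using diagonal_iff[of k j] k ij by auto
    then obtain a b where ab: "S a b \<in> t" "k < a" "a < j" "j < b" "b < k + M"
      using crossing_edge[OF t, of k j] n k ij by auto
    show False
    proof (cases "b < i + M")
      case True
      then show False using no_crossing[OF t, of i j a b] ab ij k by auto
    next
      case False
      then have b: "S a b = S (b - M) a" using S_add(1)[of "b - M" a] S_commute by simp
      show False
      proof (cases "b = i + M")
        case True
        then have "S i a \<in> t \<union> sides M v" using b ab by simp
        then show False using max[of a] ab k by auto
      next
        case False
        then have "i < b - M" "b - M < k" using \<open>\<not> b < i + M\<close> ab by auto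
        then show False using no_crossing[OF t, of i k "b - M" a] ab b k ij by auto
      qed
    qed
  qed
  then show ?thesis using that k by blast
qed

lemma apex_unique:
  assumes t: "triangulation M v t"
    and k: "i < k" "k < j" "S i k \<in> t \<union> sides M v" "S k j \<in> t \<union> sides M v"
    and l: "i < l" "l < j" "S i l \<in> t \<union> sides M v" "S l j \<in> t \<union> sides M v"
    and "j < i + M"
  shows "k = l"
proof (rule ccontr)
  assume "k \<noteq> l"
  then consider "k < l" | "l < k" by linarith
  then show False
    using no_crossing[OF t, of i l k j] no_crossing[OF t, of i k l j] assms by cases auto
qed

lemma opposite_side: "d \<in> sides M v \<Longrightarrow> opposite ctr d \<in> sides M v"
  by (metis add_Suc opposite_S sideE side_in)

lemma opposite_edge:
  assumes "cs_triangulation M v ctr t" "S i j \<in> t \<union> sides M v"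
  shows "S (i + N) (j + N) \<in> t \<union> sides M v"
  using assms opposite_side unfolding cs_triangulation_def opposite_S[symmetric] by blast

lemma S_central_mod: "S i (i + N) = S (i mod N) (i mod N + N)"
proof -
  define q where "q = i div N"
  have i: "i = i mod N + q * N" by (simp add: q_def)
  show ?thesis
  proof (cases "even q")
    case True
    then obtain r where "q = 2 * r" by (rule evenE)
    then have "i = i mod N + r * M" using i by simp
    then have "V i = V (i mod N)" "V (i + N) = V (i mod N + N)"
      unfolding V_eq_iff by (metis mod_mult_self1, metis add.assoc add.commute mod_mult_self1)
    then show ?thesis by (simp add: S_def)
  next
    case False
    then obtain r where "q = 2 * r + 1" by (rule oddE)
    then have j: "i = (i mod N + N) + r * M" "i + N = i mod N + (r + 1) * M"
      using i by (simp_all add: algebra_simps)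
    have "V i = V (i mod N + N)" unfolding V_eq_iff by (subst j(1)) (simp only: mod_mult_self1)
    moreover have "V (i + N) = V (i mod N)" unfolding V_eq_iff by (subst j(2)) (simp only: mod_mult_self1)
    ultimately show ?thesis by (simp add: S_def closed_segment_commute)
  qed
qed

text \<open>Take an edge or side \<open>S i j\<close> of maximal length below \<open>N\<close> and
  the apex \<open>k\<close> of the triangle on its long side. If neither other side of the triangle
  is central, then one of them is longer than \<open>S i j\<close> but still shorter than
  \<open>N\<close>, or \<open>S j k\<close> crosses the reflection of \<open>S i j\<close>.\<close>

lemma central_exists:
  assumes cst: "cs_triangulation M v ctr t"
  shows "\<exists>p<N. S p (p + N) \<in> t"
proof -
  have t: "triangulation M v t" using cst by (simp add: cs_triangulation_def)
  have found: ?thesis if "S i (i + N) \<in> t \<union> sides M v" for i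
  proof -
    have "S i (i + N) \<in> diagonals M v" using N_ge by (subst diagonal_iff) auto
    then have "S (i mod N) (i mod N + N) \<in> t"
      using that unfolding S_central_mod[of i] by (simp add: diagonals_def)
    moreover have "i mod N < N" using N_ge by simp
    ultimately show ?thesis by blast
  qed
  define L where "L = {l. 0 < l \<and> l < N \<and> (\<exists>i. S i (i + l) \<in> t \<union> sides M v)}"
  have fin: "finite L" unfolding L_def by (rule finite_subset[of _ "{..<N}"]) auto
  have "1 \<in> L" using N_ge side_in[of 0] by (auto simp: L_def)
  then have "Max L \<in> L" using fin Max_in by blast
  then obtain i l where l: "l = Max L" "0 < l" "l < N" "S i (i + l) \<in> t \<union> sides M v"
    unfolding L_def by blast
  have max: "k \<le> l" if "0 < k" "k < N" "S a (a + k) \<in> t \<union> sides M v" for a k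
    using Max_ge[OF fin, of k] that l(1) unfolding L_def by blast
  define j where "j = i + l"
  have ij: "i < j" "j < i + N" "S i j \<in> t \<union> sides M v" using l by (auto simp: j_def)
  have "S j (i + M) \<in> t \<union> sides M v" using ij S_commute by simp
  moreover have "j + 2 \<le> i + M" "i + M < j + M" using ij N_ge by linarith+
  ultimately obtain k where k: "j < k" "k < i + M" "S j k \<in> t \<union> sides M v" "S k (i + M) \<in> t \<union> sides M v"
    using apex[OF t, of j "i + M"] by metis
  consider "k = j + N" | "k + N = i + M" | "k < j + N" "i + N < k" | "j + N < k" | "k < i + N"
    by linarith
  then show ?thesis
  proof cases
    case 1
    then show ?thesis using found k by blast
  next
    case 2
    have "S k (k + N) \<in> t \<union> sides M v" using k(4) by (simp only: 2)
    then show ?thesis by (rule found)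
  next
    case 3
    have "S (i + N) (j + N) \<in> t \<union> sides M v" using opposite_edge[OF cst ij(3)] .
    moreover have "k < i + N + M" "i + N < k" "k < j + N" "j < i + N" "j + N < j + M" using 3 ij k N_ge by linarith+
    ultimately show ?thesis using no_crossing[OF t k(3), of "i + N" "j + N"] by blast
  next
    case 4
    have "k + (j + M - k) = j + M" using k(2) ij(1) by linarith
    then have "S k (k + (j + M - k)) \<in> t \<union> sides M v" using k(3) by (simp only: S_add(2) S_commute[of k j])
    moreover have "0 < j + M - k" "j + M - k < N" using 4 k(2) ij(1) by linarith+
    ultimately have "j + M - k \<le> l" using max by blast
    then show ?thesis using k(2) j_def by linarith
  next
    case 5
    have "i + (k - i) = k" using k(1) ij(1) by linarith
    then have "S i (i + (k - i)) \<in> t \<union> sides M v" using k(4) by (simp only: S_add(2) S_commute[of i k])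
    moreover have "0 < k - i" "k - i < N" using 5 k(1) ij(1) by linarith+
    ultimately have "k - i \<le> l" using max by blast
    then show ?thesis using k(1) j_def ij(1) by linarith
  qed
qed

lemma central_unique:
  assumes t: "triangulation M v t" and d: "d \<in> t" "central ctr d" and e: "e \<in> t" "central ctr e"
  shows "d = e"
proof -
  have *: "\<exists>i<N. d = S i (i + N)" if "d \<in> t" "central ctr d" for d
  proof -
    have "d \<in> diagonals M v \<union> sides M v" using that triangulationD[OF t] by blast
    then obtain i j where ij: "0 \<le> i" "i < j" "j < 0 + M" "d = S i j" by (rule segmentE[of d 0])
    then have "j = i + N" using central_iff[of i j] that by auto
    then show ?thesis using ij by auto
  qed
  obtain i where i: "i < N" "d = S i (i + N)" using * d by blast
  obtain j where j: "j < N" "e = S j (j + N)" using * e by blast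
  have "i = j"
  proof (rule ccontr)
    assume "i \<noteq> j"
    then consider "i < j" | "j < i" by linarith
    then show False
      using no_crossing[OF t, of i "i + N" j "j + N"] no_crossing[OF t, of j "j + N" i "i + N"] i j d e
      by cases auto
  qed
  then show ?thesis using i j by simp
qed

section \<open>Uniqueness of flips\<close>

lemma other_diagonalI:
  assumes "S i k \<in> t" "i < j" "j < k" "k < l" "l < i + M"
    and "S i j \<in> t \<union> sides M v" "S j k \<in> t \<union> sides M v" "S k l \<in> t \<union> sides M v" "S l i \<in> t \<union> sides M v"
  shows "other_diagonal M v t (S i k) (S j l)"
  unfolding other_diagonal_def
proof (intro bexI conjI)
  show "S i k = closed_segment (V i) (V k)" "S j l = closed_segment (V j) (V l)" by (simp_all add: S_def)
  show "{closed_segment (V i) (V j), closed_segment (V j) (V k), closed_segment (V k) (V l), closed_segment (V l) (V i)}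
      \<subseteq> t \<union> sides M v" using assms(6-9) by (simp add: S_def)
qed (use assms crossing[of i j k l] V_vertex in simp_all)

text \<open>The four corners in \<open>other_diagonal\<close> are arbitrary vertices in an
  unspecified order. That the sides of the quadrilateral are edges rules out coincidences with
  \<open>i\<close> and \<open>j\<close>, and the crossing puts the other two corners on different
  sides.\<close>

lemma other_diagonalE:
  assumes t: "triangulation M v t" and od: "other_diagonal M v t (S i j) d'" and ij: "i < j" "j < i + M"
  obtains k l where "i < k" "k < j" "j < l" "l < i + M" "d' = S k l"
    "S i k \<in> t \<union> sides M v" "S k j \<in> t \<union> sides M v" "S j l \<in> t \<union> sides M v" "S l i \<in> t \<union> sides M v"
proof -
  have "\<exists>r\<in>vertices M v. \<exists>s\<in>vertices M v. d' = closed_segment r s \<and>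
      {closed_segment (V i) r, closed_segment r (V j), closed_segment (V j) s, closed_segment s (V i)} \<subseteq> t \<union> sides M v"
  proof -
    obtain p q r s where *: "S i j = closed_segment p q" "d' = closed_segment r s"
      "r \<in> vertices M v" "s \<in> vertices M v"
      "{closed_segment p r, closed_segment r q, closed_segment q s, closed_segment s p} \<subseteq> t \<union> sides M v"
      using od unfolding other_diagonal_def by (elim bexE conjE) (rule that; assumption)
    have "p = V i \<and> q = V j \<or> p = V j \<and> q = V i" using *(1) by (auto simp: S_def doubleton_eq_iff)
    then show ?thesis
    proof
      assume "p = V i \<and> q = V j"
      then show ?thesis using *(2-5) by blast
    next
      assume "p = V j \<and> q = V i"
      then show ?thesis using *(2-5)
        by (intro bexI[of _ s] bexI[of _ r]) (simp_all add: closed_segment_commute)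
    qed
  qed
  then obtain r s where rs: "r \<in> vertices M v" "s \<in> vertices M v" "d' = closed_segment r s"
    "{closed_segment (V i) r, closed_segment r (V j), closed_segment (V j) s, closed_segment s (V i)} \<subseteq> t \<union> sides M v"
    by blast
  have ncr: "\<not> noncrossing (S i j) d'" using od by (auto simp: other_diagonal_def)
  obtain k where k: "i \<le> k" "k < i + M" "r = V k" using vertexE[OF rs(1)] by metis
  obtain l where l: "i \<le> l" "l < i + M" "s = V l" using vertexE[OF rs(2)] by metis
  have edges: "S i k \<in> t \<union> sides M v" "S k j \<in> t \<union> sides M v" "S j l \<in> t \<union> sides M v" "S l i \<in> t \<union> sides M v"
    using rs(4) k l by (simp_all add: S_def)
  have degenerate: "V a \<noteq> V b" if ab: "S a b \<in> t \<union> sides M v" for a b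
  proof
    assume "V a = V b"
    have "S a b \<in> diagonals M v \<union> sides M v" using ab triangulationD(1)[OF t] by blast
    then obtain a' b' where "0 \<le> a'" "a' < b'" "b' < 0 + M" "S a b = S a' b'" by (rule segmentE[of _ 0])
    then show False using \<open>V a = V b\<close> V_neq[of a' b'] by (auto simp: S_eq_iff)
  qed
  have kl: "k \<noteq> i" "k \<noteq> j" "l \<noteq> i" "l \<noteq> j" using edges degenerate by metis+
  have "k \<noteq> l"
  proof
    assume "k = l"
    then have "d' = {V k}" using rs k l by simp
    then have "V k \<in> open_segment (V i) (V j)"
      using ncr V_neq[OF ij] by (simp add: noncrossing_def S_def rel_interior_closed_segment)
    then have "area (V i) (V j) (V k) = 0" using area_closed_segment open_closed_segment by blast
    then show False using area_pos[of i j k] area_neg[of i k j] k kl ij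
      by (metis le_neq_implies_less less_irrefl linorder_neqE_nat)
  qed
  have d': "d' = S k l" using rs k l by (simp add: S_def)
  have between: "a < j \<and> j < b" if "a < b" "{a, b} = {k, l}" for a b
  proof -
    have "S a b = d'" using that d' S_commute by (auto simp: doubleton_eq_iff)
    moreover have "i < a" "b < i + M" "a \<noteq> j" "b \<noteq> j" using that k l kl by (auto simp: doubleton_eq_iff)
    ultimately show ?thesis
      using noncrossing_inner[of i j a b] noncrossing_outer[of i j a b] ncr ij that(1) by force
  qed
  show ?thesis
  proof (cases "k < l")
    case True
    then have "k < j" "j < l" using between[of k l] by auto
    moreover have "i < k" using k kl by simp
    ultimately show ?thesis by (intro that[of k l]) (use edges l d' in auto)
  next
    case False
    then have "l < k" using \<open>k \<noteq> l\<close> by simp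
    then have "l < j" "j < k" using between[of l k] by auto
    moreover have "i < l" using l kl by simp
    ultimately show ?thesis by (intro that[of l k]) (use edges k d' S_commute in auto)
  qed
qed

lemma other_diagonal_in: "other_diagonal M v t d d' \<Longrightarrow> d \<in> t"
  by (auto simp: other_diagonal_def)

lemma other_diagonal_unique:
  assumes t: "triangulation M v t" and od: "other_diagonal M v t d d1" "other_diagonal M v t d d2"
  shows "d1 = d2"
proof -
  have "d \<in> diagonals M v \<union> sides M v" using other_diagonal_in[OF od(1)] triangulationD[OF t] by blast
  then obtain i j where ij: "0 \<le> i" "i < j" "j < 0 + M" "d = S i j" by (rule segmentE[of d 0])
  then have ij': "j < i + M" by simp
  obtain k l where kl: "i < k" "k < j" "j < l" "l < i + M" "d1 = S k l"
    "S i k \<in> t \<union> sides M v" "S k j \<in> t \<union> sides M v" "S j l \<in> t \<union> sides M v" "S l i \<in> t \<union> sides M v"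
    using other_diagonalE[OF t od(1)[unfolded ij(4)] ij(2) ij'] by metis
  obtain k' l' where kl': "i < k'" "k' < j" "j < l'" "l' < i + M" "d2 = S k' l'"
    "S i k' \<in> t \<union> sides M v" "S k' j \<in> t \<union> sides M v" "S j l' \<in> t \<union> sides M v" "S l' i \<in> t \<union> sides M v"
    using other_diagonalE[OF t od(2)[unfolded ij(4)] ij(2) ij'] by metis
  have "k = k'" using apex_unique[OF t] kl kl' ij' by blast
  moreover have "l = l'" using apex_unique[OF t, of j l "i + M" l'] kl kl' ij by simp
  ultimately show ?thesis using kl kl' by simp
qed

lemma other_diagonal_opposite:
  assumes cst: "cs_triangulation M v ctr t" and od: "other_diagonal M v t d d'"
  shows "other_diagonal M v t (opposite ctr d) (opposite ctr d')"
proof -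
  have t: "triangulation M v t" using cst by (simp add: cs_triangulation_def)
  have "d \<in> diagonals M v \<union> sides M v" using other_diagonal_in[OF od] triangulationD[OF t] by blast
  then obtain i j where ij: "0 \<le> i" "i < j" "j < 0 + M" "d = S i j" by (rule segmentE[of d 0])
  then have ij': "j < i + M" by simp
  obtain k l where kl: "i < k" "k < j" "j < l" "l < i + M" "d' = S k l"
    "S i k \<in> t \<union> sides M v" "S k j \<in> t \<union> sides M v" "S j l \<in> t \<union> sides M v" "S l i \<in> t \<union> sides M v"
    using other_diagonalE[OF t od[unfolded ij(4)] ij(2) ij'] by metis
  have "S (i + N) (j + N) \<in> t"
    using cst other_diagonal_in[OF od] ij opposite_S unfolding cs_triangulation_def by blast
  then have "other_diagonal M v t (S (i + N) (j + N)) (S (k + N) (l + N))"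
    using kl opposite_edge[OF cst] by (intro other_diagonalI) auto
  then show ?thesis using ij kl by (simp add: opposite_S)
qed

lemma opposite_opposite [simp]: "opposite ctr (opposite ctr d) = d"
  by (simp add: image_image point_reflection_def)

text \<open>The label determines the flipped diagonal up to reflection, and the apexes of its two
  triangles are unique. Starting from the reflected diagonal yields the same new pair.\<close>

lemma flip_unique:
  assumes cst: "cs_triangulation M v ctr t"
    and \<kappa>: "\<And>d e. d \<in> dom \<kappa> \<Longrightarrow> e \<in> dom \<kappa> \<Longrightarrow> \<kappa> d = \<kappa> e \<Longrightarrow> e = d \<or> e = opposite ctr d"
    and y: "flip M v ctr l (t, \<kappa>) y" "flip M v ctr l (t, \<kappa>) y'"
  shows "y = y'"
proof -
  have t: "triangulation M v t" using cst by (simp add: cs_triangulation_def)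
  show ?thesis
  proof (cases l)
    case None
    from y(1)[unfolded None] obtain d d1 where d: "central ctr d" "other_diagonal M v t d d1" "y = (insert d1 (t - {d}), \<kappa>)"
      by (cases rule: flip.cases) auto
    from y(2)[unfolded None] obtain e e1 where e: "central ctr e" "other_diagonal M v t e e1" "y' = (insert e1 (t - {e}), \<kappa>)"
      by (cases rule: flip.cases) auto
    have "d = e" using central_unique[OF t] d e other_diagonal_in by blast
    moreover from this have "d1 = e1" using other_diagonal_unique[OF t] d e by blast
    ultimately show ?thesis using d e by simp
  next
    case (Some a)
    define Y where "Y d d' = ((t - {d, opposite ctr d}) \<union> {d', opposite ctr d'},
            \<kappa>(d := None, opposite ctr d := None, d' \<mapsto> a, opposite ctr d' \<mapsto> a))" for d d'
    from y(1)[unfolded Some] obtain d d1 where d: "\<kappa> d = Some a" "other_diagonal M v t d d1" "y = Y d d1"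
      by (cases rule: flip.cases) (auto simp: Y_def)
    from y(2)[unfolded Some] obtain e e1 where e: "\<kappa> e = Some a" "other_diagonal M v t e e1" "y' = Y e e1"
      by (cases rule: flip.cases) (auto simp: Y_def)
    have sym: "Y (opposite ctr d) (opposite ctr d') = Y d d'" for d d'
      by (auto simp: Y_def fun_eq_iff)
    have "e = d \<or> e = opposite ctr d" using \<kappa>[of d e] d e by auto
    then show ?thesis
    proof
      assume "e = d"
      then show ?thesis using other_diagonal_unique[OF t] d e by metis
    next
      assume "e = opposite ctr d"
      then have "e1 = opposite ctr d1"
        using other_diagonal_unique[OF t e(2)] other_diagonal_opposite[OF cst d(2)] by metis
      then show ?thesis using \<open>e = opposite ctr d\<close> sym d e by metis
    qed
  qed
qed

end

section \<open>From trees to triangulations\<close>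

text \<open>The leaves are read as the consecutive sides that start at vertex \<open>i\<close>; a
  node is the chord over its leaves, kept with its label.\<close>

fun ents :: "nat \<Rightarrow> 'a tree \<Rightarrow> (nat \<times> nat \<times> 'a) set" where
  "ents i Leaf = {}"
| "ents i (Node l x r) = insert (i, i + size1 l + size1 r, x) (ents i l \<union> ents (i + size1 l) r)"

lemma ents_bounds: "(k, l, c) \<in> ents i t \<Longrightarrow> i \<le> k \<and> k + 2 \<le> l \<and> l \<le> i + size1 t \<and> c \<in> set_tree t"
proof (induction t arbitrary: i)
  case (Node u x w)
  have "2 \<le> size1 u + size1 w" by (simp add: size1_size)
  then show ?case using Node.prems Node.IH(1)[of i] Node.IH(2)[of "i + size1 u"] by auto
qed simp

lemma size1_neq_0 [simp]: "size1 t \<noteq> 0"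
  by (simp add: size1_size)

lemma ents_proper:
  assumes "(k, l, c) \<in> ents i u \<union> ents (i + size1 u) w"
  shows "\<not> (k = i \<and> l = i + size1 u + size1 w)"
proof -
  show ?thesis using assms ents_bounds[of k l c i u] ents_bounds[of k l c "i + size1 u" w] by auto
qed

lemma ents_root: "rlab t = Some x \<Longrightarrow> (i, i + size1 t, x) \<in> ents i t"
  by (auto simp: rlab_Some add.assoc)

lemma ents_labels: "c \<in> set_tree t \<Longrightarrow> \<exists>k l. (k, l, c) \<in> ents i t"
proof (induction t arbitrary: i)
  case (Node u x w)
  then show ?case using Node.IH(1)[of i] Node.IH(2)[of "i + size1 u"] by fastforce
qed simp

lemma ents_functional: "(k, l, c) \<in> ents i t \<Longrightarrow> (k, l, d) \<in> ents i t \<Longrightarrow> c = d"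
proof (induction t arbitrary: i)
  case (Node u x w)
  have "\<not> ((k, l, a) \<in> ents i u \<and> (k, l, b) \<in> ents (i + size1 u) w)" for a b
  proof
    assume "(k, l, a) \<in> ents i u \<and> (k, l, b) \<in> ents (i + size1 u) w"
    then have *: "(k, l, a) \<in> ents i u" "(k, l, b) \<in> ents (i + size1 u) w" by auto
    show False using ents_bounds[OF *(1)] ents_bounds[OF *(2)] by simp
  qed
  moreover have "\<not> (k = i \<and> l = i + size1 u + size1 w \<and> (k, l, a) \<in> ents i u \<union> ents (i + size1 u) w)" for a
    using ents_proper[of k l a i u w] by blast
  ultimately show ?case using Node.prems Node.IH(1)[of i] Node.IH(2)[of "i + size1 u"]
    unfolding ents.simps insert_iff Un_iff prod.inject by metis
qed simp

lemma ents_label_unique: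
  "distinct (inorder t) \<Longrightarrow> (k, l, c) \<in> ents i t \<Longrightarrow> (k', l', c) \<in> ents i t \<Longrightarrow> k = k' \<and> l = l'"
proof (induction t arbitrary: i)
  case (Node u x w)
  have "(k, l, c) \<in> ents i u \<longrightarrow> c \<in> set_tree u" "(k', l', c) \<in> ents i u \<longrightarrow> c \<in> set_tree u"
    "(k, l, c) \<in> ents (i + size1 u) w \<longrightarrow> c \<in> set_tree w" "(k', l', c) \<in> ents (i + size1 u) w \<longrightarrow> c \<in> set_tree w"
    using ents_bounds by metis+
  moreover have "x \<notin> set_tree u" "x \<notin> set_tree w" "set_tree u \<inter> set_tree w = {}"
    "distinct (inorder u)" "distinct (inorder w)"
    using Node.prems(1) by auto
  ultimately show ?case using Node.prems(2,3) Node.IH(1)[of i] Node.IH(2)[of "i + size1 u"]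
    unfolding ents.simps insert_iff Un_iff prod.inject by blast
qed simp

text \<open>Needed to pass from a coloring back to a tree: labels that determine their chord cannot
  repeat.\<close>

lemma ents_distinct: "inj_on (\<lambda>e. snd (snd e)) (ents i t) \<Longrightarrow> distinct (inorder t)"
proof (induction t arbitrary: i)
  case (Node u x w)
  have sub: "ents i u \<subseteq> ents i (Node u x w)" "ents (i + size1 u) w \<subseteq> ents i (Node u x w)" by auto
  have d: "distinct (inorder u)" "distinct (inorder w)"
    using Node.IH Node.prems sub inj_on_subset by blast+
  have inj: "(k, l) = (k', l')" if "(k, l, c) \<in> ents i (Node u x w)" "(k', l', c) \<in> ents i (Node u x w)" for k l k' l' c
    using inj_onD[OF Node.prems _ that] by simp
  have x: "x \<notin> set_tree u \<union> set_tree w"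
  proof
    assume "x \<in> set_tree u \<union> set_tree w"
    then obtain k l where kl: "(k, l, x) \<in> ents i u \<union> ents (i + size1 u) w"
      using ents_labels[of x u i] ents_labels[of x w "i + size1 u"] by blast
    then have "(k, l) = (i, i + size1 u + size1 w)" by (intro inj[of _ _ x]) auto
    then show False using ents_proper[OF kl] by simp
  qed
  moreover have "c \<notin> set_tree w" if c: "c \<in> set_tree u" for c
  proof
    assume "c \<in> set_tree w"
    then obtain k l k' l' where *: "(k, l, c) \<in> ents i u" "(k', l', c) \<in> ents (i + size1 u) w"
      using ents_labels[of c u i] ents_labels[of c w "i + size1 u"] c by metis
    have "(k, l) = (k', l')" using * by (intro inj[of _ _ c]) auto
    then show False using ents_bounds[OF *(1)] ents_bounds[OF *(2)] by simp
  qed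
  ultimately show ?case using d by auto
qed simp

lemma ents_laminar:
  "(k, l, c) \<in> ents i t \<Longrightarrow> (k', l', c') \<in> ents i t \<Longrightarrow> l \<le> k' \<or> l' \<le> k \<or> k \<le> k' \<and> l' \<le> l \<or> k' \<le> k \<and> l \<le> l'"
proof (induction t arbitrary: i)
  case (Node u x w)
  have b: "i \<le> a \<and> b \<le> i + size1 u + size1 w" if "(a, b, d) \<in> ents i (Node u x w)" for a b d
    using ents_bounds[OF that] by auto
  consider "(k, l) = (i, i + size1 u + size1 w)" | "(k', l') = (i, i + size1 u + size1 w)"
    | "(k, l, c) \<in> ents i u" "(k', l', c') \<in> ents i u"
    | "(k, l, c) \<in> ents (i + size1 u) w" "(k', l', c') \<in> ents (i + size1 u) w"
    | "(k, l, c) \<in> ents i u" "(k', l', c') \<in> ents (i + size1 u) w"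
    | "(k, l, c) \<in> ents (i + size1 u) w" "(k', l', c') \<in> ents i u"
    using Node.prems by auto
  then show ?case
  proof cases
    case 1
    then show ?thesis using b[OF Node.prems(2)] by auto
  next
    case 2
    then show ?thesis using b[OF Node.prems(1)] by auto
  next
    case 3
    then show ?thesis using Node.IH(1)[of i] by blast
  next
    case 4
    then show ?thesis using Node.IH(2)[of "i + size1 u"] by blast
  next
    case 5
    then show ?thesis using ents_bounds[OF 5(1)] ents_bounds[OF 5(2)] by simp
  next
    case 6
    then show ?thesis using ents_bounds[OF 6(1)] ents_bounds[OF 6(2)] by simp
  qed
qed simp

lemma size1_ge2: "2 \<le> size1 t \<Longrightarrow> \<exists>x. rlab t = Some x"
  by (cases t) auto

text \<open>Combinatorial maximality. An absent chord that straddles the split point of a node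
  crosses the chord of the left child if it starts inside, and otherwise that of the right child; a
  chord on one side is left to the induction.\<close>

lemma ents_crossing:
  "i \<le> a \<Longrightarrow> a + 2 \<le> b \<Longrightarrow> b \<le> i + size1 t \<Longrightarrow> (\<And>c. (a, b, c) \<notin> ents i t) \<Longrightarrow>
    \<exists>k l c. (k, l, c) \<in> ents i t \<and> (k < a \<and> a < l \<and> l < b \<or> a < k \<and> k < b \<and> b < l)"
proof (induction t arbitrary: i)
  case (Node u x w)
  let ?m = "i + size1 u"
  consider "b \<le> ?m" | "?m \<le> a" | "a < ?m" "?m < b" by linarith
  then show ?case
  proof cases
    case 1
    then obtain k l c where "(k, l, c) \<in> ents i u" "k < a \<and> a < l \<and> l < b \<or> a < k \<and> k < b \<and> b < l"
      using Node.IH(1)[of i] Node.prems by auto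
    then show ?thesis by auto
  next
    case 2
    then obtain k l c where "(k, l, c) \<in> ents ?m w" "k < a \<and> a < l \<and> l < b \<or> a < k \<and> k < b \<and> b < l"
      using Node.IH(2)[of ?m] Node.prems by auto
    then show ?thesis by auto
  next
    case 3
    have "(a, b) \<noteq> (i, ?m + size1 w)" using Node.prems(4)[of x] by auto
    then consider "i < a" | "b < ?m + size1 w" using Node.prems by fastforce
    then show ?thesis
    proof cases
      case 1
      then have "2 \<le> size1 u" using 3 by simp
      then obtain y where "(i, ?m, y) \<in> ents i u" using size1_ge2 ents_root by metis
      then show ?thesis using 1 3 by (intro exI[of _ i] exI[of _ ?m] exI[of _ y]) auto
    next
      case 2
      then have "2 \<le> size1 w" using 3 by simp
      then obtain y where "(?m, ?m + size1 w, y) \<in> ents ?m w" using size1_ge2 ents_root by metis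
      then show ?thesis using 2 3 by (intro exI[of _ ?m] exI[of _ "?m + size1 w"] exI[of _ y]) auto
    qed
  qed
qed simp

text \<open>If the split points of the two roots differed, the chord of the larger child on one side
  would fit below neither child of the other tree. With equal splits the inclusion descends to the
  subtrees.\<close>

lemma ents_subset_eq: "size1 t = size1 t' \<Longrightarrow> ents i t \<subseteq> ents i t' \<Longrightarrow> t = t'"
proof (induction t arbitrary: i t')
  case Leaf
  then show ?case by (cases t') (auto simp: size1_size)
next
  case (Node u x w)
  obtain u' x' w' where t': "t' = Node u' x' w'" using Node.prems(1) by (cases t') (auto simp: size1_size)
  have size: "size1 u + size1 w = size1 u' + size1 w'" using Node.prems t' by simp
  have pos: "0 < size1 u" "0 < size1 w" "0 < size1 u'" "0 < size1 w'" by (simp_all add: size1_size)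
  have sub: "e \<in> ents i (Node u' x' w')" if "e \<in> ents i (Node u x w)" for e
    using Node.prems(2) t' that by blast
  have x: "x = x'"
    using sub[of "(i, i + size1 u + size1 w, x)"] ents_proper[of i "i + size1 u + size1 w" x i u' w'] size by auto
  have "\<not> size1 u < size1 u'"
  proof
    assume less: "size1 u < size1 u'"
    then have "2 \<le> size1 w" using size pos by linarith
    then obtain y where "(i + size1 u, i + size1 u + size1 w, y) \<in> ents (i + size1 u) w" using size1_ge2 ents_root by metis
    then have "(i + size1 u, i + size1 u + size1 w, y) \<in> ents i (Node u' x' w')" by (intro sub) simp
    then show False
      using ents_bounds[of "i + size1 u" "i + size1 u + size1 w" y i u']
        ents_bounds[of "i + size1 u" "i + size1 u + size1 w" y "i + size1 u'" w'] less size pos by auto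
  qed
  moreover have "\<not> size1 u' < size1 u"
  proof
    assume less: "size1 u' < size1 u"
    then have "2 \<le> size1 u" using pos by linarith
    then obtain y where "(i, i + size1 u, y) \<in> ents i u" using size1_ge2 ents_root by metis
    then have "(i, i + size1 u, y) \<in> ents i (Node u' x' w')" by (intro sub) simp
    then show False
      using ents_bounds[of "i" "i + size1 u" y i u']
        ents_bounds[of "i" "i + size1 u" y "i + size1 u'" w'] less size pos by auto
  qed
  ultimately have eq: "size1 u = size1 u'" "size1 w = size1 w'" using size by auto
  have "(k, l, c) \<in> ents i u'" if e: "(k, l, c) \<in> ents i u" for k l c
  proof -
    note b = ents_bounds[OF e]
    have "(k, l, c) \<notin> ents (i + size1 u') w'"
    proof
      assume f: "(k, l, c) \<in> ents (i + size1 u') w'"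
      show False using ents_bounds[OF f] b eq by simp
    qed
    moreover have "\<not> (k = i \<and> l = i + size1 u' + size1 w')" using b eq pos by auto
    moreover have "(k, l, c) \<in> ents i (Node u' x' w')" using e by (intro sub) simp
    ultimately show ?thesis by auto
  qed
  moreover have "(k, l, c) \<in> ents (i + size1 u) w'" if e: "(k, l, c) \<in> ents (i + size1 u) w" for k l c
  proof -
    note b = ents_bounds[OF e]
    have "(k, l, c) \<notin> ents i u'"
    proof
      assume f: "(k, l, c) \<in> ents i u'"
      show False using ents_bounds[OF f] b eq by simp
    qed
    moreover have "\<not> (k = i \<and> l = i + size1 u' + size1 w')" using b eq pos by auto
    moreover have "(k, l, c) \<in> ents i (Node u' x' w')" using e by (intro sub) simp
    ultimately show ?thesis using eq by auto
  qed
  ultimately have "ents i u \<subseteq> ents i u'" "ents (i + size1 u) w \<subseteq> ents (i + size1 u) w'" by auto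
  then have "u = u'" "w = w'" using Node.IH eq by blast+
  then show ?case using t' x by simp
qed

section \<open>The edges of a tree in the polygon and their reflections\<close>

context cs_polygon
begin

text \<open>A segment with its central reflection; the two coincide when
  \<open>l = k + N\<close>.\<close>

definition seg_orbit :: "nat \<Rightarrow> nat \<Rightarrow> complex set set" where
  "seg_orbit k l = {S k l, S (k + N) (l + N)}"

lemma S_add_N2 [simp]: "S (k + N + N) (l + N + N) = S k l"
proof -
  have "k + N + N = k + M" "l + N + N = l + M" by simp_all
  then show ?thesis by (simp only: S_add)
qed

lemma opposite_seg_orbit: "e \<in> seg_orbit k l \<Longrightarrow> opposite ctr e \<in> seg_orbit k l"
  unfolding seg_orbit_def by (elim insertE emptyE; simp add: opposite_S)

lemma orbit_shift: "seg_orbit (k + N) (l + N) = seg_orbit k l"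
  by (auto simp: seg_orbit_def)

text \<open>The half polygon is a fundamental domain of the reflection: a reflected pair has only
  one chord with both ends between \<open>p\<close> and \<open>p + N\<close>.\<close>

lemma orbit_eqD:
  assumes k: "p \<le> k" "k < l" "l \<le> p + N" and k': "p \<le> k'" "k' < l'" "l' \<le> p + N"
    and e: "e \<in> seg_orbit k l" "e \<in> seg_orbit k' l'"
  shows "k = k' \<and> l = l'"
proof -
  have same: "k = k' \<and> l = l'"
    if "p \<le> k" "k < l" "l \<le> p + N" "p \<le> k'" "k' < l'" "l' \<le> p + N" "S k l = S k' l'" for k l k' l'
    using S_eq_window[of k l k' l' p] that N_ge by simp
  have cross: "k = k' \<and> l = l'"
    if a: "p \<le> k" "k < l" "l \<le> p + N" and b: "p \<le> k'" "k' < l'" "l' \<le> p + N"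
      and eq: "S k l = S (k' + N) (l' + N)" for k l k' l'
  \<comment> \<open>Here the end of the reflected chord wraps around to \<open>p\<close>, and only
    the central chord is its own reflection within the half.\<close>
  proof (cases "l' = p + N")
    case True
    then have "l' + N = p + M" by simp
    then have "S k l = S p (k' + N)" using eq S_commute by (metis S_add(2))
    moreover have "p < k' + N" "k' + N < p + M" "l < p + M" using a b True N_ge by linarith+
    ultimately have "k = p" "l = k' + N" using S_eq_window[of k l p "k' + N" p] a b by auto
    then show ?thesis using a b True by simp
  next
    case False
    then have "l' + N < p + M" "k' + N < l' + N" "p \<le> k' + N" "l < p + M" using a b N_ge by linarith+
    then have "k = k' + N" using S_eq_window[OF eq, of p] a b by blast
    then show ?thesis using a b by simp
  qed
  from e consider "S k l = S k' l'" | "S k l = S (k' + N) (l' + N)" | "S (k + N) (l + N) = S k' l'"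
    | "S (k + N) (l + N) = S (k' + N) (l' + N)" unfolding seg_orbit_def by auto
  then show ?thesis
  proof cases
    case 3
    then show ?thesis using cross[OF k' k] by simp
  next
    case 4
    then have "S k l = S k' l'" by (metis opposite_S opposite_opposite)
    then show ?thesis by (rule same[OF k k'])
  qed (use same[OF k k'] cross[OF k k'] in blast)+
qed

definition colored_edges :: "nat \<Rightarrow> 'a tree \<Rightarrow> (complex set \<times> 'a) set" where
  "colored_edges i t = {(e, c). \<exists>k l. (k, l, c) \<in> ents i t \<and> e \<in> seg_orbit k l}"

abbreviation "G \<equiv> colored_edges"

lemma G_Leaf [simp]: "G i Leaf = {}"
  by (simp add: colored_edges_def)

lemma G_Node: "G i (Node u x w) = seg_orbit i (i + size1 u + size1 w) \<times> {x} \<union> G i u \<union> G (i + size1 u) w"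
  by (auto simp: colored_edges_def)

text \<open>Moving the start by \<open>N\<close> is the central reflection, under which each orbit
  is invariant.\<close>

lemma G_shift: "G (i + N) t = G i t"
proof (induction t arbitrary: i)
  case (Node u x w)
  have "i + N + size1 u = i + size1 u + N" "i + N + size1 u + size1 w = i + size1 u + size1 w + N" by simp_all
  then show ?case unfolding G_Node by (simp only: orbit_shift Node.IH)
qed simp

lemma G_mod: "G (i mod N) t = G i t"
proof -
  have "G (j + q * N) t = G j t" for j q
  proof (induction q)
    case (Suc q)
    have "j + Suc q * N = j + q * N + N" by simp
    then show ?case by (simp only: Suc G_shift)
  qed simp
  then show ?thesis by (metis mod_div_mult_eq)
qed

lemma G_labels: "(e, c) \<in> G i t \<Longrightarrow> c \<in> set_tree t"
  using ents_bounds by (fastforce simp: colored_edges_def)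

lemma G_opposite: "(e, c) \<in> G i t \<Longrightarrow> (opposite ctr e, c) \<in> G i t"
  unfolding colored_edges_def using opposite_seg_orbit by blast

lemma G_I: "(k, l, c) \<in> ents i t \<Longrightarrow> (S k l, c) \<in> G i t" "(k, l, c) \<in> ents i t \<Longrightarrow> (S (k + N) (l + N), c) \<in> G i t"
  by (auto simp: colored_edges_def seg_orbit_def)

lemma G_E:
  assumes "(e, c) \<in> G i t" "size1 t \<le> N"
  obtains k l where "(k, l, c) \<in> ents i t" "e \<in> seg_orbit k l" "i \<le> k" "k < l" "l \<le> i + N"
proof -
  obtain k l where kl: "(k, l, c) \<in> ents i t" "e \<in> seg_orbit k l" using assms by (auto simp: colored_edges_def)
  then show ?thesis using ents_bounds[OF kl(1)] assms(2) by (intro that) auto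
qed

lemma G_ents_iff:
  assumes "size1 t \<le> N" "i \<le> k" "k < l" "l \<le> i + N"
  shows "(S k l, c) \<in> G i t \<longleftrightarrow> (k, l, c) \<in> ents i t"
proof
  assume "(S k l, c) \<in> G i t"
  then obtain k' l' where *: "(k', l', c) \<in> ents i t" "S k l \<in> seg_orbit k' l'" "i \<le> k'" "k' < l'" "l' \<le> i + N"
    using assms(1) by (rule G_E)
  moreover have "S k l \<in> seg_orbit k l" by (simp add: seg_orbit_def)
  ultimately have "k = k' \<and> l = l'" using orbit_eqD assms by blast
  then show "(k, l, c) \<in> ents i t" using * by simp
qed (rule G_I)

lemma G_functional:
  assumes "(e, c) \<in> G i t" "(e, d) \<in> G i t" "size1 t \<le> N"
  shows "c = d"
proof -
  obtain k l where k: "(k, l, c) \<in> ents i t" "e \<in> seg_orbit k l" "i \<le> k" "k < l" "l \<le> i + N"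
    using assms(1,3) by (rule G_E)
  obtain k' l' where k': "(k', l', d) \<in> ents i t" "e \<in> seg_orbit k' l'" "i \<le> k'" "k' < l'" "l' \<le> i + N"
    using assms(2,3) by (rule G_E)
  have "k = k' \<and> l = l'" using orbit_eqD k k' by blast
  then show ?thesis using k k' ents_functional by metis
qed

lemma G_same_label:
  assumes "(e, c) \<in> G i t" "(f, c) \<in> G i t" "distinct (inorder t)"
  shows "f = e \<or> f = opposite ctr e"
proof -
  obtain k l where k: "(k, l, c) \<in> ents i t" "e \<in> seg_orbit k l" using assms(1) by (auto simp: colored_edges_def)
  obtain k' l' where k': "(k', l', c) \<in> ents i t" "f \<in> seg_orbit k' l'" using assms(2) by (auto simp: colored_edges_def)
  have "f \<in> seg_orbit k l" using k' ents_label_unique[OF assms(3) k(1) k'(1)] by simp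
  then show ?thesis using k(2) unfolding seg_orbit_def
    by (elim insertE emptyE; simp add: opposite_S)
qed

lemma central_orbit:
  assumes "k < l" "l < k + M" "e \<in> seg_orbit k l"
  shows "central ctr e \<longleftrightarrow> l = k + N"
  using assms central_iff[of k l] central_iff[of "k + N" "l + N"] by (auto simp: seg_orbit_def)

text \<open>Central means of length \<open>N\<close>, and only the chord of the root spans the whole
  half polygon.\<close>

lemma G_central:
  assumes "(e, c) \<in> G i t" "size1 t = N" "distinct (inorder t)"
  shows "central ctr e \<longleftrightarrow> rlab t = Some c"
proof -
  obtain k l where k: "(k, l, c) \<in> ents i t" "e \<in> seg_orbit k l" "i \<le> k" "k < l" "l \<le> i + N"
    using assms(1) order.eq_iff[THEN iffD1, OF assms(2), THEN conjunct1] by (rule G_E)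
  have c: "central ctr e \<longleftrightarrow> l = k + N" using k N_ge by (intro central_orbit) auto
  obtain x where x: "rlab t = Some x" using size1_ge2[of t] assms N_ge by auto
  have r: "(i, i + N, x) \<in> ents i t" using ents_root[OF x, of i] assms(2) by simp
  show ?thesis
  proof
    assume "central ctr e"
    then have "k = i" "l = i + N" using c k by auto
    then show "rlab t = Some c" using ents_functional k(1) r x by metis
  next
    assume "rlab t = Some c"
    then have "i = k \<and> i + N = l" using ents_label_unique[OF assms(3) _ k(1)] r x by simp
    then show "central ctr e" using c by simp
  qed
qed

lemma laminar_noncrossing:
  assumes "p \<le> k" "k < l" "l \<le> p + N" "p \<le> k'" "k' < l'" "l' \<le> p + N"
    and "l \<le> k' \<or> l' \<le> k \<or> k \<le> k' \<and> l' \<le> l \<or> k' \<le> k \<and> l \<le> l'" "(k, l) \<noteq> (k', l')"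
  shows "noncrossing (S k l) (S k' l')"
proof -
  have b: "l < k + M" "l' < k' + M" "l < k' + M" "l' < k + M" using assms(1-6) N_ge by linarith+
  from assms(7) consider "l \<le> k'" | "l' \<le> k" | "k \<le> k'" "l' \<le> l" | "k' \<le> k" "l \<le> l'" by blast
  then show ?thesis
  proof cases
    case 1
    then show ?thesis using assms b by (intro noncrossing_outer) auto
  next
    case 2
    then have "noncrossing (S k' l') (S k l)" using assms b by (intro noncrossing_outer) auto
    then show ?thesis by (simp add: noncrossing_commute)
  next
    case 3
    then show ?thesis using assms b by (intro noncrossing_inner) auto
  next
    case 4
    then have "noncrossing (S k' l') (S k l)" using assms b by (intro noncrossing_inner) auto
    then show ?thesis by (simp add: noncrossing_commute)
  qed
qed

text \<open>The reflected chord has its ends between \<open>p + N\<close> and \<open>p + M\<close>,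
  on the far side of the first one.\<close>

lemma halves_noncrossing:
  assumes "p \<le> k" "k < l" "l \<le> p + N" "p \<le> k'" "k' < l'" "l' \<le> p + N" "S k l \<noteq> S (k' + N) (l' + N)"
  shows "noncrossing (S k l) (S (k' + N) (l' + N))"
proof (rule noncrossing_outer)
  show "(k' + N, l' + N) \<noteq> (l, k + M)"
  proof
    assume "(k' + N, l' + N) = (l, k + M)"
    then have "k' + N = l" "l' + N = k + M" by auto
    then have "S (k' + N) (l' + N) = S l k" by (simp only: S_add)
    then show False using assms(7) S_commute by metis
  qed
qed (use assms N_ge in auto)

lemma G_noncrossing:
  assumes "(e, c) \<in> G p t" "(f, d) \<in> G p t" "size1 t \<le> N" "e \<noteq> f"
  shows "noncrossing e f"
proof -
  obtain k l where k: "(k, l, c) \<in> ents p t" "e \<in> seg_orbit k l" "p \<le> k" "k < l" "l \<le> p + N"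
    using assms(1,3) by (rule G_E)
  obtain k' l' where k': "(k', l', d) \<in> ents p t" "f \<in> seg_orbit k' l'" "p \<le> k'" "k' < l'" "l' \<le> p + N"
    using assms(2,3) by (rule G_E)
  have lam: "l \<le> k' \<or> l' \<le> k \<or> k \<le> k' \<and> l' \<le> l \<or> k' \<le> k \<and> l \<le> l'"
    using ents_laminar[OF k(1) k'(1)] .
  from k(2) k'(2) consider "e = S k l" "f = S k' l'" | "e = S k l" "f = S (k' + N) (l' + N)"
    | "e = S (k + N) (l + N)" "f = S k' l'" | "e = S (k + N) (l + N)" "f = S (k' + N) (l' + N)"
    unfolding seg_orbit_def by blast
  then show ?thesis
  proof cases
    case 1
    then have "(k, l) \<noteq> (k', l')" using assms(4) by auto
    then show ?thesis unfolding 1 using laminar_noncrossing[OF k(3-5) k'(3-5) lam] by blast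
  next
    case 2
    then show ?thesis using halves_noncrossing[OF k(3-5) k'(3-5)] assms(4) by simp
  next
    case 3
    then have "noncrossing f e" using halves_noncrossing[OF k'(3-5) k(3-5)] assms(4) by simp
    then show ?thesis by (simp add: noncrossing_commute)
  next
    case 4
    then have "(k + N, l + N) \<noteq> (k' + N, l' + N)" using assms(4) by auto
    then show ?thesis unfolding 4 using k k' lam by (intro laminar_noncrossing[of "p + N"]) auto
  qed
qed

lemma G_diagonals:
  assumes "(e, c) \<in> G p t" "size1 t \<le> N"
  shows "e \<in> diagonals M v"
proof -
  obtain k l where k: "(k, l, c) \<in> ents p t" "e \<in> seg_orbit k l" "p \<le> k" "k < l" "l \<le> p + N"
    using assms by (rule G_E)
  then have "k + 2 \<le> l" "l + 2 \<le> k + M" "l < k + M" using ents_bounds[OF k(1)] N_ge by linarith+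
  then have "S k l \<in> diagonals M v" "S (k + N) (l + N) \<in> diagonals M v"
    by (subst diagonal_iff; simp)+
  then show ?thesis using k(2) by (auto simp: seg_orbit_def)
qed

text \<open>A diagonal within one half is in the tree or crosses one of its chords by
  \<open>ents_crossing\<close>. A diagonal with an end strictly inside each half crosses the central
  one.\<close>

lemma G_maximal:
  assumes size: "size1 t = N" and d: "d \<in> diagonals M v"
    and nc: "\<And>e. e \<in> fst ` G p t \<Longrightarrow> noncrossing d e"
  shows "d \<in> fst ` G p t"
proof -
  have in_G: "e \<in> fst ` G p t" if "(k, l, c) \<in> ents p t" "e = S k l \<or> e = S (k + N) (l + N)" for k l c e
    using that G_I[OF that(1)] by force
  have half: "S a b \<in> fst ` G p t \<and> S (a + N) (b + N) \<in> fst ` G p t"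
    if ab: "p \<le> a" "a + 2 \<le> b" "b \<le> p + N" "d = S a b \<or> d = S (a + N) (b + N)" for a b
  proof (cases "\<exists>c. (a, b, c) \<in> ents p t")
    case True
    then show ?thesis using in_G by blast
  next
    case False
    have "b \<le> p + size1 t" using ab size by simp
    then obtain k l c where kl: "(k, l, c) \<in> ents p t" "k < a \<and> a < l \<and> l < b \<or> a < k \<and> k < b \<and> b < l"
      using ents_crossing[OF ab(1,2)] False by meson
    have b: "l \<le> p + N" "p \<le> k" using ents_bounds[OF kl(1)] size by auto
    have "\<not> noncrossing (S a b) (S k l) \<and> \<not> noncrossing (S (a + N) (b + N)) (S (k + N) (l + N))"
      using kl(2)
    proof
      assume *: "k < a \<and> a < l \<and> l < b"
      then have "b < k + M" using ab b N_ge by linarith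
      then show ?thesis using * crossing[of k a l b] crossing[of "k + N" "a + N" "l + N" "b + N"] noncrossing_commute by simp
    next
      assume *: "a < k \<and> k < b \<and> b < l"
      then have "l < a + M" using ab b N_ge by linarith
      then show ?thesis using * crossing[of a k b l] crossing[of "a + N" "k + N" "b + N" "l + N"] by simp
    qed
    moreover have "noncrossing d (S k l)" "noncrossing d (S (k + N) (l + N))"
      using nc in_G[OF kl(1)] by simp_all
    ultimately show ?thesis using ab(4) by metis
  qed
  obtain a b where ab: "p \<le> a" "a < b" "b < p + M" "d = S a b"
    using segmentE[of d p] d by blast
  have l2: "a + 2 \<le> b" "b + 2 \<le> a + M" using diagonal_iff[of a b] d ab by auto
  consider "b \<le> p + N" | "p + N \<le> a" | "a = p" "p + N < b" | "p < a" "a < p + N" "p + N < b"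
    using ab(1) by linarith
  then show ?thesis
  proof cases
    case 1
    then show ?thesis using half[of a b] ab l2 by simp
  next
    case 2
    then have "p \<le> a - N" "a - N + 2 \<le> b - N" "b - N \<le> p + N" "a - N + N = a" "b - N + N = b"
      using ab l2 by linarith+
    then show ?thesis using half[of "a - N" "b - N"] ab(4) by simp
  next
    \<comment> \<open>The end \<open>p\<close> is read as \<open>p + M\<close>, which makes the
      diagonal a chord of the second half.\<close>
    case 3
    then have *: "p \<le> b - N" "b - N + 2 \<le> p + N" "b - N + N = b" using ab l2 by linarith+
    have "S (b - N + N) (p + N + N) = S b p"
    proof -
      have "p + N + N = p + M" by simp
      then show ?thesis unfolding *(3) by (simp only: S_add)
    qed
    then have d': "d = S (b - N + N) (p + N + N)" using ab(4) 3(1) S_commute by metis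
    have "S (b - N + N) (p + N + N) \<in> fst ` G p t" using half[of "b - N" "p + N"] *(1,2) d' by blast
    then show ?thesis by (simp only: d')
  next
    case 4
    obtain x where x: "rlab t = Some x" using size1_ge2[of t] size N_ge by auto
    have "S p (p + N) \<in> fst ` G p t" using in_G[OF ents_root[OF x]] size by simp
    moreover have "\<not> noncrossing d (S p (p + N))"
      using crossing[of p a "p + N" b] 4 ab noncrossing_commute by simp
    ultimately show ?thesis using nc by blast
  qed
qed

lemma G_cs_triangulation:
  assumes "size1 t = N"
  shows "cs_triangulation M v ctr (fst ` G p t)"
proof -
  have "t' = fst ` G p t"
    if t': "fst ` G p t \<subseteq> t'" "t' \<subseteq> diagonals M v" "pairwise noncrossing t'" for t'
  proof
    show "t' \<subseteq> fst ` G p t"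
    proof (rule ccontr)
      assume "\<not> t' \<subseteq> fst ` G p t"
      then obtain d where d: "d \<in> t'" "d \<notin> fst ` G p t" by blast
      then have "noncrossing d e" if "e \<in> fst ` G p t" for e
        using t'(1,3) that unfolding pairwise_def by blast
      then show False using G_maximal[OF assms, of d p] d t'(2) by blast
    qed
  qed (rule t')
  moreover have "fst ` G p t \<subseteq> diagonals M v"
  proof clarify
    fix e c assume "(e, c) \<in> G p t"
    then have "e \<in> diagonals M v" by (rule G_diagonals) (simp add: assms)
    then show "fst (e, c) \<in> diagonals M v" by simp
  qed
  moreover have "pairwise noncrossing (fst ` G p t)"
  proof (rule pairwiseI)
    fix e f assume "e \<in> fst ` G p t" "f \<in> fst ` G p t" and ne: "e \<noteq> f"
    then obtain c d where "(e, c) \<in> G p t" "(f, d) \<in> G p t"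
      by (metis (no_types, lifting) imageE prod.collapse)
    then show "noncrossing e f" by (rule G_noncrossing) (simp_all add: assms ne)
  qed
  ultimately have "triangulation M v (fst ` G p t)" unfolding triangulation_def by blast
  moreover have "opposite ctr ` fst ` G p t = fst ` G p t"
  proof -
    have *: "opposite ctr e \<in> fst ` G p t" if "e \<in> fst ` G p t" for e
      using that G_opposite by (metis (no_types, lifting) fst_conv imageE imageI prod.collapse)
    moreover have "e \<in> opposite ctr ` fst ` G p t" if "e \<in> fst ` G p t" for e
      using imageI[OF *[OF that], of "opposite ctr"] unfolding opposite_opposite .
    ultimately show ?thesis by blast
  qed
  ultimately show ?thesis unfolding cs_triangulation_def by blast
qed

section \<open>Bijection between tree states and colored triangulations\<close>

definition coloring :: "nat \<Rightarrow> 'c option tree \<Rightarrow> complex set \<rightharpoonup> 'c" where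
  "coloring p t e = (if \<exists>a. (e, Some a) \<in> G p t then Some (THE a. (e, Some a) \<in> G p t) else None)"

definition enc :: "nat \<times> 'c option tree \<Rightarrow> 'c colored_triangulation" where
  "enc x = (fst ` G (fst x) (snd x), coloring (fst x) (snd x))"

lemma coloring_iff:
  assumes "size1 t = N"
  shows "coloring p t e = Some a \<longleftrightarrow> (e, Some a) \<in> G p t"
proof -
  have u: "b = a" if "(e, Some a) \<in> G p t" "(e, Some b) \<in> G p t" for a b
    using G_functional[OF that] assms by simp
  then have "(THE a. (e, Some a) \<in> G p t) = a" if "(e, Some a) \<in> G p t" for a
    using that by (intro the_equality)
  then show ?thesis using u unfolding coloring_def by auto
qed

lemma G_coloring:
  assumes "size1 t = N"
  shows "(e, c) \<in> G p t \<longleftrightarrow> e \<in> fst ` G p t \<and> coloring p t e = c"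
proof (cases c)
  case (Some a)
  then show ?thesis using coloring_iff[OF assms, of p e a] by (metis fst_conv imageI)
next
  case None
  have "coloring p t e = None" if e: "(e, None) \<in> G p t"
  proof (cases "coloring p t e")
    case (Some a)
    then have a: "(e, Some a) \<in> G p t" using coloring_iff[OF assms] by simp
    have "None = Some a" by (rule G_functional[OF e a]) (simp add: assms)
    then show ?thesis by simp
  qed
  moreover have "(e, None) \<in> G p t" if e: "e \<in> fst ` G p t" "coloring p t e = None"
  proof -
    obtain c where c: "(e, c) \<in> G p t" using e(1) by (metis imageE prod.collapse)
    then have "c = None" using e(2) coloring_iff[OF assms, of p e] by (cases c) simp_all
    then show ?thesis using c by simp
  qed
  ultimately show ?thesis using None by (metis fst_conv imageI)
qed

lemma coloring_mod: "coloring (p mod N) t = coloring p t"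
  by (rule ext) (simp add: coloring_def G_mod)

lemma enc_mod: "enc (p mod N, t) = enc (p, t)"
  by (simp add: enc_def G_mod coloring_mod)

text \<open>The apex of the triangle below an edge is the split point of its node; \<open>f\<close>
  supplies the labels.\<close>

lemma tree_of_triangulation:
  assumes t: "triangulation M v t"
  shows "i < j \<Longrightarrow> j \<le> i + N \<Longrightarrow> S i j \<in> t \<union> sides M v \<Longrightarrow>
    \<exists>u. size1 u = j - i \<and> (\<forall>k l c. (k, l, c) \<in> ents i u \<longrightarrow> S k l \<in> t \<and> f (S k l) = c)"
proof (induction "j - i" arbitrary: i j rule: less_induct)
  case less
  have jM: "j < i + M" using less.prems N_ge by linarith
  show ?case
  proof (cases "j = i + 1")
    case True
    then show ?thesis by (intro exI[of _ Leaf]) simp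
  next
    case False
    then have "i + 2 \<le> j" using less.prems by simp
    then obtain m where m: "i < m" "m < j" "S i m \<in> t \<union> sides M v" "S m j \<in> t \<union> sides M v"
      using apex[OF t _ jM less.prems(3)] by blast
    have l1: "m - i < j - i" "j - m < j - i" "m \<le> i + N" "j \<le> m + N" using m less.prems by linarith+
    obtain u where u: "size1 u = m - i" "\<And>k l c. (k, l, c) \<in> ents i u \<Longrightarrow> S k l \<in> t \<and> f (S k l) = c"
      using less.hyps[OF l1(1) m(1) l1(3) m(3)] by blast
    obtain w where w: "size1 w = j - m" "\<And>k l c. (k, l, c) \<in> ents m w \<Longrightarrow> S k l \<in> t \<and> f (S k l) = c"
      using less.hyps[OF l1(2) m(2) l1(4) m(4)] by blast
    have "S i j \<in> diagonals M v" using less.prems jM \<open>i + 2 \<le> j\<close> N_ge by (subst diagonal_iff) auto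
    then have S: "S i j \<in> t" using less.prems(3) unfolding diagonals_def by blast
    have eq: "i + size1 u = m" "m + size1 w = j" using u(1) w(1) m by simp_all
    have "size1 (Node u (f (S i j)) w) = j - i" using eq m by simp
    moreover have "S k l \<in> t \<and> f (S k l) = c" if "(k, l, c) \<in> ents i (Node u (f (S i j)) w)" for k l c
      using that u(2) w(2) S unfolding ents.simps eq by auto
    ultimately show ?thesis by blast
  qed
qed

end

locale colored_polygon = cs_polygon +
  fixes Col :: "'c set"
  assumes finite_Col: "finite Col" and N_eq: "N = card Col + 2"
begin

sublocale st: states Col
  by unfold_locales (rule finite_Col)

lemma st_N [simp]: "st.N = N"
  by (simp add: st.N_def N_eq)

lemma state_iff:
  "(p, t) \<in> mstates Col \<longleftrightarrow> p < N \<and> rlab t = Some None \<and> distinct (inorder t) \<and> set_tree t = labels Col \<and> size1 t = N"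
proof -
  have "size1 t = N" if "(p, t) \<in> mstates Col"
    using st.stateE[OF that] st_N by (metis size1.simps(2) snd_conv)
  then show ?thesis unfolding st.mem_X by auto
qed

lemma enc_in:
  assumes "x \<in> mstates Col"
  shows "enc x \<in> colored_triangulations M v ctr Col"
proof -
  obtain p t where x: "x = (p, t)" by (cases x)
  then have t: "rlab t = Some None" "distinct (inorder t)" "set_tree t = labels Col" "size1 t = N"
    using assms state_iff by auto
  have dom: "dom (coloring p t) = {d \<in> fst ` G p t. \<not> central ctr d}"
  proof (rule Set.set_eqI)
    fix d
    have "d \<in> dom (coloring p t) \<longleftrightarrow> (\<exists>a. (d, Some a) \<in> G p t)"
      unfolding dom_def mem_Collect_eq not_None_eq coloring_iff[OF t(4)] ..
    also have "\<dots> \<longleftrightarrow> (\<exists>c. (d, c) \<in> G p t \<and> \<not> central ctr d)"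
    proof
      assume "\<exists>a. (d, Some a) \<in> G p t"
      then show "\<exists>c. (d, c) \<in> G p t \<and> \<not> central ctr d" using G_central[OF _ t(4,2)] t(1) by fastforce
    next
      assume "\<exists>c. (d, c) \<in> G p t \<and> \<not> central ctr d"
      then obtain c where c: "(d, c) \<in> G p t" "\<not> central ctr d" by blast
      then have "c \<noteq> None" using G_central[OF c(1) t(4,2)] t(1) by simp
      then show "\<exists>a. (d, Some a) \<in> G p t" using c(1) by auto
    qed
    also have "\<dots> \<longleftrightarrow> d \<in> {d \<in> fst ` G p t. \<not> central ctr d}" by force
    finally show "d \<in> dom (coloring p t) \<longleftrightarrow> d \<in> {d \<in> fst ` G p t. \<not> central ctr d}" .
  qed
  have "ran (coloring p t) \<subseteq> Col"
  proof
    fix a assume "a \<in> ran (coloring p t)"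
    then obtain e where "(e, Some a) \<in> G p t" using coloring_iff[OF t(4)] by (auto simp: ran_def)
    then have "Some a \<in> labels Col" using G_labels t(3) by metis
    then show "a \<in> Col" by (auto simp: labels_def)
  qed
  moreover have "coloring p t d = coloring p t e \<longleftrightarrow> e = d \<or> e = opposite ctr d"
    if de: "d \<in> dom (coloring p t)" "e \<in> dom (coloring p t)" for d e
  proof -
    obtain a b where ab: "coloring p t d = Some a" "coloring p t e = Some b" using de by auto
    have d: "(d, Some a) \<in> G p t" and e: "(e, Some b) \<in> G p t" using ab coloring_iff[OF t(4)] by auto
    show ?thesis
    proof
      assume "coloring p t d = coloring p t e"
      then have "(e, Some a) \<in> G p t" using ab e by simp
      then show "e = d \<or> e = opposite ctr d" using G_same_label[OF d _ t(2)] by blast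
    next
      assume "e = d \<or> e = opposite ctr d"
      then have a: "(e, Some a) \<in> G p t" using d G_opposite[OF d] by metis
      have "Some a = Some b" by (rule G_functional[OF a e]) (simp add: t(4))
      then show "coloring p t d = coloring p t e" using ab by simp
    qed
  qed
  ultimately show ?thesis
    using G_cs_triangulation[OF t(4), of p] dom unfolding x enc_def colored_triangulations_def by simp
qed

text \<open>The encoding determines the labeled edges. The central one gives back the position, and
  those in the half polygon starting there give back the tree.\<close>

lemma enc_inj: "inj_on enc (mstates Col)"
proof (rule inj_onI)
  fix x y assume xy: "x \<in> mstates Col" "y \<in> mstates Col" "enc x = enc y"
  obtain p t where x: "x = (p, t)" by (cases x)
  obtain q u where y: "y = (q, u)" by (cases y)
  have t: "p < N" "rlab t = Some None" "distinct (inorder t)" "size1 t = N"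
    and u: "q < N" "rlab u = Some None" "distinct (inorder u)" "size1 u = N"
    using xy x y state_iff by auto
  have eq: "fst ` G p t = fst ` G q u" "coloring p t = coloring q u" using xy(3) x y by (auto simp: enc_def)
  have G: "G p t = G q u"
  proof -
    have "(e, c) \<in> G p t \<longleftrightarrow> (e, c) \<in> G q u" for e c
      unfolding G_coloring[OF t(4)] G_coloring[OF u(4)] eq ..
    then show ?thesis by (auto simp: set_eq_iff)
  qed
  have "(S p (p + N), None) \<in> G p t" "(S q (q + N), None) \<in> G p t"
    using G_I(1)[OF ents_root[OF t(2), of p]] G_I(1)[OF ents_root[OF u(2), of q]] unfolding G t(4) u(4) by simp_all
  then have in_G: "S p (p + N) \<in> fst ` G p t" "S q (q + N) \<in> fst ` G p t" by (metis fst_conv imageI)+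
  have central: "central ctr (S p (p + N))" "central ctr (S q (q + N))"
    using central_iff[of p "p + N"] central_iff[of q "q + N"] N_ge by auto
  have tri: "triangulation M v (fst ` G p t)" using G_cs_triangulation[OF t(4), of p] by (simp add: cs_triangulation_def)
  have Seq: "S p (p + N) = S q (q + N)" by (rule central_unique[OF tri in_G(1) central(1) in_G(2) central(2)])
  have "p = q \<and> p + N = q + N" by (rule S_eq_window[OF Seq, of 0]) (use t(1) u(1) N_ge in simp_all)
  then have "p = q" ..
  moreover have "ents p t \<subseteq> ents p u"
  proof
    fix e assume e: "e \<in> ents p t"
    obtain k l c where klc: "e = (k, l, c)" by (cases e)
    then have "p \<le> k" "k < l" "l \<le> p + N" using e ents_bounds[of k l c p t] t(4) by auto
    then show "e \<in> ents p u"
      using e klc G_ents_iff[of t p k l c] G_ents_iff[of u p k l c] G t(4) u(4) \<open>p = q\<close> by simp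
  qed
  ultimately show "x = y" using ents_subset_eq[of t u p] t(4) u(4) x y by simp
qed

lemma enc_surj:
  assumes "y \<in> colored_triangulations M v ctr Col"
  shows "\<exists>x\<in>mstates Col. enc x = y"
proof -
  obtain t \<kappa> where y: "y = (t, \<kappa>)" by (cases y)
  have cst: "cs_triangulation M v ctr t" and dom: "dom \<kappa> = {d \<in> t. \<not> central ctr d}" and ran: "ran \<kappa> \<subseteq> Col"
    and col: "\<And>d e. d \<in> dom \<kappa> \<Longrightarrow> e \<in> dom \<kappa> \<Longrightarrow> \<kappa> d = \<kappa> e \<longleftrightarrow> e = d \<or> e = opposite ctr d"
    using assms y by (auto simp: colored_triangulations_def)
  have t: "triangulation M v t" and opp: "\<And>e. e \<in> t \<Longrightarrow> opposite ctr e \<in> t"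
    using cst by (auto simp: cs_triangulation_def)
  have central_opp: "central ctr (opposite ctr e) \<longleftrightarrow> central ctr e" for e
  proof -
    have "point_reflection ctr ctr = ctr" by (simp add: point_reflection_def)
    then have "central ctr (opposite ctr e)" if "central ctr e" for e
      using that unfolding central_def by (metis imageI)
    then show ?thesis using opposite_opposite by metis
  qed
  have \<kappa>_None: "\<kappa> e = None \<longleftrightarrow> central ctr e" if "e \<in> t" for e
  proof -
    have "e \<in> dom \<kappa> \<longleftrightarrow> \<not> central ctr e" using that by (simp add: dom)
    then show ?thesis unfolding domIff by blast
  qed
  have \<kappa>_opp: "\<kappa> (opposite ctr e) = \<kappa> e" if "e \<in> t" for e
  proof (cases "central ctr e")
    case True
    then show ?thesis using \<kappa>_None[OF that] \<kappa>_None[OF opp[OF that]] central_opp by simp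
  next
    case False
    then show ?thesis using col[of e "opposite ctr e"] dom that opp central_opp by simp
  qed
  obtain p where p: "p < N" "S p (p + N) \<in> t" using central_exists[OF cst] by blast
  obtain u where u: "size1 u = N" "\<And>k l c. (k, l, c) \<in> ents p u \<Longrightarrow> S k l \<in> t \<and> \<kappa> (S k l) = c"
    using tree_of_triangulation[OF t, of p "p + N" \<kappa>] p N_ge by auto
  have G: "e \<in> t \<and> \<kappa> e = c" if ec: "(e, c) \<in> G p u" for e c
  proof -
    obtain k l where kl: "(k, l, c) \<in> ents p u" "e \<in> seg_orbit k l"
      using ec unfolding colored_edges_def by blast
    have "e = S k l \<or> e = opposite ctr (S k l)" using kl(2) by (simp add: seg_orbit_def opposite_S)
    then show ?thesis using u(2)[OF kl(1)] opp \<kappa>_opp by metis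
  qed
  \<comment> \<open>Both sets are maximal noncrossing, so inclusion is equality.\<close>
  have t_eq: "fst ` G p u = t"
  proof -
    have "fst ` G p u \<subseteq> t" using G by auto
    then show ?thesis
      using G_cs_triangulation[OF u(1), of p] triangulationD[OF t]
      unfolding cs_triangulation_def triangulation_def by metis
  qed
  have \<kappa>_eq: "coloring p u = \<kappa>"
  proof
    fix e show "coloring p u e = \<kappa> e"
    proof (cases "e \<in> t")
      case True
      then obtain c where "(e, c) \<in> G p u" using t_eq by (metis imageE prod.collapse)
      then show ?thesis using G G_coloring[OF u(1)] by metis
    next
      case False
      then have "e \<notin> dom \<kappa>" by (simp add: dom)
      then have "\<kappa> e = None" by (simp add: domIff)
      moreover have "(e, Some a) \<notin> G p u" for a using False G by blast
      then have "coloring p u e = None" by (simp add: coloring_def)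
      ultimately show ?thesis by simp
    qed
  qed
  have bounds: "p \<le> k \<and> k < l \<and> l \<le> p + N" if "(k, l, c) \<in> ents p u" for k l c
    using ents_bounds[OF that] u(1) by auto
  have central_kl: "k = p \<and> l = p + N" if "(k, l, c) \<in> ents p u" "central ctr (S k l)" for k l c
  proof -
    have "l = k + N" using bounds[OF that(1)] that(2) N_ge by (subst central_iff[symmetric]) auto
    then show ?thesis using bounds[OF that(1)] by simp
  qed
  \<comment> \<open>A color determines its pair of diagonals, which has one representative in the
    half polygon; the label \<open>None\<close> occurs only at the central chord.\<close>
  have "inj_on (\<lambda>e. snd (snd e)) (ents p u)"
  proof (rule inj_onI)
    fix e e' assume e: "e \<in> ents p u" "e' \<in> ents p u" "snd (snd e) = snd (snd e')"
    obtain k l c where k: "e = (k, l, c)" by (cases e)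
    obtain k' l' where k': "e' = (k', l', c)" using e(3) k by (cases e') auto
    have kl: "(k, l, c) \<in> ents p u" "(k', l', c) \<in> ents p u" using e k k' by auto
    note * = u(2)[OF kl(1)] u(2)[OF kl(2)]
    have "k = k' \<and> l = l'"
    proof (cases c)
      case None
      then have "central ctr (S k l)" "central ctr (S k' l')" using * \<kappa>_None by auto
      then show ?thesis using central_kl[OF kl(1)] central_kl[OF kl(2)] by metis
    next
      case (Some a)
      then have "S k' l' = S k l \<or> S k' l' = opposite ctr (S k l)"
        using * col[OF domI domI, of "S k l" a "S k' l'" a] by simp
      then have "S k' l' \<in> seg_orbit k l" by (simp add: seg_orbit_def opposite_S)
      moreover have "S k' l' \<in> seg_orbit k' l'" by (simp add: seg_orbit_def)
      ultimately show ?thesis using orbit_eqD bounds[OF kl(1)] bounds[OF kl(2)] by blast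
    qed
    then show "e = e'" using k k' by simp
  qed
  then have dist: "distinct (inorder u)" by (rule ents_distinct)
  obtain x where x: "rlab u = Some x" using size1_ge2[of u] u(1) N_ge by auto
  have "(p, p + N, x) \<in> ents p u" using ents_root[OF x, of p] u(1) by simp
  then have "x = \<kappa> (S p (p + N))" using u(2) by metis
  moreover have "central ctr (S p (p + N))" using central_iff[of p "p + N"] N_ge by simp
  ultimately have root: "rlab u = Some None" using x \<kappa>_None[OF p(2)] by simp
  have "set_tree u \<subseteq> labels Col"
  proof
    fix c assume "c \<in> set_tree u"
    then obtain k l where "(k, l, c) \<in> ents p u" using ents_labels by metis
    then have c: "c = \<kappa> (S k l)" using u(2) by metis
    show "c \<in> labels Col"
    proof (cases c)
      case (Some a)
      then have "a \<in> Col" using c ran ranI[of \<kappa> "S k l" a] by auto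
      then show ?thesis using Some by (simp add: labels_def)
    qed (simp add: labels_def)
  qed
  \<comment> \<open>A tree with \<open>N\<close> leaves has N - 1 = n + 1 nodes with distinct
    labels, as many as there are labels, so every color occurs.\<close>
  moreover have "card (set_tree u) = card (labels Col)"
  proof -
    have "card (set_tree u) = size u" using distinct_card[OF dist] by simp
    then show ?thesis using size1_size[of u] u(1) N_eq card_labels[OF finite_Col] by linarith
  qed
  moreover have "finite (labels Col)" using finite_Col by (simp add: labels_def)
  ultimately have "set_tree u = labels Col" by (metis card_subset_eq)
  then have "(p, u) \<in> mstates Col" using state_iff p(1) root dist u(1) by simp
  moreover have "enc (p, u) = y" using t_eq \<kappa>_eq y by (simp add: enc_def)
  ultimately show ?thesis by blast
qed

lemma bij_enc: "bij_betw enc (mstates Col) (colored_triangulations M v ctr Col)"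
  using enc_inj enc_in enc_surj unfolding bij_betw_def by blast

end

section \<open>Tree operations as flips\<close>

definition edge :: "nat \<Rightarrow> 'a tree \<Rightarrow> nat \<Rightarrow> nat \<Rightarrow> bool" where
  "edge i t k l \<longleftrightarrow> l = Suc k \<or> (\<exists>x. (k, l, x) \<in> ents i t)"

lemma edge_root: "edge i t i (i + size1 t)"
proof (cases t)
  case (Node u x w)
  then show ?thesis using ents_root[of t x i] by (auto simp: edge_def)
qed (simp add: edge_def)

lemma edge_child:
  "edge i u k l \<Longrightarrow> edge i (Node u x w) k l" "edge (i + size1 u) w k l \<Longrightarrow> edge i (Node u x w) k l"
  by (auto simp: edge_def)

lemma ents_label: "(k, l, c) \<in> ents i t \<Longrightarrow> c \<in> set_tree t"
  using ents_bounds[of k l c i t] by simp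

lemma ents_notin: "c \<notin> set_tree t \<Longrightarrow> ents i t - {(a, b, c)} = ents i t"
  using ents_label[of a b c i t] by blast

text \<open>The edge \<open>c\<close> is one diagonal of the quadrilateral \<open>k l m n\<close>, and the rotation replaces it by the other one.\<close>

lemma ents_rot:
  "distinct (inorder t) \<Longrightarrow> c \<in> set_tree t \<Longrightarrow> rlab t \<noteq> Some c \<Longrightarrow>
   \<exists>k l m n a b a' b'. i \<le> k \<and> k < l \<and> l < m \<and> m < n \<and> n \<le> i + size1 t \<and>
     edge i t k l \<and> edge i t l m \<and> edge i t m n \<and> edge i t k n \<and>
     ((a, b, a', b') = (k, m, l, n) \<or> (a, b, a', b') = (l, n, k, m)) \<and> (a, b, c) \<in> ents i t \<and>
     ents i (rot c t) = insert (a', b', c) (ents i t - {(a, b, c)})"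
proof (induction t arbitrary: i)
  case (Node u x w)
  let ?t = "Node u x w" and ?m = "i + size1 u"
  have d: "distinct (inorder u)" "distinct (inorder w)" "x \<notin> set_tree u" "x \<notin> set_tree w"
    "set_tree u \<inter> set_tree w = {}"
    using Node.prems(1) by auto
  have "c \<noteq> x" "c \<in> set_tree u \<or> c \<in> set_tree w" using Node.prems by auto
  then consider "rlab u = Some c" "c \<notin> set_tree w" | "rlab w = Some c" "c \<notin> set_tree u"
    | "rlab u \<noteq> Some c" "c \<in> set_tree u" "c \<notin> set_tree w"
    | "rlab w \<noteq> Some c" "c \<in> set_tree w" "c \<notin> set_tree u"
    using d rlab_in[of u c] rlab_in[of w c] by blast
  then show ?case
  proof cases
    case 1
    then obtain a b where u: "u = Node a c b" by (auto simp: rlab_Some)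
    let ?l = "i + size1 a"
    have c: "c \<notin> set_tree a" "c \<notin> set_tree b" using d(1) u by auto
    have m: "?m = ?l + size1 b" using u by simp
    have "rot c ?t = Node a x (Node b c w)" using u by simp
    then have "ents i (rot c ?t) = insert (?l, ?m + size1 w, c) (ents i ?t - {(i, ?m, c)})"
      using \<open>c \<noteq> x\<close> by (simp add: u insert_Diff_if Un_Diff ents_notin c 1(2) add.assoc) blast
    moreover have "(i, ?m, c) \<in> ents i ?t" using u by (simp add: add.assoc)
    moreover have "edge i ?t i ?l" unfolding u by (rule edge_child(1), rule edge_child(1), rule edge_root)
    moreover have "edge i (Node (Node a c b) x w) ?l (?l + size1 b)" by (rule edge_child(1), rule edge_child(2), rule edge_root)
    then have "edge i ?t ?l ?m" by (simp add: u add.assoc)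
    moreover have "edge i ?t ?m (?m + size1 w)" by (rule edge_child(2), rule edge_root)
    moreover have "edge i ?t i (?m + size1 w)" using edge_root[of i ?t] by (simp add: add.assoc)
    moreover have "i < ?l" "?l < ?m" "?m < ?m + size1 w" "?m + size1 w \<le> i + size1 ?t" using u by simp_all
    ultimately show ?thesis by blast
  next
    case 2
    then obtain a b where w: "w = Node a c b" by (auto simp: rlab_Some)
    let ?l = "?m + size1 a"
    have c: "c \<notin> set_tree a" "c \<notin> set_tree b" using d(2) w by auto
    have n: "?m + size1 w = ?l + size1 b" using w by simp
    have "rlab u \<noteq> Some c" using 2(2) rlab_in[of u c] by blast
    then have "rot c ?t = Node (Node u c a) x b" using w by simp
    then have "ents i (rot c ?t) = insert (i, ?l, c) (ents i ?t - {(?m, ?m + size1 w, c)})"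
      using \<open>c \<noteq> x\<close> by (simp add: w insert_Diff_if Un_Diff ents_notin c 2(2) add.assoc) blast
    moreover have "(?m, ?m + size1 w, c) \<in> ents i ?t" using w by (simp add: add.assoc)
    moreover have "edge i ?t i ?m" by (rule edge_child(1), rule edge_root)
    moreover have "edge i ?t ?m ?l" unfolding w by (rule edge_child(2), rule edge_child(1), rule edge_root)
    moreover have "edge i (Node u x (Node a c b)) ?l (?l + size1 b)" by (rule edge_child(2), rule edge_child(2), rule edge_root)
    then have "edge i ?t ?l (?m + size1 w)" by (simp add: w add.assoc)
    moreover have "edge i ?t i (?m + size1 w)" using edge_root[of i ?t] by (simp add: add.assoc)
    moreover have "i < ?m" "?m < ?l" "?l < ?m + size1 w" "?m + size1 w \<le> i + size1 ?t" using w by simp_all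
    ultimately show ?thesis by blast
  next
    case 3
    obtain k l m n a b a' b' where *: "i \<le> k" "k < l" "l < m" "m < n" "n \<le> i + size1 u"
      "edge i u k l" "edge i u l m" "edge i u m n" "edge i u k n"
      "(a, b, a', b') = (k, m, l, n) \<or> (a, b, a', b') = (l, n, k, m)" "(a, b, c) \<in> ents i u"
      "ents i (rot c u) = insert (a', b', c) (ents i u - {(a, b, c)})"
      using Node.IH(1)[OF d(1) 3(2,1), of i] by metis
    have "rot c ?t = Node (rot c u) x w" using rot_left 3 by metis
    then have "ents i (rot c ?t) = insert (a', b', c) (ents i ?t - {(a, b, c)})"
      using \<open>c \<noteq> x\<close> *(12) by (simp add: insert_Diff_if Un_Diff ents_notin 3(3)) blast
    moreover have "(a, b, c) \<in> ents i ?t" using *(11) by simp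
    moreover have "n \<le> i + size1 ?t" using *(5) by simp
    ultimately show ?thesis using *(1-4,10) edge_child(1)[OF *(6)] edge_child(1)[OF *(7)]
        edge_child(1)[OF *(8)] edge_child(1)[OF *(9)] by metis
  next
    case 4
    obtain k l m n a b a' b' where *: "?m \<le> k" "k < l" "l < m" "m < n" "n \<le> ?m + size1 w"
      "edge ?m w k l" "edge ?m w l m" "edge ?m w m n" "edge ?m w k n"
      "(a, b, a', b') = (k, m, l, n) \<or> (a, b, a', b') = (l, n, k, m)" "(a, b, c) \<in> ents ?m w"
      "ents ?m (rot c w) = insert (a', b', c) (ents ?m w - {(a, b, c)})"
      using Node.IH(2)[OF d(2) 4(2,1), of ?m] by metis
    have "rot c ?t = Node u x (rot c w)" using rot_right 4 by metis
    then have "ents i (rot c ?t) = insert (a', b', c) (ents i ?t - {(a, b, c)})"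
      using \<open>c \<noteq> x\<close> *(12) by (simp add: insert_Diff_if Un_Diff ents_notin 4(3)) blast
    moreover have "(a, b, c) \<in> ents i ?t" using *(11) by simp
    moreover have "n \<le> i + size1 ?t" "i \<le> k" using *(1,5) by simp_all
    ultimately show ?thesis using *(2-4,10) edge_child(2)[OF *(6)] edge_child(2)[OF *(7)]
        edge_child(2)[OF *(8)] edge_child(2)[OF *(9)] by metis
  qed
qed simp

context cs_polygon
begin

lemma edge_S: "edge i t k l \<Longrightarrow> S k l \<in> fst ` G i t \<union> sides M v"
  using side_in[of k] G_I(1)[of k l _ i t] unfolding edge_def by (metis UnCI fst_conv imageI)

text \<open>Labels are distinct, so all segments labeled \<open>c\<close> come from the one entry
  that is exchanged.\<close>

lemma G_replace:
  assumes "distinct (inorder t)" "(a, b, c) \<in> ents i t"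
    and "ents i t' = insert (a', b', c) (ents i t - {(a, b, c)})"
  shows "G i t' = seg_orbit a' b' \<times> {c} \<union> (G i t - seg_orbit a b \<times> {c})"
proof -
  have "(e, x) \<in> G i t' \<longleftrightarrow> (e, x) \<in> seg_orbit a' b' \<times> {c} \<union> (G i t - seg_orbit a b \<times> {c})" for e x
  proof -
    have "(e, x) \<in> G i t' \<longleftrightarrow> e \<in> seg_orbit a' b' \<and> x = c \<or>
        (\<exists>k l. (k, l, x) \<in> ents i t \<and> (k, l, x) \<noteq> (a, b, c) \<and> e \<in> seg_orbit k l)"
      unfolding colored_edges_def assms(3) by blast
    moreover have "(\<exists>k l. (k, l, x) \<in> ents i t \<and> (k, l, x) \<noteq> (a, b, c) \<and> e \<in> seg_orbit k l)
        \<longleftrightarrow> (e, x) \<in> G i t \<and> \<not> (e \<in> seg_orbit a b \<and> x = c)"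
    proof (cases "x = c")
      case True
      have "(k, l, c) \<in> ents i t \<longleftrightarrow> k = a \<and> l = b" for k l
        using ents_label_unique[OF assms(1,2)] assms(2) by blast
      then show ?thesis using True unfolding colored_edges_def by simp
    next
      case False
      then show ?thesis unfolding colored_edges_def by simp
    qed
    ultimately show ?thesis by blast
  qed
  then show ?thesis by (auto simp: set_eq_iff)
qed

lemma seg_orbit_opposite: "seg_orbit k l = {S k l, opposite ctr (S k l)}"
  by (simp add: seg_orbit_def opposite_S)

end

context colored_polygon
begin

lemma flip_color:
  assumes x: "(p, t) \<in> mstates Col" and c: "c \<in> Col"
  shows "flip M v ctr (Some c) (enc (p, t)) (enc (p, rot (Some c) t))"
proof -
  let ?c = "Some c"
  let ?T = "fst ` G p t"
  have t: "p < N" "rlab t = Some None" "distinct (inorder t)" "set_tree t = labels Col" "size1 t = N"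
    using x state_iff by auto
  have s': "size1 (rot ?c t) = N" using t(5) by simp
  have "?c \<in> set_tree t" "rlab t \<noteq> Some ?c" using t c by (simp_all add: labels_def)
  then obtain k l m n a b a' b' where *: "p \<le> k" "k < l" "l < m" "m < n" "n \<le> p + size1 t"
      "edge p t k l" "edge p t l m" "edge p t m n" "edge p t k n"
      "(a, b, a', b') = (k, m, l, n) \<or> (a, b, a', b') = (l, n, k, m)" "(a, b, ?c) \<in> ents p t"
      "ents p (rot ?c t) = insert (a', b', ?c) (ents p t - {(a, b, ?c)})"
    using ents_rot[OF t(3), of ?c p] by metis
  define d where "d = S a b"
  define d' where "d' = S a' b'"
  define f where "f = opposite ctr d"
  define f' where "f' = opposite ctr d'"
  have G': "G p (rot ?c t) = {d', f'} \<times> {?c} \<union> (G p t - {d, f} \<times> {?c})"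
    using G_replace[OF t(3) *(11,12)] unfolding seg_orbit_opposite d_def[symmetric] d'_def[symmetric] f_def[symmetric] f'_def[symmetric] .
  have d1: "(d, ?c) \<in> G p t" using G_I(1)[OF *(11)] unfolding d_def .
  note d = d1 G_opposite[OF d1, folded f_def]
  have d': "(d', ?c) \<in> G p (rot ?c t)" "(f', ?c) \<in> G p (rot ?c t)" unfolding G' by blast+
  have fn: "y = z" if "(e, y) \<in> G p t" "(e, z) \<in> G p t" for e y z
    by (rule G_functional[OF that]) (simp add: t)
  have fn': "y = z" if "(e, y) \<in> G p (rot ?c t)" "(e, z) \<in> G p (rot ?c t)" for e y z
    by (rule G_functional[OF that]) (simp add: t)
  have d_in: "d \<in> ?T" using d(1) by (metis fst_conv imageI)
  have nM: "n < k + M" "k + M < l + M" "m < k + M" using * t(5) N_ge by linarith+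
  note E = edge_S[OF *(6)] edge_S[OF *(7)] edge_S[OF *(8)] edge_S[OF *(9)]
  have od: "other_diagonal M v ?T d d'"
    using *(10)
  proof
    assume "(a, b, a', b') = (k, m, l, n)"
    then have eq: "d = S k m" "d' = S l n" by (simp_all add: d_def d'_def)
    show ?thesis using d_in unfolding eq
      by (rule other_diagonalI) (use *(2-4) nM E S_commute in simp_all)
  next
    assume "(a, b, a', b') = (l, n, k, m)"
    \<comment> \<open>The quadrilateral is read from \<open>l\<close> on, so its corner
      \<open>k\<close> comes last, as \<open>k + M\<close>.\<close>
    then have eq: "d = S l n" "d' = S m (k + M)" by (simp_all add: d_def d'_def S_commute)
    show ?thesis using d_in unfolding eq
      by (rule other_diagonalI) (use *(2-4) nM E S_commute in simp_all)
  qed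
  have nc: "\<not> central ctr d" using G_central[OF d(1) t(5,3)] t(2) by simp
  \<comment> \<open>A segment has only one label, so deleting \<open>d\<close> and \<open>f\<close>
    with label \<open>Some c\<close> deletes them from the triangulation.\<close>
  have T': "fst ` G p (rot ?c t) = (?T - {d, f}) \<union> {d', f'}"
  proof (rule Set.set_eqI)
    fix e
    have "e \<in> fst ` G p (rot ?c t) \<longleftrightarrow> (\<exists>y. (e, y) \<in> G p (rot ?c t))" by force
    also have "\<dots> \<longleftrightarrow> e \<in> {d', f'} \<or> (\<exists>y. (e, y) \<in> G p t \<and> \<not> (e \<in> {d, f} \<and> y = ?c))"
      unfolding G' by blast
    also have "\<dots> \<longleftrightarrow> e \<in> {d', f'} \<or> (\<exists>y. (e, y) \<in> G p t \<and> e \<notin> {d, f})"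
      using d fn by blast
    also have "\<dots> \<longleftrightarrow> e \<in> (?T - {d, f}) \<union> {d', f'}" by force
    finally show "e \<in> fst ` G p (rot ?c t) \<longleftrightarrow> e \<in> (?T - {d, f}) \<union> {d', f'}" .
  qed
  have \<kappa>': "coloring p (rot ?c t) =
      (coloring p t)(d := None, f := None, d' \<mapsto> c, f' \<mapsto> c)" (is "_ = ?\<kappa>")
  proof
    fix e
    have "coloring p (rot ?c t) e = Some y \<longleftrightarrow> ?\<kappa> e = Some y" for y
    proof (cases "e \<in> {d', f'}")
      case True
      then have "?\<kappa> e = Some c" by auto
      moreover have "(e, ?c) \<in> G p (rot ?c t)" using True d' by blast
      then have "(e, Some y) \<in> G p (rot ?c t) \<longleftrightarrow> y = c" using fn' by blast
      ultimately show ?thesis using coloring_iff[OF s'] by auto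
    next
      case False
      then have "(e, Some y) \<in> G p (rot ?c t) \<longleftrightarrow> (e, Some y) \<in> G p t \<and> \<not> (e \<in> {d, f} \<and> Some y = ?c)"
        unfolding G' by blast
      also have "\<dots> \<longleftrightarrow> (e, Some y) \<in> G p t \<and> e \<notin> {d, f}"
        using d fn by blast
      finally show ?thesis using False coloring_iff[OF s', of p e y] coloring_iff[OF t(5), of p e y] by auto
    qed
    then show "coloring p (rot ?c t) e = ?\<kappa> e" by (metis not_None_eq)
  qed
  have "flip M v ctr (Some c) (?T, coloring p t) ((?T - {d, f}) \<union> {d', f'},
      (coloring p t)(d := None, f := None, d' \<mapsto> c, f' \<mapsto> c))"
    unfolding f_def f'_def using nc _ od by (rule flip.pair_flip) (use d(1) coloring_iff[OF t(5)] in simp)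
  then show ?thesis unfolding enc_def fst_conv snd_conv T' \<kappa>' .
qed

lemma flip_central:
  assumes x: "(p, Node l None r) \<in> mstates Col"
  shows "flip M v ctr None (enc (p, Node l None r)) (enc ((p + size1 l) mod N, Node r None l))"
proof -
  let ?t = "Node l None r"
  let ?m = "p + size1 l"
  let ?T = "fst ` G p ?t"
  have t: "p < N" "distinct (inorder ?t)" "set_tree ?t = labels Col" "size1 l + size1 r = N"
    using x state_iff by auto
  have n: "None \<notin> set_tree l" "None \<notin> set_tree r" using t(2) by auto
  have pos: "0 < size1 l" "0 < size1 r" by simp_all
  have m: "p + size1 l + size1 r = p + N" "?m + size1 r + size1 l = ?m + N" using t(4) by linarith+
  \<comment> \<open>A central segment is its own reflection, so the central flip exchanges a single
    diagonal.\<close>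
  have orbit: "seg_orbit q (q + N) = {S q (q + N)}" for q
  proof -
    have "S (q + N) (q + N + N) = S (q + N) (q + M)" by (simp only: mult_2 add.assoc)
    also have "\<dots> = S q (q + N)" by (simp only: S_add S_commute)
    finally show ?thesis by (simp only: seg_orbit_def insert_absorb2)
  qed
  define d where "d = S p (p + N)"
  define d' where "d' = S ?m (?m + N)"
  have G: "G p ?t = {d} \<times> {None} \<union> G p l \<union> G ?m r"
    unfolding G_Node m orbit d_def ..
  \<comment> \<open>In the flipped state the left subtree starts at \<open>p + N\<close>, the
    reflection of its old place, so by \<open>G_shift\<close> its edges stay.\<close>
  have G': "G ?m (Node r None l) = {d'} \<times> {None} \<union> G ?m r \<union> G p l"
    unfolding G_Node unfolding m(2) unfolding orbit d'_def m(1) G_shift ..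
  have None: "(e, None) \<notin> G p l" "(e, None) \<notin> G ?m r" for e
    using n G_labels[of e None p l] G_labels[of e None ?m r] by blast+
  have cst: "cs_triangulation M v ctr ?T" using G_cs_triangulation[of ?t p] t(4) by simp
  have E: "S p ?m \<in> ?T \<union> sides M v" "S ?m (p + N) \<in> ?T \<union> sides M v"
    using edge_S[OF edge_child(1)[OF edge_root[of p l], of None r]]
      edge_S[OF edge_child(2)[OF edge_root[of ?m r], of None]] m(1) by simp_all
  have "S (p + N) (?m + N) \<in> ?T \<union> sides M v" using opposite_edge[OF cst E(1)] .
  moreover have "S (?m + N) (p + N + N) \<in> ?T \<union> sides M v" using opposite_edge[OF cst E(2)] .
  then have "S (?m + N) p \<in> ?T \<union> sides M v" by (metis S_add(2) add.assoc mult_2)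
  moreover have "d \<in> ?T" unfolding G by force
  moreover have "p < ?m" "?m < p + N" "p + N < ?m + N" "?m + N < p + M" using t(4) pos by linarith+
  ultimately have od: "other_diagonal M v ?T d d'"
    unfolding d_def d'_def using E by (intro other_diagonalI)
  have c: "central ctr d" using central_iff[of p "p + N"] N_ge unfolding d_def by simp
  \<comment> \<open>Segments have one label only, so \<open>d\<close>, which is labeled
    \<open>None\<close>, is no edge of a subtree.\<close>
  have "d \<notin> fst ` (G p l \<union> G ?m r)"
  proof
    assume "d \<in> fst ` (G p l \<union> G ?m r)"
    then obtain y where y: "(d, y) \<in> G p l \<union> G ?m r" by force
    then have "(d, y) \<in> G p ?t" "(d, None) \<in> G p ?t" unfolding G by blast+
    then have "y = None" by (rule G_functional) (use t(4) in simp)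
    then show False using y None by blast
  qed
  then have T': "fst ` G ?m (Node r None l) = insert d' (?T - {d})"
    unfolding G G' image_Un by auto
  have \<kappa>': "coloring ?m (Node r None l) = coloring p ?t"
    by (rule ext) (simp add: coloring_def G G' disj_commute)
  have "flip M v ctr None (?T, coloring p ?t) (insert d' (?T - {d}), coloring p ?t)"
    using c od by (rule flip.central_flip)
  then show ?thesis unfolding enc_mod unfolding enc_def fst_conv snd_conv T' \<kappa>' .
qed

lemma flip_enc:
  assumes "l \<in> labels Col" "x \<in> mstates Col"
  shows "flip M v ctr l (enc x) y \<longleftrightarrow> y = enc (mflip N l x)"
proof -
  have f: "flip M v ctr l (enc x) (enc (mflip N l x))"
  proof (cases l)
    case None
    from assms(2) show ?thesis
    proof (cases rule: st.stateE)
      case (1 p u w)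
      then show ?thesis using flip_central[of p u w] assms(2) None by simp
    qed
  next
    case (Some c)
    then have "c \<in> Col" using assms(1) by (auto simp: labels_def)
    then show ?thesis using flip_color[of "fst x" "snd x" c] assms(2) Some by (cases x) simp
  qed
  have "y = enc (mflip N l x)" if y: "flip M v ctr l (enc x) y"
  proof -
    obtain t \<kappa> where e: "enc x = (t, \<kappa>)" by (cases "enc x")
    have *: "(t, \<kappa>) \<in> colored_triangulations M v ctr Col" using enc_in[OF assms(2)] e by simp
    then have cst: "cs_triangulation M v ctr t"
      and \<kappa>: "\<And>d e. d \<in> dom \<kappa> \<Longrightarrow> e \<in> dom \<kappa> \<Longrightarrow> \<kappa> d = \<kappa> e \<Longrightarrow> e = d \<or> e = opposite ctr d"
      unfolding colored_triangulations_def by blast+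
    show ?thesis using flip_unique[OF cst \<kappa>] y f unfolding e by blast
  qed
  then show ?thesis using f by blast
qed

theorem states_cyclohedron_model: "cyclohedron_model (mstates Col) Col (mflip st.N) M v ctr enc"
proof unfold_locales
  show "bij_betw enc (mstates Col) (colored_triangulations M v ctr Col)" by (rule bij_enc)
  show "flip M v ctr l (enc x) y \<longleftrightarrow> y = enc (mflip st.N l x)" if "l \<in> labels Col" "x \<in> mstates Col" for l x y
    using flip_enc[OF that] by simp
qed

end

section \<open>The hexagon\<close>

lemma even_mod_6: "even (z mod 6) \<longleftrightarrow> even (z :: int)"
  by presburger

context states
begin

theorem automorphism_group_hexagon:
  assumes n: "card Col = 1" and model: "cyclohedron_model X Col F m v c enc"
  shows "order_automorphism_group (colorful_cyclohedron m v c Col) \<cong> dihedral_group 6"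
proof -
  interpret C: cyclohedron_model X Col F m v c enc by fact
  obtain a where Col: "Col = {a}" using n by (rule card_1_singletonE)
  have N: "N = 3" by (simp add: N_def n)
  have Lab: "labels Col = {None, Some a}" by (simp add: labels_def Col)
  define Y :: "int set" where "Y = {0..<6}"
  have Y: "Y = {0, 1, 2, 3, 4, 5}" by (auto simp: Y_def)
  have in_Y: "z mod 6 \<in> Y" for z by (simp add: Y_def)
  \<comment> \<open>The six states form a cycle in which the two kinds of flips alternate.\<close>
  define y where "y i = (nat ((- (i div 2)) mod 3),
    if even i then Node Leaf None (Node Leaf (Some a) Leaf) else Node (Node Leaf (Some a) Leaf) None Leaf)" for i :: int
  \<comment> \<open>The states 2k and 2k + 1 differ by the colored flip, and the other edges of the
    cycle are central flips. The position decreases with k: a central flip adds 1 on the way from 2k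
    down to 2k - 1, and adds 2, which is -1 modulo 3, on the way from 2k + 1 up.\<close>
  define f :: "'c option \<Rightarrow> int \<Rightarrow> int" where
    "f l i = (if even i \<longleftrightarrow> l \<noteq> None then i + 1 else i - 1) mod 6" for l i
  have f_closed: "f l i \<in> Y" for l i by (simp add: f_def in_Y)
  have f_invol: "f l (f l i) = i" if "i \<in> Y" for l i
    using that by (auto simp: Y f_def)
  have y_f: "y (f l i) = F l (y i)" if "i \<in> Y" "l \<in> labels Col" for l i
    using that unfolding Y Lab by (auto simp: y_def f_def N)
  have y_in: "y i \<in> X" if "i \<in> Y" for i
    using that unfolding Y by (auto simp: y_def mem_X N Lab)
  have y_inj: "inj_on y Y"
    by (rule inj_onI) (auto simp: Y y_def)
  have orb_y: "\<exists>j. j \<in> orb f (labels Col) i \<and> j \<in> Y \<and> x = y j" if i: "i \<in> Y" and x: "x \<in> orb F (labels Col) (y i)" for i x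
    using x
  proof (induction rule: orb_induct)
    case base
    show ?case using i by (intro exI[of _ i]) simp
  next
    case (step z l)
    then obtain j where "j \<in> orb f (labels Col) i" "j \<in> Y" "z = y j" by blast
    then show ?case using step.hyps(2) y_f[of j l] f_closed[of l j] orb_step[of j f "labels Col" i l]
      by (intro exI[of _ "f l j"]) simp
  qed
  have Y0: "0 \<in> Y" by (simp add: Y)
  have y_bij: "bij_betw y Y X"
  proof -
    have "x \<in> y ` Y" if "x \<in> X" for x
      using orb_y[OF Y0 connected[OF y_in[OF Y0] that]] by blast
    then show ?thesis using y_inj y_in by (auto simp: bij_betw_def)
  qed
  \<comment> \<open>In this second model both flips and symmetries are arithmetic modulo 6.\<close>
  interpret H: cyclohedron_model Y Col f m v c "enc \<circ> y"
  proof unfold_locales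
    show "f l i \<in> Y" for l i by (rule f_closed)
    show "f l (f l i) = i" if "i \<in> Y" for l i by (rule f_invol[OF that])
    show "j \<in> orb f (labels Col) i" if "i \<in> Y" "j \<in> Y" for i j
      using orb_y[OF that(1) connected[OF y_in[OF that(1)] y_in[OF that(2)]]] inj_onD[OF y_inj] that(2) by blast
    show "bij_betw (enc \<circ> y) Y (colored_triangulations m v c Col)"
      using y_bij C.bij_enc by (rule bij_betw_trans)
    show "flip m v c l ((enc \<circ> y) i) z \<longleftrightarrow> z = (enc \<circ> y) (f l i)" if "l \<in> labels Col" "i \<in> Y" for l i z
      using C.flip_enc[OF that(1) y_in[OF that(2)]] y_f[OF that(2,1)] by simp
  qed
  define swap :: "'c option \<Rightarrow> 'c option" where "swap l = (if l = None then Some a else None)" for l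
  \<comment> \<open>A rotation exchanges the two kinds of edges of the hexagon iff its amount is
    odd, the reflection of x to i - x iff i is even.\<close>
  define p where "p h = (\<lambda>l. if even (fst h) \<noteq> snd h then l else swap l)" for h :: "int \<times> bool"
  define g where "g h x = (if snd h then fst h - x else fst h + x) mod 6" for h :: "int \<times> bool" and x :: int
  let ?D = "dihedral_group 6"
  have carrier: "h \<in> carrier ?D \<longleftrightarrow> 0 \<le> fst h \<and> fst h < 6" for h
    by (cases h) (auto simp: dihedral_group_def)
  have mult: "h \<otimes>\<^bsub>?D\<^esub> k = ((if snd h then fst h - fst k else fst h + fst k) mod 6, snd h \<noteq> snd k)" for h k
    by (cases h; cases k) (simp add: dihedral_group_def)
  have compat: "H.compat (p h) (g h)" for h
  proof -
    have "p h l \<in> labels Col \<and> p h (p h l) = l" if "l \<in> labels Col" for l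
      using that by (auto simp: Lab p_def swap_def)
    then have "bij_betw (p h) (labels Col) (labels Col)"
      by (intro bij_betw_byWitness[where f' = "p h"]) auto
    moreover have "bij_betw (g h) Y Y"
    proof (rule bij_betw_byWitness[where f' = "g (if snd h then fst h else - fst h, snd h)"])
      have "x mod 6 = x" if "x \<in> Y" for x using that by (simp add: Y_def)
      then show "\<forall>x\<in>Y. g (if snd h then fst h else - fst h, snd h) (g h x) = x"
        "\<forall>x\<in>Y. g h (g (if snd h then fst h else - fst h, snd h) x) = x"
        by (auto simp: g_def mod_simps)
    qed (auto simp: g_def in_Y)
    moreover have "g h (f l x) = f (p h l) (g h x)" if "l \<in> labels Col" for l x
      using that unfolding Lab
      by (cases "snd h"; cases "even (fst h)"; cases "even x")
        (auto simp: g_def f_def p_def swap_def even_mod_6 mod_simps algebra_simps)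
    ultimately show ?thesis by (simp add: H.compat_def)
  qed
  show ?thesis
  proof (rule H.automorphism_group_iso[where p = p and g = g and ?x0.0 = 0])
    show "group ?D" by (rule group_dihedral_group) simp
    show "0 \<in> Y" by (rule Y0)
    show "H.compat (p h) (g h)" for h by (rule compat)
    show "p (h \<otimes>\<^bsub>?D\<^esub> k) l = p h (p k l)" if "l \<in> labels Col" for h k l
      using that by (cases "snd h"; cases "snd k") (auto simp: mult p_def swap_def even_mod_6 Lab)
    show "g (h \<otimes>\<^bsub>?D\<^esub> k) x = g h (g k x)" for h k x
      by (cases "snd h"; cases "snd k") (simp_all add: mult g_def mod_simps algebra_simps)
  next
    fix h k assume hk: "h \<in> carrier ?D" "k \<in> carrier ?D" "\<And>l. l \<in> labels Col \<Longrightarrow> p h l = p k l" "g h 0 = g k 0"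
    have "fst h = fst k" using hk(1,2,4) by (auto simp: carrier g_def split: if_splits)
    moreover have "p h None = p k None" using hk(3) by (simp add: Lab)
    ultimately have "snd h = snd k" by (auto simp: p_def swap_def split: if_splits)
    then show "h = k" using \<open>fst h = fst k\<close> by (simp add: prod_eq_iff)
  next
    fix q k assume qk: "H.compat q k"
    have k0: "k 0 \<in> Y" using qk Y0 by (metis H.compat_def bij_betwE)
    have q: "bij_betw q (labels Col) (labels Col)" using qk by (simp add: H.compat_def)
    \<comment> \<open>The image of 0 fixes the translation part; given its parity, the effect on the
      labels decides between rotation and reflection.\<close>
    define h where "h = (k 0, even (k 0) \<noteq> (q None = None))"
    have "p h l = q l" if "l \<in> labels Col" for l
      using that q by (auto simp: p_def h_def swap_def Lab bij_betw_def inj_on_def split: if_splits)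
    moreover have "h \<in> carrier ?D" using k0 by (simp add: carrier h_def Y_def)
    moreover have "g h 0 = k 0" using k0 by (simp add: g_def h_def Y_def)
    ultimately show "\<exists>h\<in>carrier ?D. (\<forall>l\<in>labels Col. p h l = q l) \<and> g h 0 = k 0" by blast
  qed
qed

end

theorem theorem15:
  fixes n :: nat and v :: "nat \<Rightarrow> complex" and ctr :: complex and Col :: "'c set"
  assumes "cs_convex_polygon (2 * n + 4) v ctr"
    and "finite Col" and "card Col = n"
  shows "(n > 1 \<longrightarrow> order_automorphism_group (colorful_cyclohedron (2 * n + 4) v ctr Col)
             \<cong> sym_group n \<times>\<times> dihedral_group (n + 2))
       \<and> (n = 1 \<longrightarrow> order_automorphism_group (colorful_cyclohedron (2 * n + 4) v ctr Col)
             \<cong> dihedral_group 6)"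
proof -
  have M: "2 * n + 4 = 2 * (n + 2)" by simp
  interpret colored_polygon "n + 2" v ctr Col
    by unfold_locales (use assms in \<open>simp_all add: M del: distrib_left_numeral\<close>)
  show ?thesis
    unfolding M using st.automorphism_group_large[OF _ states_cyclohedron_model]
      st.automorphism_group_hexagon[OF _ states_cyclohedron_model] assms(3) by simp
qed

end
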